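(* Let $L$ be a fixed graph and let $\mathcal{H}$ be a finite family of finite (not necessarily connected) simple graphs. Then there is a one-sided error property tester that, for any $L$-minor-free graph $G$, makes a number of queries to the random neighbor oracle bounded by a function of $\varepsilon$, $L$ and $\mathcal{H}$ only, accepts if $G$ is $\mathcal{H}$-free, and rejects with probability at least $2/3$ if $G$ is $\varepsilon$-far from $\mathcal{H}$-free.
   Context: $G$ is $L$-minor-free if $L$ cannot be obtained from $G$ by vertex deletions, edge deletions and edge contractions. Random neighbor oracle: for $G=(V,E)$, $V=\{1,\dots,n\}$, a query on $v$ returns a uniformly random neighbor of $v$, independently. $G$ is $\mathcal{H}$-free if it contains no subgraph isomorphic to any member of $\mathcal{H}$; it is $\varepsilon$-far from $\mathcal{H}$-free if more than $\varepsilon|V|$ edges must be deleted to obtain an $\mathcal{H}$-free graph. One-sided error: $\mathcal{H}$-free inputs are always accepted. *)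

theory Defs
  imports "HOL-Probability.Probability_Mass_Function"
begin

datatype 'a sgraph = SGraph (verts: "'a set") (edges: "'a set set")

definition simple_graph :: "'a sgraph \<Rightarrow> bool" where
  "simple_graph G \<longleftrightarrow> finite (verts G) \<and> (\<forall>e\<in>edges G. e \<subseteq> verts G \<and> card e = 2)"

definition neighbors :: "'a sgraph \<Rightarrow> 'a \<Rightarrow> 'a set" where
  "neighbors G v = {w. {v, w} \<in> edges G}"

definition isomorphic :: "'a sgraph \<Rightarrow> 'b sgraph \<Rightarrow> bool" where
  "isomorphic G H \<longleftrightarrow>
     (\<exists>f. bij_betw f (verts G) (verts H) \<and> (\<lambda>e. f ` e) ` edges G = edges H)"

definition subgraph :: "'a sgraph \<Rightarrow> 'a sgraph \<Rightarrow> bool" where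
  "subgraph S G \<longleftrightarrow> simple_graph S \<and> verts S \<subseteq> verts G \<and> edges S \<subseteq> edges G"

definition delete_vertex :: "'a sgraph \<Rightarrow> 'a \<Rightarrow> 'a sgraph" where
  "delete_vertex G v = SGraph (verts G - {v}) {e \<in> edges G. v \<notin> e}"

definition delete_edges :: "'a sgraph \<Rightarrow> 'a set set \<Rightarrow> 'a sgraph" where
  "delete_edges G D = SGraph (verts G) (edges G - D)"

text \<open>The vertex \<open>u\<close> plays the role of the merged vertex. Dropping \<open>{u, v}\<close> avoids the loop,
  and parallel edges are identified because the edges form a set.\<close>

definition contract_edge :: "'a sgraph \<Rightarrow> 'a \<Rightarrow> 'a \<Rightarrow> 'a sgraph" where
  "contract_edge G u v =
     SGraph (verts G - {v}) ((\<lambda>e. (id(v := u)) ` e) ` (edges G - {{u, v}}))"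

inductive minor_step :: "'a sgraph \<Rightarrow> 'a sgraph \<Rightarrow> bool" where
  vertex_deletion: "v \<in> verts G \<Longrightarrow> minor_step G (delete_vertex G v)"
| edge_deletion: "e \<in> edges G \<Longrightarrow> minor_step G (delete_edges G {e})"
| edge_contraction: "{u, v} \<in> edges G \<Longrightarrow> minor_step G (contract_edge G u v)"

definition minor_free :: "'b sgraph \<Rightarrow> 'a sgraph \<Rightarrow> bool" where
  "minor_free L G \<longleftrightarrow> \<not> (\<exists>M. minor_step\<^sup>*\<^sup>* G M \<and> isomorphic M L)"

definition family_free :: "'b sgraph set \<Rightarrow> 'a sgraph \<Rightarrow> bool" where
  "family_free \<H> G \<longleftrightarrow> \<not> (\<exists>H\<in>\<H>. \<exists>S. subgraph S G \<and> isomorphic S H)"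

definition far_from_family_free :: "real \<Rightarrow> 'b sgraph set \<Rightarrow> 'a sgraph \<Rightarrow> bool" where
  "far_from_family_free \<epsilon> \<H> G \<longleftrightarrow>
     (\<forall>D \<subseteq> edges G. family_free \<H> (delete_edges G D) \<longrightarrow>
        real (card D) > \<epsilon> * real (card (verts G)))"

text \<open>The oracle answers \<open>None\<close> exactly when the queried vertex has no neighbor.\<close>

definition random_neighbor :: "nat sgraph \<Rightarrow> nat \<Rightarrow> nat option pmf" where
  "random_neighbor G v =
     (if neighbors G v = {} then return_pmf None
      else map_pmf Some (pmf_of_set (neighbors G v)))"

text \<open>A randomized adaptive query algorithm is a well-founded decision tree: it either halts
  with a decision (\<open>True\<close> means accept), draws internal randomness from a discrete
  distribution that does not depend on the input graph (for instance a uniform vertex), or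
  queries the oracle, and continues depending on the outcome.\<close>

datatype query_alg =
    Decide bool
  | Sample "nat pmf" "nat \<Rightarrow> query_alg"
  | Query nat "nat option \<Rightarrow> query_alg"

text \<open>Joint distribution of the decision and the number of oracle queries made. Every query
  is answered by a fresh draw, so that answers are independent.\<close>

primrec run :: "nat sgraph \<Rightarrow> query_alg \<Rightarrow> (bool \<times> nat) pmf" where
  "run G (Decide b) = return_pmf (b, 0)"
| "run G (Sample p k) = bind_pmf p (\<lambda>x. run G (k x))"
| "run G (Query v k) =
     bind_pmf (random_neighbor G v) (\<lambda>a. map_pmf (\<lambda>(b, m). (b, Suc m)) (run G (k a)))"

end

theory Submission
  imports Defs
begin

text \<open>A graph without clique minor of order \<open>t\<close> has, for every \<open>r\<close>, a vertex order in which each vertex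
  strongly \<open>r\<close>-reaches boundedly many higher vertices, the hubs: repeatedly split off a union of
  geodesics towards the earlier blocks, which touch pairwise.

  If the graph is far from \<open>\<H>\<close>-free, it contains linearly many edge-disjoint copies of one pattern
  whose vertices carry prescribed colours and occur in a prescribed order. Process the colours from
  the lowest one upwards. At a vertex \<open>x\<close> of the current colour, a component of the part of the
  pattern below it is attached to \<open>x\<close> and to some hubs; by bounded reachability there are boundedly
  many choices of these hubs. For every choice that is seen by only a small fraction of the edges at
  \<open>x\<close>, delete these edges. In total few edges are deleted, so one copy survives. For that copy random
  neighbour queries from \<open>x\<close> find, with constant probability, a replacement for each component that is
  attached to the same hubs, and the colours make replacements of different components disjoint.\<close>

section \<open>Minor models\<close>

text \<open>Degrees are unbounded, so a query at a vertex of large degree cannot be expected to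
  return a prescribed neighbour, and the surviving copy itself need not be found. What must be found
  exactly are the hubs, because several components attach to them jointly. Hence an upward edge is
  kept only at vertices of degree at most \<open>1 / \<beta>\<close>, where one query returns the
  prescribed upper end with probability at least \<open>\<beta>\<close>. Below a vertex, any
  component with the same hubs is as good as the original one. A query may enter such a component
  away from its top; completing the part below the entry point reveals that part's attachments,
  which are fixed, and so the search climbs to the top. The order of the deletions matters: the
  components counted at colour \<open>h\<close> use only edges left after the deletions for lower
  colours, so each of them can itself be completed by the search. Order, colouring and pattern exist
  only in the analysis. The tester knows none of them: each step queries a random known vertex or
  draws a fresh one, and the edges found are searched for a member of \<open>\<H>\<close>.\<close>

definition adj_rel :: "'a set set \<Rightarrow> 'a set \<Rightarrow> ('a \<times> 'a) set" where
  "adj_rel E U = {(a, b). a \<in> U \<and> b \<in> U \<and> {a, b} \<in> E}"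

definition conn :: "'a set set \<Rightarrow> 'a set \<Rightarrow> bool" where
  "conn E X \<longleftrightarrow> X \<noteq> {} \<and> (\<forall>a\<in>X. \<forall>b\<in>X. (a, b) \<in> (adj_rel E X)\<^sup>*)"

definition touch :: "'a set set \<Rightarrow> 'a set \<Rightarrow> 'a set \<Rightarrow> bool" where
  "touch E A B \<longleftrightarrow> (\<exists>a\<in>A. \<exists>b\<in>B. {a, b} \<in> E)"

lemma touch_sym: "touch E A B \<longleftrightarrow> touch E B A"
  unfolding touch_def by (metis insert_commute)

lemma adj_rel_sym: "sym (adj_rel E U)"
  unfolding adj_rel_def sym_def by (auto simp: insert_commute)

lemma adj_rel_rtrancl_sym: "(a, b) \<in> (adj_rel E U)\<^sup>* \<Longrightarrow> (b, a) \<in> (adj_rel E U)\<^sup>*"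
  using adj_rel_sym sym_rtrancl by (metis symD)

lemma adj_rel_rtrancl_mono: "U \<subseteq> U' \<Longrightarrow> (adj_rel E U)\<^sup>* \<subseteq> (adj_rel E U')\<^sup>*"
  by (intro rtrancl_mono) (auto simp: adj_rel_def)

lemma adj_rel_rtrancl_in: "(a, b) \<in> (adj_rel E U)\<^sup>* \<Longrightarrow> a \<in> U \<Longrightarrow> b \<in> U"
  by (induction rule: rtrancl_induct) (auto simp: adj_rel_def)

lemma simple_graph_finite_edges: "simple_graph G \<Longrightarrow> finite (edges G)"
  unfolding simple_graph_def by (meson PowI finite_Pow_iff finite_subset subsetI)

definition minor_model :: "'b sgraph \<Rightarrow> 'a sgraph \<Rightarrow> ('b \<Rightarrow> 'a set) \<Rightarrow> bool" where
  "minor_model L G B \<longleftrightarrow>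
     (\<forall>i\<in>verts L. conn (edges G) (B i) \<and> B i \<subseteq> verts G) \<and>
     (\<forall>i\<in>verts L. \<forall>j\<in>verts L. i \<noteq> j \<longrightarrow> B i \<inter> B j = {}) \<and>
     (\<forall>i j. {i, j} \<in> edges L \<longrightarrow> touch (edges G) (B i) (B j))"

section \<open>Realising a minor model by minor steps\<close>

lemma simple_graph_delete_vertex: "simple_graph G \<Longrightarrow> simple_graph (delete_vertex G v)"
  unfolding simple_graph_def delete_vertex_def by auto

lemma simple_graph_delete_edges: "simple_graph G \<Longrightarrow> simple_graph (delete_edges G D)"
  unfolding simple_graph_def delete_edges_def by auto

lemma simple_graph_contract_edge:
  assumes "simple_graph G" "{u, v} \<in> edges G"
  shows "simple_graph (contract_edge G u v)"
proof -
  have uv: "u \<noteq> v" "u \<in> verts G" "v \<in> verts G"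
    using assms unfolding simple_graph_def by force+
  have "card ((id(v := u)) ` e) = 2" if e: "e \<in> edges G" "e \<noteq> {u, v}" for e
  proof -
    from e(1) assms(1) have "card e = 2" by (auto simp: simple_graph_def)
    then obtain a b where ab: "e = {a, b}" "a \<noteq> b" by (meson card_2_iff)
    have "(id(v := u)) a \<noteq> (id(v := u)) b" using ab e(2) by (auto simp: insert_commute)
    then show ?thesis unfolding ab(1) image_insert image_empty by simp
  qed
  moreover have "(id(v := u)) ` e \<subseteq> verts G - {v}" if "e \<in> edges G" for e
  proof -
    have "e \<subseteq> verts G" using that assms(1) unfolding simple_graph_def by auto
    then show ?thesis using uv by auto
  qed
  moreover have "finite (verts G)" using assms(1) unfolding simple_graph_def by simp
  ultimately show ?thesis
    unfolding simple_graph_def contract_edge_def sgraph.sel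
    by (intro conjI ballI finite_Diff) blast+
qed

lemma minor_model_delete_vertex:
  assumes "minor_model L G B" "\<And>i. i \<in> verts L \<Longrightarrow> v \<notin> B i" "simple_graph L"
  shows "minor_model L (delete_vertex G v) B"
proof -
  have "adj_rel (edges (delete_vertex G v)) X = adj_rel (edges G) X" if "v \<notin> X" for X
    using that by (auto simp: adj_rel_def delete_vertex_def)
  then have "conn (edges (delete_vertex G v)) (B i)" if "i \<in> verts L" for i
    using assms that unfolding minor_model_def conn_def by auto
  moreover have "touch (edges (delete_vertex G v)) (B i) (B j)" if "{i, j} \<in> edges L" for i j
  proof -
    have "i \<in> verts L" "j \<in> verts L" using that assms(3) unfolding simple_graph_def by auto
    moreover have "touch (edges G) (B i) (B j)" using that assms(1) unfolding minor_model_def by auto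
    ultimately show ?thesis
      using assms(2) unfolding touch_def delete_vertex_def by auto
  qed
  moreover have "B i \<subseteq> verts (delete_vertex G v)" if "i \<in> verts L" for i
    using that assms(1,2) unfolding minor_model_def delete_vertex_def by auto
  ultimately show ?thesis using assms(1) unfolding minor_model_def by auto
qed

text \<open>Both ends lie in one branch set, so the merging map sends every branch set into itself
  without \<open>v\<close>. It turns walks into walks, the contracted edge becoming a trivial
  step.\<close>

lemma minor_model_contract_edge:
  assumes "minor_model L G B" "simple_graph L" "simple_graph G"
    and uv: "{u, v} \<in> edges G" "i0 \<in> verts L" "u \<in> B i0" "v \<in> B i0"
  shows "minor_model L (contract_edge G u v) (\<lambda>i. B i - {v})"
proof -
  let ?f = "id(v := u)" and ?G = "contract_edge G u v"
  have neq: "u \<noteq> v" using uv assms(3) unfolding simple_graph_def by force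
  have f_in: "?f p \<in> B i - {v}" if "p \<in> B i" "i \<in> verts L" for p i
  proof (cases "p = v")
    case True
    then have "i = i0" using that assms(1) uv unfolding minor_model_def by blast
    then show ?thesis using True uv neq by auto
  next
    case False
    then show ?thesis using that by auto
  qed
  have f_edge: "{?f p, ?f q} \<in> edges ?G" if "{p, q} \<in> edges G" "{p, q} \<noteq> {u, v}" for p q
  proof -
    have "?f ` {p, q} \<in> edges ?G" unfolding contract_edge_def sgraph.sel
      by (intro imageI) (use that in blast)
    then show ?thesis by (simp only: image_insert image_empty)
  qed
  have "conn (edges ?G) (B i - {v})" if i: "i \<in> verts L" for i
  proof -
    have c: "conn (edges G) (B i)" using assms(1) i unfolding minor_model_def by auto
    have step_rel: "(?f p, ?f q) \<in> (adj_rel (edges ?G) (B i - {v}))\<^sup>*"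
      if "(p, q) \<in> adj_rel (edges G) (B i)" for p q
    proof (cases "{p, q} = {u, v}")
      case True
      then have "?f p = ?f q" by (auto simp: doubleton_eq_iff)
      then show ?thesis by (simp only: rtrancl.rtrancl_refl)
    next
      case False
      have "{p, q} \<in> edges G" "p \<in> B i" "q \<in> B i" using that unfolding adj_rel_def by auto
      then have "(?f p, ?f q) \<in> adj_rel (edges ?G) (B i - {v})"
        using False f_edge[of p q] f_in[OF _ i] unfolding adj_rel_def by blast
      then show ?thesis by (rule r_into_rtrancl)
    qed
    have star: "(?f p, ?f q) \<in> (adj_rel (edges ?G) (B i - {v}))\<^sup>*"
      if "(p, q) \<in> (adj_rel (edges G) (B i))\<^sup>*" for p q
      using that
    proof (induction rule: rtrancl_induct)
      case base show ?case by (rule rtrancl.rtrancl_refl)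
    next
      case (step y z)
      from step(3) step_rel[OF step(2)] show ?case by (rule rtrancl_trans)
    qed
    have "(a, b) \<in> (adj_rel (edges ?G) (B i - {v}))\<^sup>*" if "a \<in> B i - {v}" "b \<in> B i - {v}" for a b
    proof -
      have "(a, b) \<in> (adj_rel (edges G) (B i))\<^sup>*" using that c unfolding conn_def by blast
      then show ?thesis using star[of a b] that by simp
    qed
    moreover have "B i - {v} \<noteq> {}" using f_in c i unfolding conn_def by blast
    ultimately show ?thesis unfolding conn_def by auto
  qed
  moreover have "touch (edges ?G) (B i - {v}) (B j - {v})" if ij: "{i, j} \<in> edges L" for i j
  proof -
    have ijL: "i \<in> verts L" "j \<in> verts L" "i \<noteq> j" using ij assms(2) unfolding simple_graph_def by force+
    obtain p q where pq: "p \<in> B i" "q \<in> B j" "{p, q} \<in> edges G"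
      using assms(1) ij unfolding minor_model_def touch_def by blast
    have "{p, q} \<noteq> {u, v}"
    proof
      assume "{p, q} = {u, v}"
      then have "p \<in> B i0" "q \<in> B i0" using uv by (auto simp: doubleton_eq_iff)
      moreover have "i \<noteq> i0 \<or> j \<noteq> i0" using ijL by blast
      ultimately show False using pq ijL(1,2) uv(2) assms(1) unfolding minor_model_def by blast
    qed
    then show ?thesis using f_edge f_in pq ijL unfolding touch_def by blast
  qed
  moreover have "B i - {v} \<subseteq> verts ?G" if "i \<in> verts L" for i
    using that assms(1) unfolding minor_model_def contract_edge_def by auto
  moreover have "(B i - {v}) \<inter> (B j - {v}) = {}" if "i \<in> verts L" "j \<in> verts L" "i \<noteq> j" for i j
    using that assms(1) unfolding minor_model_def by blast
  ultimately show ?thesis unfolding minor_model_def by simp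
qed

text \<open>Greedy: delete a vertex outside all branch sets; otherwise contract an edge inside a
  branch set with two vertices; otherwise all branch sets are singletons and surplus edges are
  deleted until the graph is the image of \<open>L\<close>.\<close>

lemma minor_of_model:
  assumes "simple_graph L" "simple_graph G" "minor_model L G B"
  shows "\<exists>M. minor_step\<^sup>*\<^sup>* G M \<and> isomorphic M L"
  using assms(2,3)
proof (induction "card (verts G) + card (edges G)" arbitrary: G B rule: less_induct)
  case less
  have fin: "finite (verts G)" "finite (edges G)"
    using less.prems simple_graph_finite_edges simple_graph_def by auto
  show ?case
  proof (cases "\<exists>v\<in>verts G. \<forall>i\<in>verts L. v \<notin> B i")
    case True
    then obtain v where v: "v \<in> verts G" "\<forall>i\<in>verts L. v \<notin> B i" by blast
    have "card (verts (delete_vertex G v)) < card (verts G)"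
      using card_Diff1_less[OF fin(1) v(1)] by (simp add: delete_vertex_def)
    moreover have "card (edges (delete_vertex G v)) \<le> card (edges G)"
      using fin by (auto simp: delete_vertex_def intro: card_mono)
    ultimately have "\<exists>M. minor_step\<^sup>*\<^sup>* (delete_vertex G v) M \<and> isomorphic M L"
      using less v minor_model_delete_vertex[OF less.prems(2) _ assms(1)]
      by (intro less.hyps[of _ B]) (auto intro: simple_graph_delete_vertex)
    then show ?thesis using minor_step.vertex_deletion[OF v(1)]
      by (meson converse_rtranclp_into_rtranclp)
  next
    case cover: False
    show ?thesis
    proof (cases "\<exists>i\<in>verts L. \<exists>u\<in>B i. \<exists>v\<in>B i. u \<noteq> v")
      case True
      then obtain i u w where i: "i \<in> verts L" "u \<in> B i" "w \<in> B i" "u \<noteq> w" by blast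
      then have "(u, w) \<in> (adj_rel (edges G) (B i))\<^sup>*"
        using less.prems(2) unfolding minor_model_def conn_def by blast
      then obtain v where v: "v \<in> B i" "{u, v} \<in> edges G"
        using i(4) by (metis (mono_tags, lifting) adj_rel_def case_prodD converse_rtranclE mem_Collect_eq)
      have sub: "v \<in> verts G" using v i less.prems(2) unfolding minor_model_def by auto
      have "card (verts (contract_edge G u v)) < card (verts G)"
        using card_Diff1_less[OF fin(1) sub] by (simp add: contract_edge_def)
      moreover have "card (edges (contract_edge G u v)) \<le> card (edges G)"
        using fin unfolding contract_edge_def
        by (metis card_Diff1_le card_image_le finite_Diff le_trans sgraph.sel(2))
      ultimately have "\<exists>M. minor_step\<^sup>*\<^sup>* (contract_edge G u v) M \<and> isomorphic M L"
        using less.prems v i minor_model_contract_edge[OF less.prems(2) assms(1) less.prems(1) v(2) i(1,2) v(1)]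
        by (intro less.hyps[of _ "\<lambda>i. B i - {v}"]) (auto intro: simple_graph_contract_edge)
      then show ?thesis using minor_step.edge_contraction[OF v(2)]
        by (meson converse_rtranclp_into_rtranclp)
    next
      case False
      have "\<forall>i\<in>verts L. \<exists>a. B i = {a}"
      proof
        fix i assume i: "i \<in> verts L"
        then obtain a where "a \<in> B i" using less.prems(2) unfolding minor_model_def conn_def by blast
        then have "B i = {a}" using False i by blast
        then show "\<exists>a. B i = {a}" by blast
      qed
      then obtain f where f: "\<And>i. i \<in> verts L \<Longrightarrow> B i = {f i}" by metis
      have inj: "inj_on f (verts L)"
        using less.prems(2) f unfolding minor_model_def inj_on_def by blast
      have im: "f ` verts L = verts G"
        using cover f less.prems(2) unfolding minor_model_def by fastforce
      have eL: "f ` e \<in> edges G" if e: "e \<in> edges L" for e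
      proof -
        have "card e = 2" "e \<subseteq> verts L" using e assms(1) unfolding simple_graph_def by auto
        then obtain i j where ij: "e = {i, j}" "i \<in> verts L" "j \<in> verts L"
          by (metis card_2_iff insert_subset)
        then have "touch (edges G) (B i) (B j)" using e less.prems(2) unfolding minor_model_def by auto
        then show ?thesis using ij f unfolding touch_def by auto
      qed
      show ?thesis
      proof (cases "edges G \<subseteq> (\<lambda>e. f ` e) ` edges L")
        case True
        then have eq: "edges G = (\<lambda>e. f ` e) ` edges L" using eL by auto
        have b: "bij_betw f (verts L) (verts G)" using inj im by (simp add: bij_betw_def)
        let ?g = "inv_into (verts L) f"
        have "?g ` f ` e = e" if "e \<in> edges L" for e
          using that assms(1) inj unfolding simple_graph_def by (meson inv_into_image_cancel)
        then have "(\<lambda>e. ?g ` e) ` edges G = edges L"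
          unfolding eq image_image by force
        then have "isomorphic G L"
          unfolding isomorphic_def using bij_betw_inv_into[OF b] by blast
        then show ?thesis by blast
      next
        case False
        then obtain e where e: "e \<in> edges G" "e \<notin> (\<lambda>e. f ` e) ` edges L" by blast
        have "card (edges (delete_edges G {e})) < card (edges G)"
          using card_Diff1_less[OF fin(2) e(1)] by (simp add: delete_edges_def)
        moreover have "minor_model L (delete_edges G {e}) B"
        proof -
          have "conn (edges (delete_edges G {e})) (B i)" if "i \<in> verts L" for i
            using f[OF that] unfolding conn_def by auto
          moreover have "touch (edges (delete_edges G {e})) (B i) (B j)" if ij: "{i, j} \<in> edges L" for i j
          proof -
            have "i \<in> verts L" "j \<in> verts L" using ij assms(1) unfolding simple_graph_def by auto
            moreover have "f ` {i, j} \<in> edges G - {e}" using eL e(2) ij by blast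
            ultimately show ?thesis using f unfolding touch_def delete_edges_def by auto
          qed
          ultimately show ?thesis using less.prems(2) unfolding minor_model_def delete_edges_def by auto
        qed
        ultimately have "\<exists>M. minor_step\<^sup>*\<^sup>* (delete_edges G {e}) M \<and> isomorphic M L"
          using simple_graph_delete_edges[OF less.prems(1)]
          by (intro less.hyps[of _ B]) (auto simp: delete_edges_def)
        then show ?thesis using minor_step.edge_deletion[OF e(1)]
          by (meson converse_rtranclp_into_rtranclp)
      qed
    qed
  qed
qed

text \<open>Pairwise touching sets model a complete graph, so \<open>card (verts L)\<close> of them
  model \<open>L\<close> whatever its edges are.\<close>

lemma minor_free_card_touching:
  assumes "simple_graph L" "simple_graph G" "minor_free L G"
    and S: "\<And>X. X \<in> \<S> \<Longrightarrow> conn (edges G) X \<and> X \<subseteq> verts G"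
    and dis: "\<And>X Y. X \<in> \<S> \<Longrightarrow> Y \<in> \<S> \<Longrightarrow> X \<noteq> Y \<Longrightarrow> X \<inter> Y = {} \<and> touch (edges G) X Y"
  shows "card \<S> < card (verts L)"
proof (rule ccontr)
  assume "\<not> ?thesis"
  then have ge: "card (verts L) \<le> card \<S>" by simp
  have finS: "finite \<S>"
    using S assms(2) unfolding simple_graph_def
    by (meson PowI finite_Pow_iff finite_subset subsetI)
  have finL: "finite (verts L)" using assms(1) unfolding simple_graph_def by auto
  obtain B where B: "inj_on B (verts L)" "B ` verts L \<subseteq> \<S>"
    using card_le_inj[OF finL finS ge] by blast
  have "minor_model L G B"
    unfolding minor_model_def
  proof (intro conjI ballI allI impI)
    fix i j assume ij: "{i, j} \<in> edges L"
    then have "i \<in> verts L" "j \<in> verts L" "i \<noteq> j" using assms(1) unfolding simple_graph_def by force+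
    then show "touch (edges G) (B i) (B j)" using B dis[of "B i" "B j"] by (auto dest: inj_onD)
  next
    fix i j assume "i \<in> verts L" "j \<in> verts L" "i \<noteq> j"
    then show "B i \<inter> B j = {}" using B dis[of "B i" "B j"] by (auto dest: inj_onD)
  qed (use B S in auto)
  then show False using minor_of_model assms(1-3) unfolding minor_free_def by blast
qed

section \<open>A vertex order with bounded strong reachability\<close>

text \<open>Only the target of a step is restricted to \<open>U\<close>: later walks start at a
  vertex \<open>x\<close> outside the set of vertices of smaller rank than \<open>x\<close>.\<close>

definition via :: "'a set set \<Rightarrow> 'a set \<Rightarrow> ('a \<times> 'a) set" where
  "via E U = {(a, b). b \<in> U \<and> {a, b} \<in> E}"

text \<open>Strong reachability: walks with at most \<open>r\<close> edges whose inner vertices lie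
  in \<open>U\<close>, while both ends are free.\<close>

definition sreach :: "'a set set \<Rightarrow> 'a set \<Rightarrow> nat \<Rightarrow> 'a \<Rightarrow> 'a set" where
  "sreach E U r x = {z. \<exists>m<r. \<exists>u. (x, u) \<in> via E U ^^ m \<and> {u, z} \<in> E}"

lemma relpow_subset:
  fixes R S :: "('a \<times> 'a) set"
  shows "R \<subseteq> S \<Longrightarrow> R ^^ m \<subseteq> S ^^ m"
  by (induction m) auto

lemma via_mono: "U \<subseteq> U' \<Longrightarrow> via E U \<subseteq> via E U'"
  by (auto simp: via_def)

lemma sreach_mono:
  assumes "U \<subseteq> U'"
  shows "sreach E U r x \<subseteq> sreach E U' r x"
proof
  fix z assume "z \<in> sreach E U r x"
  then obtain m u where "m < r" "(x, u) \<in> via E U ^^ m" "{u, z} \<in> E"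
    unfolding sreach_def by blast
  moreover have "via E U ^^ m \<subseteq> via E U' ^^ m" for m
    using via_mono[OF assms] by (rule relpow_subset)
  ultimately show "z \<in> sreach E U' r x" unfolding sreach_def by blast
qed

lemma via_relpow_adj_rel:
  assumes "x \<in> U"
  shows "(x, u) \<in> via E U ^^ m \<longleftrightarrow> (x, u) \<in> adj_rel E U ^^ m"
proof
  assume "(x, u) \<in> via E U ^^ m"
  then have "(x, u) \<in> adj_rel E U ^^ m \<and> u \<in> U"
    by (induction m arbitrary: u) (use assms in \<open>auto simp: adj_rel_def via_def\<close>)
  then show "(x, u) \<in> adj_rel E U ^^ m" ..
next
  have "adj_rel E U \<subseteq> via E U" by (auto simp: adj_rel_def via_def)
  then show "(x, u) \<in> adj_rel E U ^^ m \<Longrightarrow> (x, u) \<in> via E U ^^ m"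
    using relpow_subset by blast
qed

section \<open>Walk distance and geodesics\<close>

lemma relpow_sym_rel:
  assumes "sym R" "(a, b) \<in> R ^^ m"
  shows "(b, a) \<in> R ^^ m"
  using assms(2)
proof (induction m arbitrary: b)
  case (Suc m)
  then obtain c where c: "(a, c) \<in> R ^^ m" "(c, b) \<in> R" by auto
  then have "(b, c) \<in> R" using assms(1) by (meson symD)
  then show ?case using Suc.IH[OF c(1)] by (meson relpow_Suc_I2)
qed simp

definition gdist :: "('a \<times> 'a) set \<Rightarrow> 'a \<Rightarrow> 'a \<Rightarrow> nat" where
  "gdist R v u = (LEAST m. (v, u) \<in> R ^^ m)"

lemma gdist_relpow: "(v, u) \<in> R\<^sup>* \<Longrightarrow> (v, u) \<in> R ^^ gdist R v u"
  unfolding gdist_def by (metis LeastI rtrancl_imp_relpow)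

lemma gdist_le: "(v, u) \<in> R ^^ m \<Longrightarrow> gdist R v u \<le> m"
  unfolding gdist_def by (rule Least_le)

lemma gdist_step:
  assumes "(v, u) \<in> R ^^ m"  "(u, w) \<in> R ^^ l"
  shows "gdist R v w \<le> gdist R v u + l"
proof -
  have "(v, u) \<in> R ^^ gdist R v u" using assms(1) gdist_relpow relpow_imp_rtrancl by metis
  then have "(v, w) \<in> R ^^ (gdist R v u + l)" using assms(2) by (auto simp: relpow_add)
  then show ?thesis by (rule gdist_le)
qed

lemma gdist_pred:
  assumes "(v, u) \<in> R\<^sup>*" "gdist R v u = Suc m"
  obtains w where "(v, w) \<in> R\<^sup>*" "(w, u) \<in> R" "gdist R v w = m"
proof -
  have "(v, u) \<in> R ^^ Suc m" using gdist_relpow[OF assms(1)] assms(2) by simp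
  then obtain w where w: "(v, w) \<in> R ^^ m" "(w, u) \<in> R" by auto
  have "gdist R v w \<le> m" using w by (simp add: gdist_le)
  moreover have "gdist R v u \<le> gdist R v w + 1" using gdist_step[OF w(1), of u 1] w by simp
  ultimately have "gdist R v w = m" using assms(2) by simp
  then show ?thesis using that w relpow_imp_rtrancl by metis
qed

text \<open>\<open>Q\<close> is the vertex set of a shortest walk, built by induction on the
  distance. Injectivity of the distance is the property exploited later: \<open>Q\<close> has at
  most one vertex at each distance from \<open>v\<close>.\<close>

lemma geodesic:
  assumes "sym R" "(v, c) \<in> R\<^sup>*" "gdist R v c = m"
  shows "\<exists>Q. c \<in> Q \<and> (\<forall>z\<in>Q. (v, z) \<in> R\<^sup>* \<and> (v, z) \<in> {(a, b). (a, b) \<in> R \<and> a \<in> Q \<and> b \<in> Q}\<^sup>*) \<and>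
      v \<in> Q \<and> inj_on (gdist R v) Q \<and> (\<forall>z\<in>Q. gdist R v z \<le> m)"
  using assms(2,3)
proof (induction m arbitrary: c)
  case 0
  then have "c = v" using gdist_relpow[OF 0(1)] by simp
  then show ?case using 0 by (intro exI[of _ "{v}"]) auto
next
  case (Suc m)
  obtain w where w: "(v, w) \<in> R\<^sup>*" "(w, c) \<in> R" "gdist R v w = m"
    using gdist_pred[OF Suc.prems] by blast
  obtain Q where Q: "w \<in> Q" "\<And>z. z \<in> Q \<Longrightarrow> (v, z) \<in> R\<^sup>*"
    "\<And>z. z \<in> Q \<Longrightarrow> (v, z) \<in> {(a, b). (a, b) \<in> R \<and> a \<in> Q \<and> b \<in> Q}\<^sup>*"
    "v \<in> Q" "inj_on (gdist R v) Q" "\<And>z. z \<in> Q \<Longrightarrow> gdist R v z \<le> m"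
    using Suc.IH[OF w(1,3)] by auto
  let ?Q = "insert c Q"
  let ?S = "\<lambda>Q. {(a, b). (a, b) \<in> R \<and> a \<in> Q \<and> b \<in> Q}"
  have mono: "(?S Q)\<^sup>* \<subseteq> (?S ?Q)\<^sup>*" by (rule rtrancl_mono) auto
  have "(v, c) \<in> (?S ?Q)\<^sup>*"
  proof (rule rtrancl_into_rtrancl)
    show "(v, w) \<in> (?S ?Q)\<^sup>*" using mono Q by blast
    show "(w, c) \<in> ?S ?Q" using w Q by auto
  qed
  moreover have "(v, z) \<in> (?S ?Q)\<^sup>*" if "z \<in> Q" for z using mono Q(3)[OF that] by blast
  moreover have "inj_on (gdist R v) ?Q"
  proof -
    have "gdist R v c \<notin> gdist R v ` Q" using Q(6) Suc.prems(2) by force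
    then show ?thesis using Q(5) unfolding inj_on_insert by blast
  qed
  moreover have "gdist R v z \<le> Suc m" if "z \<in> ?Q" for z using that Q(6) Suc.prems(2) by force
  ultimately show ?case using Q(2,4) Suc.prems(1) by (intro exI[of _ ?Q]) auto
qed

lemma conn_component:
  assumes "v \<in> U"
  shows "conn E {u. (v, u) \<in> (adj_rel E U)\<^sup>*}"
proof -
  let ?C = "{u. (v, u) \<in> (adj_rel E U)\<^sup>*}"
  have "(v, u) \<in> (adj_rel E ?C)\<^sup>*" if "(v, u) \<in> (adj_rel E U)\<^sup>*" for u
    using that
  proof (induction rule: rtrancl_induct)
    case (step y z)
    have "(v, z) \<in> (adj_rel E U)\<^sup>*" using step(1,2) by (rule rtrancl_into_rtrancl)
    then have "(y, z) \<in> adj_rel E ?C" using step(1,2) unfolding adj_rel_def by blast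
    then show ?case using step.IH by (meson rtrancl_into_rtrancl)
  qed simp
  then have "(a, b) \<in> (adj_rel E ?C)\<^sup>*" if "a \<in> ?C" "b \<in> ?C" for a b
    using that adj_rel_rtrancl_sym by (metis (no_types, lifting) mem_Collect_eq rtrancl_trans)
  then show ?thesis unfolding conn_def by auto
qed

text \<open>The state of the cop-and-robber style decomposition: \<open>U\<close> is the set of vertices still to be
  ordered and \<open>\<B>\<close> the set of blocks removed so far. Blocks that see a common connected piece of
  \<open>U\<close> touch each other, so a clique minor bounds their number.\<close>

definition decomp_state ::
  "'a set set \<Rightarrow> 'a set \<Rightarrow> nat \<Rightarrow> nat \<Rightarrow> 'a set \<Rightarrow> 'a set set \<Rightarrow> bool" where
  "decomp_state E V r K U \<B> \<longleftrightarrow> U \<subseteq> V \<and> V - U \<subseteq> \<Union>\<B> \<and>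
     (\<forall>B\<in>\<B>. conn E B \<and> B \<subseteq> V - U) \<and>
     (\<forall>B\<in>\<B>. \<forall>B'\<in>\<B>. B \<noteq> B' \<longrightarrow> B \<inter> B' = {}) \<and>
     (\<forall>X B B'. X \<subseteq> U \<longrightarrow> conn E X \<longrightarrow> B \<in> \<B> \<longrightarrow> B' \<in> \<B> \<longrightarrow> B \<noteq> B' \<longrightarrow>
        touch E X B \<longrightarrow> touch E X B' \<longrightarrow> touch E B B') \<and>
     (\<forall>B\<in>\<B>. \<forall>x\<in>U. card (sreach E U r x \<inter> B) \<le> K)"

lemma decomp_stateD:
  assumes "decomp_state E V r K U \<B>"
  shows "U \<subseteq> V" "V - U \<subseteq> \<Union>\<B>"
    "\<And>B. B \<in> \<B> \<Longrightarrow> conn E B" "\<And>B. B \<in> \<B> \<Longrightarrow> B \<subseteq> V - U"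
    "\<And>B B'. B \<in> \<B> \<Longrightarrow> B' \<in> \<B> \<Longrightarrow> B \<noteq> B' \<Longrightarrow> B \<inter> B' = {}"
    "\<And>X B B'. X \<subseteq> U \<Longrightarrow> conn E X \<Longrightarrow> B \<in> \<B> \<Longrightarrow> B' \<in> \<B> \<Longrightarrow> B \<noteq> B' \<Longrightarrow>
        touch E X B \<Longrightarrow> touch E X B' \<Longrightarrow> touch E B B'"
    "\<And>B x. B \<in> \<B> \<Longrightarrow> x \<in> U \<Longrightarrow> card (sreach E U r x \<inter> B) \<le> K"
  using assms unfolding decomp_state_def by simp_all

text \<open>The form in which excluding the minor \<open>L\<close> enters the ordering: fewer than
  \<open>t\<close> branch sets in any model of a complete graph.\<close>

definition bounded_clique_minors :: "'a set set \<Rightarrow> 'a set \<Rightarrow> nat \<Rightarrow> bool" where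
  "bounded_clique_minors E V t \<longleftrightarrow>
     (\<forall>\<S>. (\<forall>X\<in>\<S>. conn E X \<and> X \<subseteq> V) \<longrightarrow>
        (\<forall>X\<in>\<S>. \<forall>Y\<in>\<S>. X \<noteq> Y \<longrightarrow> X \<inter> Y = {} \<and> touch E X Y) \<longrightarrow> card \<S> < t)"

lemma decomp_state_card_touching:
  assumes "bounded_clique_minors E V t" "decomp_state E V r K U \<B>" "X \<subseteq> U" "conn E X" "finite V"
  shows "finite {B\<in>\<B>. touch E X B}" "card {B\<in>\<B>. touch E X B} < t"
proof -
  note st = decomp_stateD[OF assms(2)]
  let ?T = "{B\<in>\<B>. touch E X B}"
  have sub: "conn E B \<and> B \<subseteq> V" if "B \<in> ?T" for B
    using st(3,4)[of B] that by auto
  have "?T \<subseteq> Pow V" using sub by auto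
  then show "finite ?T" using assms(5) by (simp add: finite_subset)
  have "A \<inter> B = {} \<and> touch E A B" if AB: "A \<in> ?T" "B \<in> ?T" "A \<noteq> B" for A B
    using AB st(5)[of A B] st(6)[OF assms(3,4), of A B] by simp
  then show "card ?T < t"
    using assms(1) sub unfolding bounded_clique_minors_def by simp
qed

text \<open>\<open>H\<close> consists of \<open>v\<close> and one geodesic from \<open>v\<close> to
  each of the fewer than \<open>t\<close> blocks that \<open>C\<close> touches. Vertices of
  \<open>C\<close> reached from the same \<open>x\<close> differ in their distance from
  \<open>v\<close> by at most \<open>2 * r\<close>, so a geodesic contains at most
  \<open>4 * r + 1\<close> of them.\<close>

lemma decomp_block:
  assumes "finite V" "bounded_clique_minors E V t" "decomp_state E V r K U \<B>" "v \<in> U"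
  defines "C \<equiv> {u. (v, u) \<in> (adj_rel E U)\<^sup>*}"
  obtains H where "v \<in> H" "H \<subseteq> C" "conn E H"
    "\<And>B. B \<in> \<B> \<Longrightarrow> touch E C B \<Longrightarrow> touch E H B"
    "\<And>x. x \<in> U \<Longrightarrow> card (sreach E U r x \<inter> H) \<le> t * (4 * r + 1)"
proof -
  let ?R = "adj_rel E U"
  define T where "T = {B\<in>\<B>. touch E C B}"
  have U: "U \<subseteq> V" "finite U" using assms(1) decomp_stateD(1)[OF assms(3)] by (auto intro: finite_subset)
  have CU: "C \<subseteq> U" using adj_rel_rtrancl_in assms(4) unfolding C_def by fast
  have connC: "conn E C" unfolding C_def by (rule conn_component[OF assms(4)])
  have T: "finite T" "card T < t"
    unfolding T_def using decomp_state_card_touching[OF assms(2,3) CU connC assms(1)] by auto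
  have "\<exists>Q. \<forall>B\<in>T. v \<in> Q B \<and> Q B \<subseteq> C \<and> conn E (Q B) \<and> touch E (Q B) B \<and> inj_on (gdist ?R v) (Q B)"
  proof (rule bchoice, rule ballI)
    fix B assume "B \<in> T"
    then obtain c b where c: "c \<in> C" "b \<in> B" "{c, b} \<in> E" unfolding T_def touch_def by blast
    let ?S = "\<lambda>Q. {(a, b). (a, b) \<in> ?R \<and> a \<in> Q \<and> b \<in> Q}"
    obtain Q where Q: "c \<in> Q" "\<And>z. z \<in> Q \<Longrightarrow> (v, z) \<in> ?R\<^sup>*" "\<And>z. z \<in> Q \<Longrightarrow> (v, z) \<in> (?S Q)\<^sup>*"
      "v \<in> Q" "inj_on (gdist ?R v) Q"
      using geodesic[OF adj_rel_sym, of v c E U] c(1) unfolding C_def by auto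
    have "?S Q \<subseteq> adj_rel E Q" by (auto simp: adj_rel_def)
    then have "(v, z) \<in> (adj_rel E Q)\<^sup>*" if "z \<in> Q" for z
      using Q(3)[OF that] rtrancl_mono by blast
    then have "conn E Q"
      unfolding conn_def using Q(1) by (meson adj_rel_rtrancl_sym empty_iff rtrancl_trans)
    moreover have "touch E Q B" using c Q(1) unfolding touch_def by blast
    ultimately show "\<exists>Q. v \<in> Q \<and> Q \<subseteq> C \<and> conn E Q \<and> touch E Q B \<and> inj_on (gdist ?R v) Q"
      using Q unfolding C_def by blast
  qed
  then obtain Q where Q: "\<And>B. B \<in> T \<Longrightarrow> v \<in> Q B" "\<And>B. B \<in> T \<Longrightarrow> Q B \<subseteq> C"
    "\<And>B. B \<in> T \<Longrightarrow> conn E (Q B)" "\<And>B. B \<in> T \<Longrightarrow> touch E (Q B) B"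
    "\<And>B. B \<in> T \<Longrightarrow> inj_on (gdist ?R v) (Q B)"
    by blast
  define H where "H = {v} \<union> (\<Union>B\<in>T. Q B)"
  show ?thesis
  proof
    show "v \<in> H" unfolding H_def by simp
    show HC: "H \<subseteq> C" using Q(2) unfolding H_def C_def by auto
    show "touch E H B" if "B \<in> \<B>" "touch E C B" for B
      using Q(4)[of B] that unfolding H_def T_def touch_def by blast
    have vz: "(v, z) \<in> (adj_rel E H)\<^sup>*" if "z \<in> H" for z
    proof (cases "z = v")
      case False
      then obtain B where B: "B \<in> T" "z \<in> Q B" using \<open>z \<in> H\<close> unfolding H_def by blast
      then have "(v, z) \<in> (adj_rel E (Q B))\<^sup>*" using Q(1,3) unfolding conn_def by blast
      moreover have "Q B \<subseteq> H" using B unfolding H_def by blast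
      ultimately show ?thesis using adj_rel_rtrancl_mono by blast
    qed simp
    then show "conn E H"
      unfolding conn_def using \<open>v \<in> H\<close> by (meson adj_rel_rtrancl_sym empty_iff rtrancl_trans)
    show "card (sreach E U r x \<inter> H) \<le> t * (4 * r + 1)" if x: "x \<in> U" for x
    proof -
      have close: "gdist ?R v z \<le> gdist ?R v y + 2 * r"
        if yz: "y \<in> sreach E U r x" "z \<in> sreach E U r x" "y \<in> C" "z \<in> C" for y z
      proof -
        have *: "\<exists>l\<le>r. (x, y) \<in> ?R ^^ l" if y: "y \<in> sreach E U r x" "y \<in> C" for y
        proof -
          obtain m u where m: "m < r" "(x, u) \<in> via E U ^^ m" "{u, y} \<in> E"
            using y(1) unfolding sreach_def by blast
          have u: "(x, u) \<in> ?R ^^ m" using m(2) via_relpow_adj_rel[OF x] by blast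
          then have "u \<in> U" using adj_rel_rtrancl_in x relpow_imp_rtrancl by metis
          then have "(u, y) \<in> ?R" using m(3) y(2) CU unfolding adj_rel_def by auto
          then have "(x, y) \<in> ?R ^^ Suc m" using u by auto
          then show ?thesis using m(1) by (meson Suc_leI)
        qed
        obtain l l' where l: "l \<le> r" "(x, y) \<in> ?R ^^ l" "l' \<le> r" "(x, z) \<in> ?R ^^ l'"
          using * yz by meson
        have "(y, x) \<in> ?R ^^ l" using relpow_sym_rel[OF adj_rel_sym l(2)] .
        then have "(y, z) \<in> ?R ^^ (l + l')" using l(4) by (auto simp: relpow_add)
        moreover obtain m where "(v, y) \<in> ?R ^^ m" using yz(3) unfolding C_def by (auto dest: rtrancl_imp_relpow)
        ultimately show ?thesis using gdist_step l(1,3) by fastforce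
      qed
      have piece: "card (sreach E U r x \<inter> P) \<le> 4 * r + 1"
        if P: "P \<subseteq> C" "inj_on (gdist ?R v) P" for P
      proof (cases "sreach E U r x \<inter> P = {}")
        case False
        then obtain y where y: "y \<in> sreach E U r x" "y \<in> P" by blast
        let ?d = "gdist ?R v y"
        have "gdist ?R v ` (sreach E U r x \<inter> P) \<subseteq> {?d - 2 * r..?d + 2 * r}"
        proof
          fix d assume "d \<in> gdist ?R v ` (sreach E U r x \<inter> P)"
          then obtain z where z: "d = gdist ?R v z" "z \<in> sreach E U r x" "z \<in> P" by blast
          have "y \<in> C" "z \<in> C" using y z P(1) by auto
          then have "d \<le> ?d + 2 * r" "?d \<le> d + 2 * r"
            using close[OF y(1) z(2)] close[OF z(2) y(1)] z(1) by simp_all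
          then show "d \<in> {?d - 2 * r..?d + 2 * r}" by simp
        qed
        then have "card (sreach E U r x \<inter> P) \<le> card {?d - 2 * r..?d + 2 * r}"
          using P(2) by (intro card_inj_on_le[of "gdist ?R v"]) (auto intro: inj_on_subset)
        then show ?thesis by simp
      qed simp
      have "card (sreach E U r x \<inter> H) \<le> card ((sreach E U r x \<inter> {v}) \<union> (\<Union>B\<in>T. sreach E U r x \<inter> Q B))"
        using Q(2) CU U T(1) unfolding H_def
        by (intro card_mono) (auto intro!: finite_subset[of _ U])
      also have "\<dots> \<le> card (sreach E U r x \<inter> {v}) + (\<Sum>B\<in>T. card (sreach E U r x \<inter> Q B))"
        by (intro order_trans[OF card_Un_le] add_left_mono card_UN_le T(1))
      \<comment> \<open>The set \<open>{v}\<close> counts as one further geodesic; together these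
        are \<open>Suc (card T)\<close> pieces, which is at most \<open>t\<close>.\<close>
      also have "\<dots> \<le> (4 * r + 1) + (\<Sum>B\<in>T. 4 * r + 1)"
      proof (intro add_mono sum_mono piece)
        show "{v} \<subseteq> C" unfolding C_def by simp
      qed (use Q in auto)
      also have "\<dots> = Suc (card T) * (4 * r + 1)" by simp
      also have "\<dots> \<le> t * (4 * r + 1)" using T(2) by (intro mult_right_mono) auto
      finally show ?thesis .
    qed
  qed
qed

text \<open>The new case is a connected \<open>X\<close> in the rest that touches \<open>H\<close>:
  it lies in \<open>C\<close>, so an old block touched by \<open>X\<close> is touched by
  \<open>C\<close>, hence by \<open>H\<close>.\<close>

lemma decomp_state_step:
  assumes "finite V" "bounded_clique_minors E V t" "decomp_state E V r (t * (4 * r + 1)) U \<B>" "v \<in> U"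
  defines "C \<equiv> {u. (v, u) \<in> (adj_rel E U)\<^sup>*}"
  assumes H: "v \<in> H" "H \<subseteq> C" "conn E H"
    "\<And>B. B \<in> \<B> \<Longrightarrow> touch E C B \<Longrightarrow> touch E H B"
    "\<And>x. x \<in> U \<Longrightarrow> card (sreach E U r x \<inter> H) \<le> t * (4 * r + 1)"
  shows "decomp_state E V r (t * (4 * r + 1)) (U - H) (insert H \<B>)"
proof -
  note st = decomp_stateD[OF assms(3)]
  have CU: "C \<subseteq> U" using adj_rel_rtrancl_in assms(4) unfolding C_def by fast
  have connC: "conn E C" unfolding C_def by (rule conn_component[OF assms(4)])
  have U: "U \<subseteq> V" "finite U" using st(1) assms(1) by (auto intro: finite_subset)
  have XC: "touch E H B" if X: "X \<subseteq> U - H" "conn E X" "touch E X H" "touch E X B" "B \<in> \<B>" for X B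
  proof -
    obtain x h where xh: "x \<in> X" "h \<in> H" "{x, h} \<in> E" using X(3) unfolding touch_def by blast
    have "X \<subseteq> C"
    proof
      fix y assume "y \<in> X"
      then have "(x, y) \<in> (adj_rel E U)\<^sup>*"
        using X(1,2) xh(1) adj_rel_rtrancl_mono[of X U E] unfolding conn_def by blast
      moreover have "(h, x) \<in> adj_rel E U"
        using xh X(1) H(2) CU unfolding adj_rel_def by (auto simp: insert_commute)
      moreover have "(v, h) \<in> (adj_rel E U)\<^sup>*" using xh(2) H(2) unfolding C_def by blast
      ultimately have "(v, y) \<in> (adj_rel E U)\<^sup>*"
        by (meson rtrancl.rtrancl_into_rtrancl rtrancl_trans)
      then show "y \<in> C" unfolding C_def by simp
    qed
    then have "touch E C B" using X(4) unfolding touch_def by blast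
    then show ?thesis using H(4) X(5) by blast
  qed
  have touching: "touch E B B'"
    if "X \<subseteq> U - H" "conn E X" "B \<in> insert H \<B>" "B' \<in> insert H \<B>" "B \<noteq> B'" "touch E X B" "touch E X B'" for X B B'
  proof -
    have "X \<subseteq> U" using that by blast
    show ?thesis
    proof (cases "B = H")
      case True
      then show ?thesis using that XC[of X B'] by simp
    next
      case False
      show ?thesis
      proof (cases "B' = H")
        case True
        then show ?thesis using that XC[of X B] touch_sym[of E] False by simp
      next
        case False
        then show ?thesis using that \<open>B \<noteq> H\<close> st(6)[OF \<open>X \<subseteq> U\<close>, of B B'] by simp
      qed
    qed
  qed
  have small: "card (sreach E (U - H) r x \<inter> B) \<le> t * (4 * r + 1)" if "x \<in> U - H" "B \<in> insert H \<B>" for x B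
  proof -
    have "B \<subseteq> V" using that(2) st(4)[of B] U H(2) CU by auto
    then have "finite B" using assms(1) by (rule finite_subset)
    then have "card (sreach E (U - H) r x \<inter> B) \<le> card (sreach E U r x \<inter> B)"
      using sreach_mono[of "U - H" U E r x] by (intro card_mono) auto
    also have "\<dots> \<le> t * (4 * r + 1)" using that H(5) st(7)[of B x] by auto
    finally show ?thesis .
  qed
  have "H \<subseteq> U" using H(2) CU by blast
  have dis: "B \<inter> B' = {}" if "B \<in> insert H \<B>" "B' \<in> insert H \<B>" "B \<noteq> B'" for B B'
  proof -
    have "H \<inter> A = {}" if "A \<in> \<B>" for A using st(4)[OF that] \<open>H \<subseteq> U\<close> by blast
    then show ?thesis using that st(5)[of B B'] by auto
  qed
  have con: "conn E B \<and> B \<subseteq> V - (U - H)" if "B \<in> insert H \<B>" for B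
    using that st(3,4)[of B] H(3) \<open>H \<subseteq> U\<close> U by auto
  have "V - (U - H) \<subseteq> \<Union> (insert H \<B>)" using st(2) by auto
  moreover have "U - H \<subseteq> V" using U by auto
  ultimately show ?thesis unfolding decomp_state_def
    using touching small dis con by (intro conjI ballI allI impI) simp_all
qed

text \<open>Vertices outside \<open>U\<close> belong to earlier blocks and count as ranked above all
  of \<open>U\<close>; this is what the implication
  \<open>z \<in> U \<longrightarrow> rank x < rank z\<close> encodes.\<close>

lemma decomp_order:
  assumes "finite V" "bounded_clique_minors E V t" "decomp_state E V r (t * (4 * r + 1)) U \<B>"
  shows "\<exists>rank :: 'a \<Rightarrow> nat. inj_on rank U \<and>
    (\<forall>x\<in>U. card {z\<in>V. (z \<in> U \<longrightarrow> rank x < rank z) \<and> z \<in> sreach E {u\<in>U. rank u < rank x} r x}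
       \<le> t * (t * (4 * r + 1)))"
  using assms(3)
proof (induction "card U" arbitrary: U \<B> rule: less_induct)
  case less
  let ?K = "t * (4 * r + 1)"
  note st = decomp_stateD[OF less.prems]
  have U: "U \<subseteq> V" "finite U" using st(1) assms(1) by (auto intro: finite_subset)
  show ?case
  proof (cases "U = {}")
    case False
    then obtain v where v: "v \<in> U" by blast
    define C where "C = {u. (v, u) \<in> (adj_rel E U)\<^sup>*}"
    obtain H where H: "v \<in> H" "H \<subseteq> C" "conn E H"
      "\<And>B. B \<in> \<B> \<Longrightarrow> touch E C B \<Longrightarrow> touch E H B"
      "\<And>x. x \<in> U \<Longrightarrow> card (sreach E U r x \<inter> H) \<le> ?K"
      using decomp_block[OF assms(1,2) less.prems v] unfolding C_def by blast
    have CU: "C \<subseteq> U" using adj_rel_rtrancl_in v unfolding C_def by fast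
    have connC: "conn E C" unfolding C_def by (rule conn_component[OF v])
    have st': "decomp_state E V r ?K (U - H) (insert H \<B>)"
      using decomp_state_step[OF assms(1,2) less.prems v] H unfolding C_def by blast
    have "card (U - H) < card U" using v H(1) U by (intro psubset_card_mono) auto
    then obtain rank' :: "'a \<Rightarrow> nat" where r': "inj_on rank' (U - H)"
      "\<And>x. x \<in> U - H \<Longrightarrow> card {z\<in>V. (z \<in> U - H \<longrightarrow> rank' x < rank' z) \<and>
         z \<in> sreach E {u\<in>U - H. rank' u < rank' x} r x} \<le> t * ?K"
      using less.hyps[OF _ st'] by blast
    obtain h :: "'a \<Rightarrow> nat" where h: "inj_on h U" using finite_imp_inj_to_nat_seg[OF U(2)] by blast
    obtain N where N: "\<And>x. x \<in> U - H \<Longrightarrow> rank' x < N"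
      using U(2) finite_nat_set_iff_bounded[of "rank' ` (U - H)"] by auto
    \<comment> \<open>Blocks split off earlier get larger ranks; inside \<open>H\<close> any
      injective order will do.\<close>
    define rank where "rank x = (if x \<in> H then N + h x else rank' x)" for x
    have HU: "H \<subseteq> U" using H(2) CU by blast
    have "inj_on rank U"
    proof (rule inj_onI)
      fix x y assume xy: "x \<in> U" "y \<in> U" "rank x = rank y"
      then show "x = y"
        using N[of x] N[of y] r'(1) h unfolding rank_def inj_on_def by (auto split: if_splits)
    qed
    moreover have "card {z\<in>V. (z \<in> U \<longrightarrow> rank x < rank z) \<and> z \<in> sreach E {u\<in>U. rank u < rank x} r x} \<le> t * ?K"
      if x: "x \<in> U" for x
    proof (cases "x \<in> H")
      case False
      have *: "{u\<in>U. rank u < rank x} = {u\<in>U - H. rank' u < rank' x}"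
        using N[of x] False x unfolding rank_def by auto
      have "{z\<in>V. (z \<in> U \<longrightarrow> rank x < rank z) \<and> z \<in> sreach E {u\<in>U. rank u < rank x} r x} \<subseteq>
        {z\<in>V. (z \<in> U - H \<longrightarrow> rank' x < rank' z) \<and> z \<in> sreach E {u\<in>U - H. rank' u < rank' x} r x}"
        unfolding * using False unfolding rank_def by auto
      moreover have "finite {z\<in>V. (z \<in> U - H \<longrightarrow> rank' x < rank' z) \<and>
         z \<in> sreach E {u\<in>U - H. rank' u < rank' x} r x}" using assms(1) by simp
      ultimately show ?thesis
        using r'(2)[of x] False x card_mono by (meson DiffI order_trans)
    next
      case True
      let ?Z = "{z\<in>V. (z \<in> U \<longrightarrow> rank x < rank z) \<and> z \<in> sreach E {u\<in>U. rank u < rank x} r x}"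
      let ?T = "{B\<in>\<B>. touch E C B}"
      have T: "finite ?T" "card ?T < t"
        using decomp_state_card_touching[OF assms(2) less.prems CU connC assms(1)] by auto
      have finB: "finite B" if "B \<in> insert H \<B>" for B
      proof -
        have "B \<subseteq> V" using that st(4)[of B] HU U by auto
        then show ?thesis using assms(1) by (rule finite_subset)
      qed
      \<comment> \<open>A vertex reached from \<open>x\<close> lies in \<open>H\<close> or in an
        earlier block that \<open>C\<close> touches. These are at most \<open>t\<close> blocks, each
        with at most \<open>?K\<close> reached vertices.\<close>
      have sub: "?Z \<subseteq> (\<Union>B\<in>insert H ?T. sreach E U r x \<inter> B)"
      proof
        fix z assume z: "z \<in> ?Z"
        then have zr: "z \<in> sreach E U r x"
          using sreach_mono[of "{u\<in>U. rank u < rank x}" U E r x] by blast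
        show "z \<in> (\<Union>B\<in>insert H ?T. sreach E U r x \<inter> B)"
        proof (cases "z \<in> U")
          case inU: True
          then have "rank x < rank z" using z by blast
          then have "z \<in> H" using N[of z] inU True unfolding rank_def by (auto split: if_splits)
          then show ?thesis using zr by blast
        next
          case False
          then obtain B where B: "B \<in> \<B>" "z \<in> B" using z st(2) by blast
          obtain m u where m: "(x, u) \<in> via E U ^^ m" "{u, z} \<in> E"
            using zr unfolding sreach_def by blast
          have "(x, u) \<in> adj_rel E U ^^ m" using m(1) via_relpow_adj_rel[OF x] by blast
          then have "(x, u) \<in> (adj_rel E U)\<^sup>*" by (rule relpow_imp_rtrancl)
          moreover have "(v, x) \<in> (adj_rel E U)\<^sup>*" using True H(2) unfolding C_def by blast
          ultimately have "(v, u) \<in> (adj_rel E U)\<^sup>*" by (meson rtrancl_trans)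
          then have "u \<in> C" unfolding C_def by simp
          then have "touch E C B" using B m(2) unfolding touch_def by blast
          then show ?thesis using B zr by blast
        qed
      qed
      have "card ?Z \<le> card (\<Union>B\<in>insert H ?T. sreach E U r x \<inter> B)"
        using sub T(1) finB by (intro card_mono) auto
      also have "\<dots> \<le> (\<Sum>B\<in>insert H ?T. card (sreach E U r x \<inter> B))"
        using T(1) by (intro card_UN_le) auto
      also have "\<dots> \<le> (\<Sum>B\<in>insert H ?T. ?K)"
        using H(5)[OF x] st(7)[OF _ x] by (intro sum_mono) auto
      also have "\<dots> = card (insert H ?T) * ?K" by simp
      also have "\<dots> \<le> t * ?K"
        using T by (intro mult_right_mono) (auto simp: card_insert_if)
      finally show ?thesis .
    qed
    ultimately show ?thesis by blast
  qed simp
qed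

lemma rank_exists:
  assumes "finite V" "bounded_clique_minors E V t"
  shows "\<exists>rank :: 'a \<Rightarrow> nat. inj_on rank V \<and>
    (\<forall>x\<in>V. card {z\<in>V. rank x < rank z \<and> z \<in> sreach E {u\<in>V. rank u < rank x} r x}
       \<le> t * (t * (4 * r + 1)))"
proof -
  have "decomp_state E V r (t * (4 * r + 1)) V {}" unfolding decomp_state_def by simp
  from decomp_order[OF assms this] obtain rank :: "'a \<Rightarrow> nat" where r: "inj_on rank V"
    "\<And>x. x \<in> V \<Longrightarrow> card {z\<in>V. (z \<in> V \<longrightarrow> rank x < rank z) \<and> z \<in> sreach E {u\<in>V. rank u < rank x} r x} \<le> t * (t * (4 * r + 1))"
    by blast
  have "{z\<in>V. rank x < rank z \<and> P z} = {z\<in>V. (z \<in> V \<longrightarrow> rank x < rank z) \<and> P z}" for x P by auto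
  then show ?thesis using r by (intro exI[of _ rank]) simp
qed

section \<open>Random exploration\<close>

lemma measure_bind_pmf_integral:
  "measure_pmf.prob (bind_pmf p f) A = measure_pmf.expectation p (\<lambda>x. measure_pmf.prob (f x) A)"
proof -
  have "ennreal (measure_pmf.prob (bind_pmf p f) A) = emeasure (measure_pmf (bind_pmf p f)) A"
    by (simp add: measure_pmf.emeasure_eq_measure)
  also have "\<dots> = (\<integral>\<^sup>+x. emeasure (measure_pmf (f x)) A \<partial>p)"
    by (rule emeasure_bind_pmf)
  also have "\<dots> = (\<integral>\<^sup>+x. ennreal (measure_pmf.prob (f x) A) \<partial>p)"
    by (simp add: measure_pmf.emeasure_eq_measure)
  also have "\<dots> = ennreal (measure_pmf.expectation p (\<lambda>x. measure_pmf.prob (f x) A))"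
    by (intro nn_integral_eq_integral measure_pmf.integrable_const_bound[where B = 1]) auto
  finally show ?thesis by (simp add: integral_nonneg_AE)
qed

lemma measure_bind_pmf_ge:
  assumes "\<And>x. x \<in> Y \<Longrightarrow> c \<le> measure_pmf.prob (f x) A" "0 \<le> c"
  shows "measure_pmf.prob p Y * c \<le> measure_pmf.prob (bind_pmf p f) A"
proof -
  have "measure_pmf.prob p Y * c = measure_pmf.expectation p (\<lambda>x. indicator Y x * c)"
    by simp
  also have "\<dots> \<le> measure_pmf.expectation p (\<lambda>x. measure_pmf.prob (f x) A)"
  proof (rule integral_mono)
    show "integrable (measure_pmf p) (\<lambda>x. measure_pmf.prob (f x) A)"
      by (intro measure_pmf.integrable_const_bound[where B = 1]) auto
    show "integrable (measure_pmf p) (\<lambda>x. indicator Y x * c)"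
      using assms(2) by (intro measure_pmf.integrable_const_bound[where B = c]) (auto simp: indicator_def)
  qed (use assms in \<open>auto simp: indicator_def\<close>)
  finally show ?thesis by (simp add: measure_bind_pmf_integral)
qed

section \<open>Acceptance and rejection probabilities, independent repetition\<close>

definition acc :: "nat sgraph \<Rightarrow> query_alg \<Rightarrow> real" where
  "acc G A = measure_pmf.prob (run G A) {(b, m). b}"

definition rej :: "nat sgraph \<Rightarrow> query_alg \<Rightarrow> real" where
  "rej G A = measure_pmf.prob (run G A) {(b, m). \<not> b}"

lemma acc_rej: "acc G A = 1 - rej G A"
proof -
  have "{(b, m). b} = space (measure_pmf (run G A)) - {(b, m). \<not> b}" by auto
  then show ?thesis unfolding acc_def rej_def
    by (metis measure_pmf.prob_compl sets_measure_pmf UNIV_I)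
qed

lemma prob_Suc_snd:
  "measure_pmf.prob (map_pmf (\<lambda>(b, m). (b, Suc m)) p) {(b, m). P b} = measure_pmf.prob p {(b, m). P b}"
proof -
  have "(\<lambda>(b, m). (b, Suc m)) -` {(b, m). P b} = {(b, m). P b}" by auto
  then show ?thesis by simp
qed

text \<open>A rejection by either run is final, so one-sided error is preserved and acceptance
  probabilities multiply.\<close>

primrec seq_alg :: "query_alg \<Rightarrow> query_alg \<Rightarrow> query_alg" where
  "seq_alg (Decide b) B = (if b then B else Decide False)"
| "seq_alg (Sample p k) B = Sample p (\<lambda>x. seq_alg (k x) B)"
| "seq_alg (Query v k) B = Query v (\<lambda>a. seq_alg (k a) B)"

lemma acc_seq_alg: "acc G (seq_alg A B) = acc G A * acc G B"
proof (induction A)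
  case (Decide b)
  have "measure_pmf.prob (return_pmf (b', 0 :: nat)) {(b, m). b} = of_bool b'" for b'
    by (simp add: measure_return indicator_def)
  then show ?case by (cases b) (simp_all add: acc_def)
next
  case (Sample p k)
  then have "acc G (seq_alg (k x) B) = acc G (k x) * acc G B" for x by auto
  then show ?case by (simp add: acc_def measure_bind_pmf_integral)
next
  case (Query v k)
  then have "acc G (seq_alg (k x) B) = acc G (k x) * acc G B" for x by auto
  then show ?case
    by (simp add: acc_def measure_bind_pmf_integral prob_Suc_snd[where P = "\<lambda>b. b"] del: measure_map_pmf)
qed

lemma queries_seq_alg:
  assumes "\<And>b m. (b, m) \<in> set_pmf (run G B) \<Longrightarrow> m \<le> q"
    "(b, m) \<in> set_pmf (run G (seq_alg A B))"
  shows "\<exists>b' m'. (b', m') \<in> set_pmf (run G A) \<and> m \<le> m' + q"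
  using assms(2)
proof (induction A arbitrary: b m)
  case (Decide b')
  then show ?case using assms(1) by (cases b') auto
next
  case (Sample p k)
  then obtain x where x: "x \<in> set_pmf p" "(b, m) \<in> set_pmf (run G (seq_alg (k x) B))" by auto
  then show ?case using Sample.IH[of "k x" b m] by auto
next
  case (Query v k)
  then obtain a m1 where a: "a \<in> set_pmf (random_neighbor G v)" "(b, m1) \<in> set_pmf (run G (seq_alg (k a) B))"
    "m = Suc m1" by auto
  then obtain b' m' where "(b', m') \<in> set_pmf (run G (k a))" "m1 \<le> m' + q"
    using Query.IH[of "k a" b m1] by auto
  then show ?case using a by (intro exI[of _ b'] exI[of _ "Suc m'"]) force
qed

primrec rep_alg :: "nat \<Rightarrow> query_alg \<Rightarrow> query_alg" where
  "rep_alg 0 A = Decide True"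
| "rep_alg (Suc N) A = seq_alg A (rep_alg N A)"

lemma acc_rep_alg: "acc G (rep_alg N A) = acc G A ^ N"
  by (induction N) (simp_all add: acc_seq_alg, simp add: acc_def measure_return)

lemma queries_rep_alg:
  assumes "\<And>b m. (b, m) \<in> set_pmf (run G A) \<Longrightarrow> m \<le> q"
  shows "(b, m) \<in> set_pmf (run G (rep_alg N A)) \<Longrightarrow> m \<le> N * q"
proof (induction N arbitrary: b m)
  case (Suc N)
  obtain b' m' where "(b', m') \<in> set_pmf (run G A)" "m \<le> m' + N * q"
    using queries_seq_alg[of G "rep_alg N A" "N * q" b m A] Suc by auto
  then show ?case using assms[of b' m'] by simp
qed simp

text \<open>\<open>xs\<close> lists the known vertices and \<open>F\<close> collects the known
  edges. The index range \<open>{..M}\<close> does not depend on \<open>xs\<close>: as long as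
  \<open>xs\<close> has at most \<open>M\<close> entries, each entry and the fresh draw are selected
  with probability at least \<open>1 / (M + 1)\<close>.\<close>

primrec expl :: "(nat set set \<Rightarrow> bool) \<Rightarrow> nat \<Rightarrow> nat \<Rightarrow> nat \<Rightarrow> nat list \<Rightarrow> nat set set \<Rightarrow> query_alg" where
  "expl dec n M 0 = (\<lambda>xs F. Decide (dec F))"
| "expl dec n M (Suc j) = (\<lambda>xs F. Sample (pmf_of_set {..M}) (\<lambda>i.
     if i < length xs
     then Query (xs ! i) (case_option (expl dec n M j xs F)
            (\<lambda>y. expl dec n M j (y # xs) (insert {xs ! i, y} F)))
     else Sample (pmf_of_set {1..n}) (\<lambda>v. expl dec n M j (v # xs) F)))"

lemma set_pmf_random_neighbor:
  assumes "simple_graph G" "Some y \<in> set_pmf (random_neighbor G x)"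
  shows "{x, y} \<in> edges G"
proof -
  have fin: "finite (neighbors G x)"
  proof (rule finite_subset)
    show "neighbors G x \<subseteq> verts G"
      using assms(1) unfolding simple_graph_def neighbors_def by auto
    show "finite (verts G)" using assms(1) unfolding simple_graph_def by simp
  qed
  then show ?thesis using assms(2)
    unfolding random_neighbor_def by (auto split: if_splits simp: neighbors_def)
qed

lemma expl_sound:
  assumes "simple_graph G" "\<And>F. F \<subseteq> edges G \<Longrightarrow> dec F"
  shows "F \<subseteq> edges G \<Longrightarrow> (b, m) \<in> set_pmf (run G (expl dec n M j xs F)) \<Longrightarrow> b"
proof (induction j arbitrary: xs F b m)
  case (Suc j)
  from Suc.prems(2) obtain i where i: "(b, m) \<in> set_pmf (run G (if i < length xs
     then Query (xs ! i) (case_option (expl dec n M j xs F)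
            (\<lambda>y. expl dec n M j (y # xs) (insert {xs ! i, y} F)))
     else Sample (pmf_of_set {1..n}) (\<lambda>v. expl dec n M j (v # xs) F)))" by auto
  show ?case
  proof (cases "i < length xs")
    case True
    then obtain a m1 where a: "a \<in> set_pmf (random_neighbor G (xs ! i))"
      "(b, m1) \<in> set_pmf (run G (case_option (expl dec n M j xs F)
            (\<lambda>y. expl dec n M j (y # xs) (insert {xs ! i, y} F)) a))"
      using i by auto
    show ?thesis
    proof (cases a)
      case None
      then show ?thesis using a Suc.IH[OF Suc.prems(1), of b m1 xs] by simp
    next
      case (Some y)
      then have "{xs ! i, y} \<in> edges G" using a set_pmf_random_neighbor[OF assms(1)] by blast
      then show ?thesis using a Some Suc.IH[of "insert {xs ! i, y} F" b m1 "y # xs"] Suc.prems(1) by simp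
    qed
  next
    case False
    then show ?thesis using i Suc.IH[OF Suc.prems(1)] by auto
  qed
qed (use assms in auto)

lemma expl_queries:
  "(b, m) \<in> set_pmf (run G (expl dec n M j xs F)) \<Longrightarrow> m \<le> j"
proof (induction j arbitrary: xs F b m)
  case (Suc j)
  from Suc.prems obtain i where i: "(b, m) \<in> set_pmf (run G (if i < length xs
     then Query (xs ! i) (case_option (expl dec n M j xs F)
            (\<lambda>y. expl dec n M j (y # xs) (insert {xs ! i, y} F)))
     else Sample (pmf_of_set {1..n}) (\<lambda>v. expl dec n M j (v # xs) F)))" by auto
  show ?case
  proof (cases "i < length xs")
    case True
    then obtain a m1 where a: "m = Suc m1"
      "(b, m1) \<in> set_pmf (run G (case_option (expl dec n M j xs F)
            (\<lambda>y. expl dec n M j (y # xs) (insert {xs ! i, y} F)) a))"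
      using i by auto
    then have "m1 \<le> j" using Suc.IH by (cases a) auto
    then show ?thesis using a by simp
  next
    case False
    then obtain v where "(b, m) \<in> set_pmf (run G (expl dec n M j (v # xs) F))" using i by auto
    then show ?thesis using Suc.IH by (meson le_SucI)
  qed
qed simp

section \<open>A calculus of lower bounds for the rejection probability\<close>

locale exploration =
  fixes G :: "nat sgraph" and dec :: "nat set set \<Rightarrow> bool" and n M :: nat and \<beta> :: real
  assumes G: "simple_graph G" "verts G = {1..n}" and n: "0 < n" and \<beta>: "0 < \<beta>" "\<beta> \<le> 1"
begin

definition consistent :: "nat set \<Rightarrow> nat set set \<Rightarrow> bool" where
  "consistent K F \<longleftrightarrow> \<Union>F \<subseteq> K \<and> F \<subseteq> edges G"

text \<open>Reaching a state with property \<open>B\<close> from one with property \<open>A\<close> within \<open>a\<close> steps costs at most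
  a factor \<open>(\<beta> / (M + 1)) ^ a\<close> of the rejection probability of the remaining exploration. Here
  \<open>K\<close> is the set of discovered vertices and \<open>F\<close> the set of discovered edges.\<close>

definition leadsto ::
  "(nat set \<Rightarrow> nat set set \<Rightarrow> bool) \<Rightarrow> nat \<Rightarrow> (nat set \<Rightarrow> nat set set \<Rightarrow> bool) \<Rightarrow> bool" where
  "leadsto A a B \<longleftrightarrow> (\<forall>xs F j p. consistent (set xs) F \<longrightarrow> A (set xs) F \<longrightarrow> length xs + j + a \<le> M \<longrightarrow> 0 \<le> p \<longrightarrow>
     (\<forall>xs' F'. consistent (set xs') F' \<longrightarrow> set xs \<subseteq> set xs' \<longrightarrow> F \<subseteq> F' \<longrightarrow> length xs' + j \<le> M \<longrightarrow>
        B (set xs') F' \<longrightarrow> p \<le> rej G (expl dec n M j xs' F')) \<longrightarrow>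
     p * (\<beta> / (M + 1)) ^ a \<le> rej G (expl dec n M (j + a) xs F))"

definition monotone_prop :: "(nat set \<Rightarrow> nat set set \<Rightarrow> bool) \<Rightarrow> bool" where
  "monotone_prop A \<longleftrightarrow> (\<forall>K F K' F'. A K F \<longrightarrow> K \<subseteq> K' \<longrightarrow> F \<subseteq> F' \<longrightarrow> A K' F')"

lemma monotone_propI:
  "(\<And>K F K' F'. A K F \<Longrightarrow> K \<subseteq> K' \<Longrightarrow> F \<subseteq> F' \<Longrightarrow> A K' F') \<Longrightarrow> monotone_prop A"
  unfolding monotone_prop_def by simp

lemma monotone_propD: "monotone_prop A \<Longrightarrow> A K F \<Longrightarrow> K \<subseteq> K' \<Longrightarrow> F \<subseteq> F' \<Longrightarrow> A K' F'"
  unfolding monotone_prop_def by simp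

lemma leadstoI:
  assumes "\<And>xs F j p. consistent (set xs) F \<Longrightarrow> A (set xs) F \<Longrightarrow> length xs + j + a \<le> M \<Longrightarrow> 0 \<le> p \<Longrightarrow>
     (\<And>xs' F'. consistent (set xs') F' \<Longrightarrow> set xs \<subseteq> set xs' \<Longrightarrow> F \<subseteq> F' \<Longrightarrow> length xs' + j \<le> M \<Longrightarrow>
        B (set xs') F' \<Longrightarrow> p \<le> rej G (expl dec n M j xs' F')) \<Longrightarrow>
     p * (\<beta> / (M + 1)) ^ a \<le> rej G (expl dec n M (j + a) xs F)"
  shows "leadsto A a B"
  using assms unfolding leadsto_def by blast

lemma leadstoD:
  assumes "leadsto A a B" "consistent (set xs) F" "A (set xs) F" "length xs + j + a \<le> M" "0 \<le> p"
     "\<And>xs' F'. consistent (set xs') F' \<Longrightarrow> set xs \<subseteq> set xs' \<Longrightarrow> F \<subseteq> F' \<Longrightarrow> length xs' + j \<le> M \<Longrightarrow>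
        B (set xs') F' \<Longrightarrow> p \<le> rej G (expl dec n M j xs' F')"
  shows "p * (\<beta> / (M + 1)) ^ a \<le> rej G (expl dec n M (j + a) xs F)"
  using assms unfolding leadsto_def by blast

lemma leadsto_trans:
  assumes "leadsto A a B" "leadsto B b C"
  shows "leadsto A (a + b) C"
proof (rule leadstoI)
  fix xs F j and p :: real
  assume *: "consistent (set xs) F" "A (set xs) F" "length xs + j + (a + b) \<le> M" "0 \<le> p"
    "\<And>xs' F'. consistent (set xs') F' \<Longrightarrow> set xs \<subseteq> set xs' \<Longrightarrow> F \<subseteq> F' \<Longrightarrow> length xs' + j \<le> M \<Longrightarrow>
        C (set xs') F' \<Longrightarrow> p \<le> rej G (expl dec n M j xs' F')"
  let ?\<eta> = "\<beta> / (M + 1)"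
  \<comment> \<open>The first phase is run with \<open>j + b\<close> steps in reserve and with
    \<open>p * ?\<eta> ^ b\<close>, the guarantee of the second phase, as its target bound.\<close>
  have "(p * ?\<eta> ^ b) * ?\<eta> ^ a \<le> rej G (expl dec n M ((j + b) + a) xs F)"
  proof (rule leadstoD[OF assms(1) *(1,2)])
    show "length xs + (j + b) + a \<le> M" using *(3) by simp
    show "0 \<le> p * ?\<eta> ^ b" using *(4) \<beta> by simp
    fix xs' F' assume s: "consistent (set xs') F'" "set xs \<subseteq> set xs'" "F \<subseteq> F'" "length xs' + (j + b) \<le> M" "B (set xs') F'"
    show "p * ?\<eta> ^ b \<le> rej G (expl dec n M (j + b) xs' F')"
    proof (rule leadstoD[OF assms(2) s(1,5)])
      show "length xs' + j + b \<le> M" using s(4) by simp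
      show "p \<le> rej G (expl dec n M j xs'' F'')"
        if "consistent (set xs'') F''" "set xs' \<subseteq> set xs''" "F' \<subseteq> F''" "length xs'' + j \<le> M" "C (set xs'') F''" for xs'' F''
        using that s *(5)[of xs'' F''] by blast
    qed (use *(4) in simp)
  qed
  then show "p * ?\<eta> ^ (a + b) \<le> rej G (expl dec n M (j + (a + b)) xs F)"
    by (simp add: power_add algebra_simps)
qed

lemma leadsto_weaken:
  assumes "leadsto A a B" "\<And>K F. consistent K F \<Longrightarrow> A' K F \<Longrightarrow> A K F" "\<And>K F. consistent K F \<Longrightarrow> B K F \<Longrightarrow> B' K F"
  shows "leadsto A' a B'"
proof (rule leadstoI)
  fix xs F j and p :: real
  assume *: "consistent (set xs) F" "A' (set xs) F" "length xs + j + a \<le> M" "0 \<le> p"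
    "\<And>xs' F'. consistent (set xs') F' \<Longrightarrow> set xs \<subseteq> set xs' \<Longrightarrow> F \<subseteq> F' \<Longrightarrow> length xs' + j \<le> M \<Longrightarrow>
        B' (set xs') F' \<Longrightarrow> p \<le> rej G (expl dec n M j xs' F')"
  show "p * (\<beta> / (M + 1)) ^ a \<le> rej G (expl dec n M (j + a) xs F)"
    using leadstoD[OF assms(1) *(1) _ *(3,4), OF assms(2)[OF *(1,2)]] *(5) assms(3) by blast
qed

text \<open>Knowledge only grows, so a monotone property that holds at the start still holds at the
  end.\<close>

lemma leadsto_frame:
  assumes "leadsto A a B" "monotone_prop X"
  shows "leadsto (\<lambda>K F. A K F \<and> X K F) a (\<lambda>K F. B K F \<and> X K F)"
proof (rule leadstoI)
  fix xs F j and p :: real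
  assume *: "consistent (set xs) F" "A (set xs) F \<and> X (set xs) F" "length xs + j + a \<le> M" "0 \<le> p"
    "\<And>xs' F'. consistent (set xs') F' \<Longrightarrow> set xs \<subseteq> set xs' \<Longrightarrow> F \<subseteq> F' \<Longrightarrow> length xs' + j \<le> M \<Longrightarrow>
        B (set xs') F' \<and> X (set xs') F' \<Longrightarrow> p \<le> rej G (expl dec n M j xs' F')"
  have "X (set xs') F'" if "set xs \<subseteq> set xs'" "F \<subseteq> F'" for xs' F'
    by (rule monotone_propD[OF assms(2) conjunct2[OF *(2)] that])
  then show "p * (\<beta> / (M + 1)) ^ a \<le> rej G (expl dec n M (j + a) xs F)"
    using leadstoD[OF assms(1) *(1) conjunct1[OF *(2)] *(3,4)] *(5) by blast
qed

lemma leadsto_refl: "leadsto A 0 A"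
  by (rule leadstoI) auto

text \<open>The bound is claimed for each starting state separately, so the analysis may choose
  \<open>i\<close> according to what was found, although the tester never sees it.\<close>

lemma leadsto_ex:
  assumes "\<And>i. leadsto (A i) a B"
  shows "leadsto (\<lambda>K F. \<exists>i. A i K F) a B"
  using assms unfolding leadsto_def by blast

lemma leadsto_False: "leadsto (\<lambda>K F. False) a B"
  by (rule leadstoI) auto

text \<open>The index \<open>M\<close> is never a position in \<open>xs\<close> and thus selects a
  fresh draw: a factor \<open>1 / (M + 1)\<close> for the index and \<open>\<beta>\<close> for
  hitting \<open>Y\<close>.\<close>

lemma rej_expl_fresh:
  assumes "length xs \<le> M" "0 \<le> p" "Y \<subseteq> {1..n}" "\<beta> * n \<le> card Y"
    "\<And>y. y \<in> Y \<Longrightarrow> p \<le> rej G (expl dec n M j (y # xs) F)"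
  shows "p * (\<beta> / (M + 1)) \<le> rej G (expl dec n M (Suc j) xs F)"
proof -
  let ?k = "\<lambda>i. if i < length xs
     then Query (xs ! i) (case_option (expl dec n M j xs F)
            (\<lambda>y. expl dec n M j (y # xs) (insert {xs ! i, y} F)))
     else Sample (pmf_of_set {1..n}) (\<lambda>v. expl dec n M j (v # xs) F)"
  have "measure_pmf.prob (pmf_of_set {1..n}) Y * p \<le> rej G (?k M)"
    using assms unfolding rej_def by (auto intro!: measure_bind_pmf_ge)
  moreover have "measure_pmf.prob (pmf_of_set {1..n}) Y = card Y / n"
    using n assms(3) by (subst measure_pmf_of_set) (auto simp: Int_absorb1)
  moreover have "\<beta> * p \<le> card Y / n * p"
    using assms(2,4) n by (intro mult_right_mono) (simp_all add: pos_le_divide_eq)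
  ultimately have "\<beta> * p \<le> rej G (?k M)" by simp
  then have "measure_pmf.prob (pmf_of_set {..M}) {M} * (\<beta> * p) \<le> rej G (expl dec n M (Suc j) xs F)"
    unfolding rej_def expl.simps run.simps using assms(2) \<beta>
    by (intro measure_bind_pmf_ge) auto
  moreover have "measure_pmf.prob (pmf_of_set {..M}) {M} = 1 / (M + 1)"
    by (subst measure_pmf_of_set) auto
  ultimately show ?thesis by (simp add: algebra_simps)
qed

lemma rej_expl_query:
  assumes "length xs \<le> M" "0 \<le> p" "x \<in> set xs" "Y \<subseteq> neighbors G x" "Y \<noteq> {}"
    "\<beta> * card (neighbors G x) \<le> card Y"
    "\<And>y. y \<in> Y \<Longrightarrow> p \<le> rej G (expl dec n M j (y # xs) (insert {x, y} F))"
  shows "p * (\<beta> / (M + 1)) \<le> rej G (expl dec n M (Suc j) xs F)"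
proof -
  let ?k = "\<lambda>i. if i < length xs
     then Query (xs ! i) (case_option (expl dec n M j xs F)
            (\<lambda>y. expl dec n M j (y # xs) (insert {xs ! i, y} F)))
     else Sample (pmf_of_set {1..n}) (\<lambda>v. expl dec n M j (v # xs) F)"
  let ?N = "neighbors G x"
  have "?N \<subseteq> verts G" using G(1) unfolding simple_graph_def neighbors_def by auto
  then have N: "finite ?N" "?N \<noteq> {}" using G(2) assms(4,5) by (auto intro: finite_subset)
  obtain i where i: "i < length xs" "xs ! i = x" using assms(3) by (meson in_set_conv_nth)
  have "measure_pmf.prob (random_neighbor G x) (Some ` Y) * p \<le> rej G (?k i)"
    using assms(2,7) i unfolding rej_def
    by (auto intro!: measure_bind_pmf_ge simp: prob_Suc_snd[where P = Not] simp del: measure_map_pmf)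
  moreover have "measure_pmf.prob (random_neighbor G x) (Some ` Y) = card Y / card ?N"
  proof -
    have "Some -` Some ` Y = Y" by auto
    then show ?thesis
      using N assms(4) by (simp add: random_neighbor_def measure_pmf_of_set Int_absorb1)
  qed
  moreover have "\<beta> * p \<le> card Y / card ?N * p"
    using assms(2,6) N by (intro mult_right_mono) (simp_all add: pos_le_divide_eq card_gt_0_iff)
  ultimately have "\<beta> * p \<le> rej G (?k i)" by simp
  then have "measure_pmf.prob (pmf_of_set {..M}) {i} * (\<beta> * p) \<le> rej G (expl dec n M (Suc j) xs F)"
    unfolding rej_def expl.simps run.simps using assms(2) \<beta>
    by (intro measure_bind_pmf_ge) auto
  moreover have "measure_pmf.prob (pmf_of_set {..M}) {i} = 1 / (M + 1)"
    using i assms(1) by (subst measure_pmf_of_set) auto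
  ultimately show ?thesis by (simp add: algebra_simps)
qed

lemma leadsto_fresh:
  assumes "Y \<subseteq> {1..n}" "\<beta> * n \<le> card Y"
  shows "leadsto (\<lambda>K F. True) 1 (\<lambda>K F. \<exists>y\<in>Y. y \<in> K)"
proof (rule leadstoI)
  fix xs F j and p :: real
  assume *: "consistent (set xs) F" "True" "length xs + j + 1 \<le> M" "0 \<le> p"
    "\<And>xs' F'. consistent (set xs') F' \<Longrightarrow> set xs \<subseteq> set xs' \<Longrightarrow> F \<subseteq> F' \<Longrightarrow> length xs' + j \<le> M \<Longrightarrow>
        \<exists>y\<in>Y. y \<in> set xs' \<Longrightarrow> p \<le> rej G (expl dec n M j xs' F')"
  have "p \<le> rej G (expl dec n M j (y # xs) F)" if "y \<in> Y" for y
    using that *(1,3) by (intro *(5)) (auto simp: consistent_def)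
  then show "p * (\<beta> / (M + 1)) ^ 1 \<le> rej G (expl dec n M (j + 1) xs F)"
    using rej_expl_fresh[of xs p Y j F] *(3,4) assms by simp
qed

lemma leadsto_query:
  assumes "Y \<subseteq> neighbors G x" "Y \<noteq> {}" "\<beta> * card (neighbors G x) \<le> card Y"
  shows "leadsto (\<lambda>K F. x \<in> K) 1 (\<lambda>K F. \<exists>y\<in>Y. {x, y} \<in> F)"
proof (rule leadstoI)
  fix xs F j and p :: real
  assume *: "consistent (set xs) F" "x \<in> set xs" "length xs + j + 1 \<le> M" "0 \<le> p"
    "\<And>xs' F'. consistent (set xs') F' \<Longrightarrow> set xs \<subseteq> set xs' \<Longrightarrow> F \<subseteq> F' \<Longrightarrow> length xs' + j \<le> M \<Longrightarrow>
        \<exists>y\<in>Y. {x, y} \<in> F' \<Longrightarrow> p \<le> rej G (expl dec n M j xs' F')"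
  have "p \<le> rej G (expl dec n M j (y # xs) (insert {x, y} F))" if "y \<in> Y" for y
    using that *(1,2,3) assms(1) by (intro *(5)) (auto simp: consistent_def neighbors_def)
  then show "p * (\<beta> / (M + 1)) ^ 1 \<le> rej G (expl dec n M (j + 1) xs F)"
    using rej_expl_query[of xs p x Y j F] *(2,3,4) assms by simp
qed

text \<open>An idle step is a fresh draw with all of \<open>{1..n}\<close> as its target, whose loss
  factor is admissible since \<open>\<beta> \<le> 1\<close>. This allows uniform step
  budgets.\<close>

lemma leadsto_pad:
  assumes "leadsto A a B" "monotone_prop B" "a \<le> b"
  shows "leadsto A b B"
proof -
  have "real n * \<beta> \<le> real n" using \<beta> n by simp
  then have "leadsto (\<lambda>K F. True) 1 (\<lambda>K F. True)"
    using leadsto_fresh[of "{1..n}"] by (auto intro: leadsto_weaken simp: mult.commute)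
  from leadsto_frame[OF this assms(2)] have B1: "leadsto B 1 B" by simp
  have "leadsto B c B" for c
  proof (induction c)
    case 0
    show ?case by (rule leadsto_refl)
  next
    case (Suc c)
    then show ?case using leadsto_trans[OF B1] by fastforce
  qed
  from leadsto_trans[OF assms(1) this, of "b - a"] show ?thesis using assms(3) by simp
qed

text \<open>The goals are pursued one after the other; those already reached, and \<open>A\<close>
  itself, persist by monotonicity.\<close>

lemma leadsto_ball:
  assumes "finite I" "\<And>i. i \<in> I \<Longrightarrow> leadsto A a (B i)" "monotone_prop A" "\<And>i. i \<in> I \<Longrightarrow> monotone_prop (B i)"
  shows "leadsto A (card I * a) (\<lambda>K F. (\<forall>i\<in>I. B i K F) \<and> A K F)"
  using assms(1,2,4)
proof (induction I rule: finite_induct)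
  case empty
  show ?case using leadsto_refl[of A] by simp
next
  case (insert i I)
  let ?P = "\<lambda>K F. (\<forall>i\<in>I. B i K F) \<and> A K F"
  have IH: "leadsto A (card I * a) ?P" using insert by auto
  have "monotone_prop ?P"
  proof (rule monotone_propI)
    fix K F K' F' assume *: "(\<forall>i\<in>I. B i K F) \<and> A K F" and sub: "K \<subseteq> K'" "F \<subseteq> F'"
    have "B i K' F'" if i: "i \<in> I" for i
      by (rule monotone_propD[OF insert.prems(2) _ sub]) (use * i in simp_all)
    moreover have "A K' F'" by (rule monotone_propD[OF assms(3) conjunct2[OF *] sub])
    ultimately show "(\<forall>i\<in>I. B i K' F') \<and> A K' F'" by simp
  qed
  from leadsto_frame[OF _ this, of A a "B i"] insert.prems(1)
  have "leadsto (\<lambda>K F. A K F \<and> ?P K F) a (\<lambda>K F. B i K F \<and> ?P K F)" by blast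
  then have "leadsto ?P a (\<lambda>K F. (\<forall>i\<in>insert i I. B i K F) \<and> A K F)"
    by (rule leadsto_weaken) auto
  from leadsto_trans[OF IH this] show ?case using insert(1,2) by (simp add: add.commute)
qed

text \<open>The calculus is started from the empty state with \<open>p = 1\<close>; once no step is
  left the decision is deterministic.\<close>

lemma rej_expl_leadsto:
  assumes "leadsto (\<lambda>K F. True) M B" "\<And>K F. consistent K F \<Longrightarrow> B K F \<Longrightarrow> \<not> dec F"
  shows "(\<beta> / (M + 1)) ^ M \<le> rej G (expl dec n M M [] {})"
proof -
  have "1 * (\<beta> / (M + 1)) ^ M \<le> rej G (expl dec n M (0 + M) [] {})"
  proof (rule leadstoD[OF assms(1)])
    fix xs' F' assume "consistent (set xs') F'" "B (set xs') F'"
    then have "\<not> dec F'" using assms(2) by blast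
    then show "1 \<le> rej G (expl dec n M 0 xs' F')" by (simp add: rej_def measure_return)
  qed (auto simp: consistent_def)
  then show ?thesis by simp
qed

end

section \<open>Elimination forests of patterns\<close>

locale pattern =
  fixes P :: "nat set set" and k :: nat
  assumes P: "\<And>e. e \<in> P \<Longrightarrow> e \<subseteq> {..<k} \<and> card e = 2"
begin

text \<open>The elimination forest of \<open>P\<close> for the order of the naturals: \<open>pcomp h\<close> is the component of \<open>h\<close>
  in the pattern induced by \<open>{..h}\<close>, and \<open>att h\<close> is the set of its neighbours, all above \<open>h\<close>.\<close>

definition pcomp :: "nat \<Rightarrow> nat set" where
  "pcomp h = {s. (h, s) \<in> (adj_rel P {..h})\<^sup>*}"

definition att :: "nat \<Rightarrow> nat set" where
  "att h = {j. h < j \<and> (\<exists>s\<in>pcomp h. {j, s} \<in> P)}"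

text \<open>Says that \<open>pcomp c\<close> is a whole component of the pattern induced by
  \<open>{..<h}\<close>, named by its largest vertex.\<close>

definition block :: "nat \<Rightarrow> nat \<Rightarrow> bool" where
  "block h c \<longleftrightarrow> c < h \<and> (\<forall>j\<in>att c. h \<le> j)"

lemma P_neq: "{i, j} \<in> P \<Longrightarrow> i \<noteq> j"
  using P[of "{i, j}"] by auto

lemma P_less: "{i, j} \<in> P \<Longrightarrow> i < k \<and> j < k"
  using P[of "{i, j}"] by auto

lemma pcomp_self: "h \<in> pcomp h"
  unfolding pcomp_def by simp

lemma pcomp_le: "s \<in> pcomp h \<Longrightarrow> s \<le> h"
  unfolding pcomp_def using adj_rel_rtrancl_in[of h s P "{..h}"] by simp

lemma att_less: "j \<in> att h \<Longrightarrow> h < j \<and> j < k"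
  unfolding att_def using P_less by auto

lemma finite_att: "finite (att h)"
  using att_less by (intro finite_subset[of "att h" "{..<k}"]) auto

lemma card_att: "card (att h) \<le> k"
  using att_less card_mono[of "{..<k}" "att h"] by auto

lemma attI: "s \<in> pcomp h \<Longrightarrow> {s, j} \<in> P \<Longrightarrow> h < j \<Longrightarrow> j \<in> att h"
  unfolding att_def by (auto simp: insert_commute)

lemma attE:
  assumes "j \<in> att h"
  obtains s where "s \<in> pcomp h" "{s, j} \<in> P" "{j, s} \<in> P" "h < j"
  using assms unfolding att_def by (auto simp: insert_commute)

lemma pcomp_edge:
  assumes "s \<in> pcomp h" "{s, j} \<in> P" "j \<le> h"
  shows "j \<in> pcomp h"
proof -
  have "(s, j) \<in> adj_rel P {..h}" using assms pcomp_le unfolding adj_rel_def by auto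
  then show ?thesis using assms(1) unfolding pcomp_def by (auto intro: rtrancl_into_rtrancl)
qed

lemma pcomp_edge_cases:
  assumes "s \<in> pcomp h" "{s, j} \<in> P"
  shows "j \<in> pcomp h \<or> j \<in> att h"
  using pcomp_edge[OF assms] attI[OF assms] by linarith

lemma pcomp_trans:
  assumes "s \<in> pcomp h"
  shows "pcomp s \<subseteq> pcomp h"
proof
  fix u assume "u \<in> pcomp s"
  then have "(s, u) \<in> (adj_rel P {..h})\<^sup>*"
    using adj_rel_rtrancl_mono[of "{..s}" "{..h}" P] pcomp_le[OF assms] unfolding pcomp_def by auto
  then show "u \<in> pcomp h" using assms unfolding pcomp_def by (simp add: rtrancl_trans[of h s])
qed

lemma att_pcomp:
  assumes "s \<in> pcomp h"
  shows "att s \<subseteq> att h \<union> pcomp h"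
proof
  fix j assume "j \<in> att s"
  then obtain t where "t \<in> pcomp s" "{t, j} \<in> P" by (rule attE)
  then show "j \<in> att h \<union> pcomp h" using pcomp_trans[OF assms] pcomp_edge_cases[of t h j] by auto
qed

text \<open>On a walk from \<open>s\<close> to \<open>h\<close> inside \<open>{..h}\<close>, the
  first vertex outside \<open>pcomp s\<close> is an attachment of \<open>s\<close>. This provides
  the upward moves of the search.\<close>

lemma pcomp_climb:
  assumes "s \<in> pcomp h" "s \<noteq> h"
  shows "\<exists>v\<in>att s. v \<in> pcomp h"
proof -
  have sh: "(s, h) \<in> (adj_rel P {..h})\<^sup>*"
    using assms(1) adj_rel_rtrancl_sym unfolding pcomp_def by auto
  have "u \<in> pcomp s \<or> (\<exists>v\<in>att s. v \<in> pcomp h)" if "(s, u) \<in> (adj_rel P {..h})\<^sup>*" for u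
    using that
  proof (induction rule: rtrancl_induct)
    case base
    show ?case using pcomp_self by simp
  next
    case (step y z)
    show ?case
    proof (cases "\<exists>v\<in>att s. v \<in> pcomp h")
      case False
      then have y: "y \<in> pcomp s" using step.IH by simp
      have yz: "{y, z} \<in> P" "z \<le> h" using step(2) unfolding adj_rel_def by auto
      have "z \<in> pcomp h" using pcomp_edge[OF _ yz] y pcomp_trans[OF assms(1)] by blast
      then show ?thesis using pcomp_edge_cases[OF y yz(1)] by blast
    qed simp
  qed
  from this[OF sh] show ?thesis using pcomp_le[of h s] pcomp_le[OF assms(1)] assms(2) by auto
qed

text \<open>The sets \<open>pcomp\<close> form a laminar family: two that meet are nested.\<close>

lemma pcomp_common:
  assumes "s \<in> pcomp c" "s \<in> pcomp h" "c \<le> h"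
  shows "c \<in> pcomp h"
proof -
  have "(s, c) \<in> (adj_rel P {..c})\<^sup>*" using assms(1) adj_rel_rtrancl_sym unfolding pcomp_def by auto
  then have "(s, c) \<in> (adj_rel P {..h})\<^sup>*" using adj_rel_rtrancl_mono[of "{..c}" "{..h}" P] assms(3) by auto
  then show ?thesis using assms(2) unfolding pcomp_def by (simp add: rtrancl_trans[of h s])
qed

text \<open>Take the largest \<open>c\<close> below \<open>h\<close> whose component contains
  \<open>s\<close>; an attachment of it below \<open>h\<close> would be a larger candidate.\<close>

lemma block_exists:
  assumes "s < h"
  shows "\<exists>c. block h c \<and> s \<in> pcomp c"
proof -
  let ?A = "{c. c < h \<and> s \<in> pcomp c}"
  define c where "c = Max ?A"
  have A: "finite ?A" "s \<in> ?A" using assms pcomp_self by auto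
  then have "c \<in> ?A" unfolding c_def by (intro Max_in) blast+
  then have c: "c < h" "s \<in> pcomp c" by auto
  have "h \<le> j" if j: "j \<in> att c" for j
  proof (rule ccontr)
    assume "\<not> h \<le> j"
    obtain t where t: "t \<in> pcomp c" "{t, j} \<in> P" "{j, t} \<in> P" "c < j" using j by (rule attE)
    have "t \<in> pcomp j" using pcomp_edge[OF pcomp_self t(3)] pcomp_le[OF t(1)] t(4) by simp
    then have "c \<in> pcomp j" using pcomp_common[OF t(1)] t(4) by simp
    then have "j \<in> ?A" using pcomp_trans c(2) \<open>\<not> h \<le> j\<close> by auto
    then show False using Max_ge[OF A(1)] t(4) unfolding c_def by fastforce
  qed
  then show ?thesis using c unfolding block_def by auto
qed

lemma block_pcomp:
  assumes "block h c" "s \<in> pcomp c" "s \<in> pcomp h"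
  shows "c \<in> pcomp h" "h \<in> att c"
proof -
  have "c < h" using assms(1) unfolding block_def by simp
  then show c: "c \<in> pcomp h" using pcomp_common[OF assms(2,3)] by simp
  then obtain v where v: "v \<in> att c" "v \<in> pcomp h" using pcomp_climb \<open>c < h\<close> by blast
  then have "v = h" using pcomp_le[of v h] assms(1) unfolding block_def by force
  then show "h \<in> att c" using v by simp
qed

lemma block_unique:
  assumes "block h c" "block h c'" "s \<in> pcomp c" "s \<in> pcomp c'"
  shows "c = c'"
proof -
  have False if cc: "block h c" "block h c'" "s \<in> pcomp c" "s \<in> pcomp c'" "c' < c" for c c'
  proof -
    have "c' \<in> pcomp c" using pcomp_common[OF cc(4,3)] cc(5) by simp
    then obtain v where "v \<in> att c'" "v \<in> pcomp c" using pcomp_climb cc(5) by blast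
    then show False using pcomp_le[of v c] cc(1,2) unfolding block_def by force
  qed
  then show ?thesis using assms by (meson linorder_neqE_nat)
qed

lemma block_edge:
  assumes "block h c" "s \<in> pcomp c" "{s, j} \<in> P" "j < h"
  shows "j \<in> pcomp c"
  using pcomp_edge_cases[OF assms(2,3)] assms(1,4) unfolding block_def by force

text \<open>Colours stand in for injectivity, as images of distinct pattern vertices have distinct
  colours. Edges between two attachments are not demanded here; they are supplied at higher pattern
  vertices.\<close>

definition colored_hom :: "(nat \<Rightarrow> nat) \<Rightarrow> nat set set \<Rightarrow> nat \<Rightarrow> (nat \<Rightarrow> nat) \<Rightarrow> bool" where
  "colored_hom col F h g \<longleftrightarrow> (\<forall>i\<in>pcomp h \<union> att h. col (g i) = i) \<and>
     (\<forall>i\<in>pcomp h. \<forall>j. {i, j} \<in> P \<longrightarrow> {g i, g j} \<in> F)"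

lemma colored_hom_mono: "colored_hom col F h g \<Longrightarrow> F \<subseteq> F' \<Longrightarrow> colored_hom col F' h g"
  unfolding colored_hom_def by blast

text \<open>An edge leaving \<open>pcomp c\<close> ends in \<open>att c\<close>, hence at
  \<open>h\<close> or above, where every \<open>g c\<close> agrees with \<open>f\<close>. So
  independent choices for different components fit together.\<close>

lemma glue_blocks:
  assumes "\<And>c. c \<in> C \<Longrightarrow> block h c"
    "\<And>c. c \<in> C \<Longrightarrow> colored_hom col F c (g c) \<and> (\<forall>j\<in>att c. g c j = f j)"
  shows "\<exists>g'. (\<forall>i. (\<forall>c\<in>C. i \<notin> pcomp c) \<longrightarrow> g' i = f i) \<and>
    (\<forall>c\<in>C. \<forall>i\<in>pcomp c. col (g' i) = i \<and> (\<forall>j. {i, j} \<in> P \<longrightarrow> {g' i, g' j} \<in> F))"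
proof -
  define g' where "g' i = (if \<exists>c\<in>C. i \<in> pcomp c then g (SOME c. c \<in> C \<and> i \<in> pcomp c) i else f i)" for i
  have g': "g' i = g c i" if "c \<in> C" "i \<in> pcomp c" for c i
  proof -
    have "(SOME c. c \<in> C \<and> i \<in> pcomp c) = c"
      using that block_unique[of h _ c i] assms(1) by (intro some_equality) auto
    then show ?thesis using that unfolding g'_def by auto
  qed
  have far: "g' j = f j" if "h \<le> j" for j
    using that pcomp_le assms(1) unfolding g'_def block_def by (meson leD le_less_trans)
  have "col (g' i) = i \<and> (\<forall>j. {i, j} \<in> P \<longrightarrow> {g' i, g' j} \<in> F)" if c: "c \<in> C" "i \<in> pcomp c" for c i
  proof (intro conjI allI impI)
    show "col (g' i) = i" using g'[OF c] assms(2)[OF c(1)] c(2) unfolding colored_hom_def by auto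
    fix j assume ij: "{i, j} \<in> P"
    have "g' j = g c j"
    proof (cases "j < h")
      case True
      then show ?thesis using g'[OF c(1)] block_edge[OF assms(1)[OF c(1)] c(2) ij] by simp
    next
      case False
      then have "j \<in> att c"
        using pcomp_edge_cases[OF c(2) ij] pcomp_le[of j c] assms(1)[OF c(1)] unfolding block_def by auto
      then show ?thesis using far False assms(2)[OF c(1)] by simp
    qed
    then show "{g' i, g' j} \<in> F"
      using g'[OF c] assms(2)[OF c(1)] c(2) ij unfolding colored_hom_def by auto
  qed
  moreover have "g' i = f i" if "\<forall>c\<in>C. i \<notin> pcomp c" for i using that unfolding g'_def by auto
  ultimately show ?thesis by (intro exI[of _ g']) simp
qed

end

section \<open>Deleting rare connections\<close>

text \<open>Bound on the deleted edges in units of \<open>\<beta> * n\<close>: one summand each for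
  \<open>stage 0\<close>, for the \<open>k\<close> rounds of \<open>rare\<close>, and for
  \<open>final\<close>.\<close>

definition loss :: "nat \<Rightarrow> nat \<Rightarrow> nat" where
  "loss k K = K * (2 * K) + k * (k * (K + 1) ^ k * (2 * K)) + k * K"

locale pruning = exploration G dec n M \<beta> + pattern P k
  for G :: "nat sgraph" and dec n M \<beta> P k +
  fixes col rank :: "nat \<Rightarrow> nat" and K :: nat
  assumes rank_inj: "inj_on rank {1..n}"
    and reach: "\<And>x. x \<in> {1..n} \<Longrightarrow> card {z\<in>{1..n}. rank x < rank z \<and>
      z \<in> sreach (edges G) {u\<in>{1..n}. rank u < rank x} (k * k + 2) x} \<le> K"
begin

text \<open>The hubs of \<open>x\<close>. The radius covers a walk through a component of the
  pattern: at most \<open>k * k\<close> steps inside, one to enter and one to leave.\<close>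

definition up :: "nat \<Rightarrow> nat set" where
  "up x = {z\<in>{1..n}. rank x < rank z \<and>
      z \<in> sreach (edges G) {u\<in>{1..n}. rank u < rank x} (k * k + 2) x}"

abbreviation deg :: "nat \<Rightarrow> nat" where
  "deg x \<equiv> card (neighbors G x)"

lemma finite_up: "finite (up x)"
  unfolding up_def by simp

lemma card_up: "x \<in> {1..n} \<Longrightarrow> card (up x) \<le> K"
  unfolding up_def by (rule reach)

lemma edge_in: "{x, y} \<in> edges G \<Longrightarrow> x \<in> {1..n} \<and> y \<in> {1..n} \<and> x \<noteq> y"
  using G unfolding simple_graph_def by fastforce

lemma finite_neighbors: "finite (neighbors G x)"
proof (rule finite_subset)
  show "neighbors G x \<subseteq> {1..n}" using edge_in unfolding neighbors_def by auto
qed simp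

lemma finite_edges: "finite (edges G)"
  using simple_graph_finite_edges G(1) .

lemma up_edge: "{x, y} \<in> edges G \<Longrightarrow> rank x < rank y \<Longrightarrow> y \<in> up x"
proof -
  assume e: "{x, y} \<in> edges G" "rank x < rank y"
  have "y \<in> sreach (edges G) U (k * k + 2) x" for U
    unfolding sreach_def using e(1)
    by (intro CollectI exI[of _ "0 :: nat"] exI[of _ x] conjI) simp_all
  then show ?thesis using e edge_in[of x y] unfolding up_def by simp
qed

lemma card_up_edges:
  assumes "Z \<subseteq> {1..n}"
  shows "card {e \<in> edges G. \<exists>x\<in>Z. \<exists>y. e = {x, y} \<and> rank x < rank y} \<le> K * card Z"
proof -
  have Z: "finite Z" using assms by (rule finite_subset) simp
  have "{e \<in> edges G. \<exists>x\<in>Z. \<exists>y. e = {x, y} \<and> rank x < rank y} \<subseteq> (\<lambda>(x, y). {x, y}) ` (SIGMA x:Z. up x)"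
    using up_edge by auto
  then have "card {e \<in> edges G. \<exists>x\<in>Z. \<exists>y. e = {x, y} \<and> rank x < rank y} \<le> card (SIGMA x:Z. up x)"
    using Z finite_up by (intro surj_card_le) auto
  also have "\<dots> = (\<Sum>x\<in>Z. card (up x))" using Z finite_up by simp
  also have "\<dots> \<le> (\<Sum>x\<in>Z. K)" using card_up assms by (intro sum_mono) auto
  finally show ?thesis by (simp add: mult.commute)
qed

text \<open>Every edge joins its lower end to one of at most \<open>K\<close> hubs of that end; the
  two orientations give the factor \<open>2\<close>.\<close>

lemma sum_deg: "(\<Sum>x\<in>{1..n}. deg x) \<le> 2 * K * n"
proof -
  let ?D = "SIGMA x:{1..n}. up x"
  have "(\<Sum>x\<in>{1..n}. deg x) = card (SIGMA x:{1..n}. neighbors G x)"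
    using finite_neighbors by simp
  also have "\<dots> \<le> card (?D \<union> prod.swap ` ?D)"
  proof (rule card_mono)
    show "(SIGMA x:{1..n}. neighbors G x) \<subseteq> ?D \<union> prod.swap ` ?D"
    proof
      fix p assume "p \<in> (SIGMA x:{1..n}. neighbors G x)"
      then obtain x y where p: "p = (x, y)" "{x, y} \<in> edges G" "{y, x} \<in> edges G"
        unfolding neighbors_def by (auto simp: insert_commute)
      have "rank x \<noteq> rank y" using rank_inj edge_in[OF p(2)] by (auto dest: inj_onD)
      then have "y \<in> up x \<or> x \<in> up y" using up_edge p by (meson linorder_neqE_nat)
      then show "p \<in> ?D \<union> prod.swap ` ?D"
        using p(1) edge_in[OF p(2)] by (force simp: image_iff)
    qed
  qed (use finite_up in auto)
  also have "\<dots> \<le> card ?D + card (prod.swap ` ?D)" by (rule card_Un_le)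
  also have "\<dots> \<le> card ?D + card ?D" using finite_up by (intro add_left_mono card_image_le) auto
  finally have le: "(\<Sum>x\<in>{1..n}. deg x) \<le> card ?D + card ?D" .
  have "card ?D = (\<Sum>x\<in>{1..n}. card (up x))" using finite_up by simp
  also have "\<dots> \<le> (\<Sum>x\<in>{1..n}. K)" using card_up by (intro sum_mono) auto
  finally have "card ?D \<le> K * n" by (simp add: mult.commute)
  then show ?thesis using le by simp
qed

section \<open>Pieces of copies and the successive deletions\<close>

definition piece :: "nat set set \<Rightarrow> nat \<Rightarrow> (nat \<Rightarrow> nat) \<Rightarrow> bool" where
  "piece A h f \<longleftrightarrow> (\<forall>i\<in>pcomp h \<union> att h. col (f i) = i \<and> f i \<in> {1..n}) \<and>
     (\<forall>i\<in>pcomp h \<union> att h. \<forall>j\<in>pcomp h \<union> att h. i < j \<longrightarrow> rank (f i) < rank (f j)) \<and>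
     (\<forall>i\<in>pcomp h. \<forall>j. {i, j} \<in> P \<longrightarrow> {f i, f j} \<in> A)"

lemma pieceD:
  assumes "piece A h f"
  shows "i \<in> pcomp h \<union> att h \<Longrightarrow> col (f i) = i" "i \<in> pcomp h \<union> att h \<Longrightarrow> f i \<in> {1..n}"
    "i \<in> pcomp h \<union> att h \<Longrightarrow> j \<in> pcomp h \<union> att h \<Longrightarrow> i < j \<Longrightarrow> rank (f i) < rank (f j)"
    "i \<in> pcomp h \<Longrightarrow> {i, j} \<in> P \<Longrightarrow> {f i, f j} \<in> A"
  using assms unfolding piece_def by auto

lemma piece_mono: "piece A h f \<Longrightarrow> A \<subseteq> A' \<Longrightarrow> piece A' h f"
  unfolding piece_def by blast

lemma piece_sub:
  assumes "piece A h f" "s \<in> pcomp h"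
  shows "piece A s f"
proof -
  have "pcomp s \<union> att s \<subseteq> pcomp h \<union> att h" "pcomp s \<subseteq> pcomp h"
    using pcomp_trans[OF assms(2)] att_pcomp[OF assms(2)] by auto
  then show ?thesis unfolding piece_def
    by (intro conjI ballI allI impI) (blast intro: pieceD[OF assms(1)])+
qed

text \<open>The answers to a query at \<open>q h\<close> that enter some component of type
  \<open>c\<close> whose attachments are the ones prescribed by \<open>q\<close>.\<close>

definition hits :: "nat set set \<Rightarrow> nat \<Rightarrow> nat \<Rightarrow> (nat \<Rightarrow> nat) \<Rightarrow> nat set" where
  "hits A h c q = {y. \<exists>f s. piece A c f \<and> (\<forall>j\<in>att c. f j = q j) \<and> s \<in> pcomp c \<and> {h, s} \<in> P \<and> y = f s}"

definition rare :: "nat set set \<Rightarrow> nat \<Rightarrow> nat set set" where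
  "rare A h = {e. \<exists>c q y. block h c \<and> h \<in> att c \<and> y \<in> hits A h c q \<and>
     real (card (hits A h c q)) < \<beta> * deg (q h) \<and> e = {q h, y}}"

text \<open>\<open>stage 0\<close> drops the upward edges at vertices of degree above
  \<open>1 / \<beta>\<close>, so that each remaining one is found by a single query. For colour
  \<open>h\<close> the hits are computed in \<open>stage h\<close>, after all lower colours have
  been treated.\<close>

primrec stage :: "nat \<Rightarrow> nat set set" where
  "stage 0 = {e \<in> edges G. \<forall>x y. e = {x, y} \<longrightarrow> rank x < rank y \<longrightarrow> \<beta> * deg x \<le> 1}"
| "stage (Suc h) = stage h - rare (stage h) h"

text \<open>A component of the whole pattern has no attachment and is entered by a fresh vertex, so
  its hits are compared with \<open>n\<close> instead of a degree.\<close>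

definition root_hits :: "nat \<Rightarrow> nat set" where
  "root_hits c = {y. \<exists>f s. piece (stage k) c f \<and> s \<in> pcomp c \<and> y = f s}"

text \<open>Deleting only upward edges keeps the cost at \<open>K\<close> per vertex and still
  destroys every such component that has an edge.\<close>

definition final :: "nat set set" where
  "final = stage k - {e. \<exists>c x y. c < k \<and> att c = {} \<and> real (card (root_hits c)) < \<beta> * n \<and>
     x \<in> root_hits c \<and> e = {x, y} \<and> rank x < rank y}"

lemma stage_antimono: "h \<le> h' \<Longrightarrow> stage h' \<subseteq> stage h"
  by (induction h' rule: dec_induct) auto

lemma stage_edges: "stage h \<subseteq> edges G"
  using stage_antimono[of 0 h] by auto

lemma final_stage: "h \<le> k \<Longrightarrow> final \<subseteq> stage h"
  using stage_antimono[of h k] unfolding final_def by auto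

lemma hits_neighbors:
  assumes "A \<subseteq> edges G" "h \<in> att c"
  shows "hits A h c q \<subseteq> neighbors G (q h)"
proof
  fix y assume "y \<in> hits A h c q"
  then obtain f s where f: "piece A c f" "\<forall>j\<in>att c. f j = q j" "s \<in> pcomp c" "{h, s} \<in> P" "y = f s"
    unfolding hits_def by blast
  then have "{f s, f h} \<in> A" using pieceD(4)[OF f(1,3), of h] by (simp add: insert_commute)
  then show "y \<in> neighbors G (q h)" using f(2,5) assms unfolding neighbors_def by (auto simp: insert_commute)
qed

lemma hits_restrict: "hits A h c (restrict q (att c)) = hits A h c q"
  unfolding hits_def by simp

lemma card_adj_rel: "c < k \<Longrightarrow> card (adj_rel P {..c}) \<le> k * k"
proof -
  assume "c < k"
  then have "adj_rel P {..c} \<subseteq> {..<k} \<times> {..<k}" unfolding adj_rel_def by auto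
  then have "card (adj_rel P {..c}) \<le> card ({..<k} \<times> {..<k})" by (intro card_mono) auto
  then show ?thesis by simp
qed

text \<open>A piece attached at \<open>x\<close> contains a short walk through vertices of smaller rank from \<open>x\<close> to each
  of its other attachments, so these lie in \<open>up x\<close>.\<close>

lemma piece_up:
  assumes A: "A \<subseteq> edges G" and c: "block h c" "h \<in> att c" "h \<le> k" and f: "piece A c f" and j: "j \<in> att c"
  shows "f j \<in> insert (f h) (up (f h))"
proof (cases "j = h")
  case False
  have ch: "c < h" "h < j" using c(1) j False unfolding block_def by auto
  let ?U = "{u\<in>{1..n}. rank u < rank (f h)}"
  let ?R = "adj_rel P {..c}"
  have E: "{f a, f b} \<in> edges G" if "a \<in> pcomp c" "{a, b} \<in> P" for a b
    using pieceD(4)[OF f that] A by auto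
  have U: "f a \<in> ?U" if "a \<in> pcomp c" for a
    using pieceD(2,3)[OF f] that c(2) pcomp_le[OF that] ch by auto
  obtain s where s: "s \<in> pcomp c" "{s, h} \<in> P" "{h, s} \<in> P" using c(2) by (rule attE)
  obtain t where t: "t \<in> pcomp c" "{t, j} \<in> P" using j by (rule attE)
  have "(s, t) \<in> ?R\<^sup>*"
    using s(1) t(1) adj_rel_rtrancl_sym[of c s P] unfolding pcomp_def by (simp add: rtrancl_trans[of s c])
  moreover have "finite ?R" using finite_subset[of ?R "{..c} \<times> {..c}"] unfolding adj_rel_def by auto
  ultimately obtain m where m: "m \<le> card ?R" "(s, t) \<in> ?R ^^ m"
    using rtrancl_finite_eq_relpow[of ?R] by auto
  have "(f s, f b) \<in> via (edges G) ?U ^^ l \<and> b \<in> pcomp c" if "(s, b) \<in> ?R ^^ l" for b l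
    using that
  proof (induction l arbitrary: b)
    case 0
    then show ?case using s(1) by simp
  next
    case (Suc l)
    then obtain a where a: "(s, a) \<in> ?R ^^ l" "(a, b) \<in> ?R" by auto
    then have ab: "{a, b} \<in> P" "b \<le> c" unfolding adj_rel_def by auto
    have IH: "(f s, f a) \<in> via (edges G) ?U ^^ l" "a \<in> pcomp c" using Suc.IH[OF a(1)] by auto
    have b: "b \<in> pcomp c" using pcomp_edge[OF IH(2) ab] .
    have "(f a, f b) \<in> via (edges G) ?U" using E[OF IH(2) ab(1)] U[OF b] unfolding via_def by simp
    then show ?case using IH(1) b by auto
  qed
  then have st: "(f s, f t) \<in> via (edges G) ?U ^^ m" using m(2) by blast
  have "(f h, f s) \<in> via (edges G) ?U"
    using E[OF s(1,2)] U[OF s(1)] unfolding via_def by (simp add: insert_commute)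
  then have "(f h, f t) \<in> via (edges G) ?U ^^ Suc m" using st by (rule relpow_Suc_I2)
  moreover have "Suc m < k * k + 2" using m(1) card_adj_rel[of c] ch c(3) by simp
  moreover have "{f t, f j} \<in> edges G" using E[OF t] .
  ultimately have "f j \<in> sreach (edges G) ?U (k * k + 2) (f h)" unfolding sreach_def by blast
  moreover have "rank (f h) < rank (f j)" "f j \<in> {1..n}" using pieceD(2,3)[OF f] c(2) j ch by auto
  ultimately show ?thesis unfolding up_def by simp
qed simp

section \<open>Counting the deleted edges\<close>

lemma real_card_UN_le:
  assumes "finite I"
  shows "real (card (\<Union>i\<in>I. B i)) \<le> (\<Sum>i\<in>I. real (card (B i)))"
  using card_UN_le[OF assms, of B] by (metis of_nat_le_iff of_nat_sum)

text \<open>Edges are charged to \<open>x = q h\<close>: at most \<open>k\<close> types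
  \<open>c\<close>, at most \<open>(K + 1) ^ k\<close> ways to place the attachments on
  \<open>x\<close> and its hubs, and at most \<open>\<beta> * deg x\<close> edges for each. The
  degree sum finishes the count.\<close>

lemma card_rare:
  assumes A: "A \<subseteq> edges G" and h: "h < k"
  shows "real (card (rare A h)) \<le> \<beta> * (k * (K + 1) ^ k * (2 * K * n))"
proof -
  let ?Q = "\<lambda>x c. PiE (att c) (\<lambda>_. insert x (up x))"
  define B where "B x c q = (if h \<in> att c \<and> q h = x \<and> real (card (hits A h c q)) < \<beta> * deg x
    then (\<lambda>y. {x, y}) ` hits A h c q else {})" for x c q
  have sub: "rare A h \<subseteq> (\<Union>x\<in>{1..n}. \<Union>c\<in>{..<h}. \<Union>q\<in>?Q x c. B x c q)"
  proof
    fix e assume "e \<in> rare A h"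
    then obtain c q y where e: "block h c" "h \<in> att c" "y \<in> hits A h c q"
     "real (card (hits A h c q)) < \<beta> * deg (q h)" "e = {q h, y}" unfolding rare_def by blast
    then obtain f s where f: "piece A c f" "\<forall>j\<in>att c. f j = q j" unfolding hits_def by blast
    \<comment> \<open>\<open>hits\<close> consults \<open>q\<close> on \<open>att c\<close> only, so
      \<open>q\<close> may be cut down to an element of the finite function space.\<close>
    let ?q = "restrict q (att c)"
    have "?q \<in> ?Q (q h) c"
      using piece_up[OF A e(1,2) _ f(1)] f(2) e(2) h by (auto simp: PiE_iff)
    moreover have "q h \<in> {1..n}" using pieceD(2)[OF f(1), of h] f(2) e(2) by auto
    moreover have "c \<in> {..<h}" using e(1) unfolding block_def by simp
    moreover have "e \<in> B (q h) c ?q" using e unfolding B_def by (simp add: hits_restrict)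
    ultimately show "e \<in> (\<Union>x\<in>{1..n}. \<Union>c\<in>{..<h}. \<Union>q\<in>?Q x c. B x c q)" by blast
  qed
  have B: "finite (B x c q)" "real (card (B x c q)) \<le> \<beta> * deg x" for x c q
  proof -
    have fin: "finite (hits A h c q)" if "h \<in> att c"
      using hits_neighbors[OF A that] finite_neighbors by (rule finite_subset)
    then show "finite (B x c q)" unfolding B_def by simp
    have "real (card ((\<lambda>y. {x, y}) ` hits A h c q)) \<le> real (card (hits A h c q))" if "h \<in> att c"
      using card_image_le[OF fin[OF that]] by (simp only: of_nat_le_iff)
    then show "real (card (B x c q)) \<le> \<beta> * deg x" unfolding B_def using \<beta> by auto
  qed
  have Q: "finite (?Q x c)" "x \<in> {1..n} \<Longrightarrow> card (?Q x c) \<le> (K + 1) ^ k" for x c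
  proof -
    show "finite (?Q x c)" using finite_att finite_up by (intro finite_PiE) auto
    assume x: "x \<in> {1..n}"
    have "card (?Q x c) = card (insert x (up x)) ^ card (att c)"
      using finite_att by (subst card_PiE) auto
    also have "\<dots> \<le> (K + 1) ^ card (att c)"
      using card_up[OF x] finite_up by (intro power_mono) (auto simp: card_insert_if)
    also have "\<dots> \<le> (K + 1) ^ k" using card_att by (intro power_increasing) auto
    finally show "card (?Q x c) \<le> (K + 1) ^ k" .
  qed
  have "card (rare A h) \<le> card (\<Union>x\<in>{1..n}. \<Union>c\<in>{..<h}. \<Union>q\<in>?Q x c. B x c q)"
    using sub B(1) Q(1) by (intro card_mono) auto
  then have "real (card (rare A h)) \<le> real (card (\<Union>x\<in>{1..n}. \<Union>c\<in>{..<h}. \<Union>q\<in>?Q x c. B x c q))" by simp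
  also have "\<dots> \<le> (\<Sum>x\<in>{1..n}. real (card (\<Union>c\<in>{..<h}. \<Union>q\<in>?Q x c. B x c q)))"
    by (rule real_card_UN_le) simp
  also have "\<dots> \<le> (\<Sum>x\<in>{1..n}. \<Sum>c\<in>{..<h}. real (card (\<Union>q\<in>?Q x c. B x c q)))"
    by (intro sum_mono real_card_UN_le) simp
  also have "\<dots> \<le> (\<Sum>x\<in>{1..n}. \<Sum>c\<in>{..<h}. \<Sum>q\<in>?Q x c. real (card (B x c q)))"
    using Q(1) by (intro sum_mono real_card_UN_le) simp
  also have "\<dots> \<le> (\<Sum>x\<in>{1..n}. \<Sum>c\<in>{..<h}. \<Sum>q\<in>?Q x c. \<beta> * deg x)"
    by (intro sum_mono B(2))
  also have "\<dots> \<le> (\<Sum>x\<in>{1..n}. \<Sum>c\<in>{..<h}. (K + 1) ^ k * (\<beta> * deg x))"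
  proof (intro sum_mono)
    fix x c assume x: "x \<in> {1..n}"
    have "real (card (?Q x c)) * (\<beta> * deg x) \<le> real ((K + 1) ^ k) * (\<beta> * deg x)"
      using Q(2)[OF x, of c] \<beta> by (intro mult_right_mono) (simp_all only: of_nat_le_iff, simp)
    then show "(\<Sum>q\<in>?Q x c. \<beta> * deg x) \<le> real ((K + 1) ^ k) * (\<beta> * deg x)" by simp
  qed
  also have "\<dots> = (\<Sum>x\<in>{1..n}. (h * (K + 1) ^ k * \<beta>) * deg x)" by (simp add: algebra_simps)
  also have "\<dots> = (h * (K + 1) ^ k * \<beta>) * real (\<Sum>x\<in>{1..n}. deg x)"
    by (simp add: sum_distrib_left)
  also have "\<dots> \<le> (k * (K + 1) ^ k * \<beta>) * real (2 * K * n)"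
    using h \<beta> sum_deg by (intro mult_mono) (auto intro!: mult_right_mono simp del: of_nat_sum of_nat_mult)
  finally show ?thesis by (simp add: algebra_simps)
qed

text \<open>Markov's inequality: at most \<open>\<beta> * (2 * K * n)\<close> vertices have degree
  above \<open>1 / \<beta>\<close>, and each loses at most \<open>K\<close> upward edges.\<close>

lemma card_base: "real (card (edges G - stage 0)) \<le> \<beta> * (K * (2 * K * n))"
proof -
  let ?Z = "{x\<in>{1..n}. 1 < \<beta> * deg x}"
  have "edges G - stage 0 \<subseteq> {e \<in> edges G. \<exists>x\<in>?Z. \<exists>y. e = {x, y} \<and> rank x < rank y}"
  proof
    fix e assume e: "e \<in> edges G - stage 0"
    then obtain x y where xy: "e = {x, y}" "rank x < rank y" "\<not> \<beta> * deg x \<le> 1" by auto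
    then have "x \<in> ?Z" using e edge_in[of x y] by auto
    then show "e \<in> {e \<in> edges G. \<exists>x\<in>?Z. \<exists>y. e = {x, y} \<and> rank x < rank y}" using e xy by blast
  qed
  then have "card (edges G - stage 0) \<le> card {e \<in> edges G. \<exists>x\<in>?Z. \<exists>y. e = {x, y} \<and> rank x < rank y}"
    using finite_edges by (intro card_mono) auto
  also have "\<dots> \<le> K * card ?Z" by (rule card_up_edges) auto
  finally have le: "real (card (edges G - stage 0)) \<le> K * real (card ?Z)"
    by (metis of_nat_le_iff of_nat_mult)
  have "real (card ?Z) = (\<Sum>x\<in>?Z. 1)" by simp
  also have "\<dots> \<le> (\<Sum>x\<in>?Z. \<beta> * deg x)" by (intro sum_mono) auto
  also have "\<dots> \<le> (\<Sum>x\<in>{1..n}. \<beta> * deg x)" using \<beta> by (intro sum_mono2) auto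
  also have "\<dots> = \<beta> * real (\<Sum>x\<in>{1..n}. deg x)" by (simp add: sum_distrib_left)
  also have "\<dots> \<le> \<beta> * real (2 * K * n)"
    using \<beta> sum_deg by (intro mult_left_mono of_nat_mono) simp_all
  finally have "K * real (card ?Z) \<le> K * (\<beta> * real (2 * K * n))" by (rule mult_left_mono) simp
  with le show ?thesis by (simp only: of_nat_mult mult.assoc mult.left_commute)
qed

lemma root_hits_sub: "root_hits c \<subseteq> {1..n}"
  unfolding root_hits_def using pieceD(2) by blast

lemma card_stage_final: "real (card (stage k - final)) \<le> \<beta> * (k * (K * n))"
proof -
  define B where "B c = (if real (card (root_hits c)) < \<beta> * n
    then {e \<in> edges G. \<exists>x\<in>root_hits c. \<exists>y. e = {x, y} \<and> rank x < rank y} else {})" for c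
  have "stage k - final \<subseteq> (\<Union>c\<in>{..<k}. B c)"
  proof
    fix e assume "e \<in> stage k - final"
    then obtain c x y where "e \<in> stage k" "c < k" "real (card (root_hits c)) < \<beta> * n"
      "x \<in> root_hits c" "e = {x, y}" "rank x < rank y" unfolding final_def by blast
    then show "e \<in> (\<Union>c\<in>{..<k}. B c)" using stage_edges unfolding B_def by auto
  qed
  moreover have "finite (\<Union>c\<in>{..<k}. B c)"
    by (rule finite_subset[OF _ finite_edges]) (auto simp: B_def split: if_splits)
  ultimately have "real (card (stage k - final)) \<le> real (card (\<Union>c\<in>{..<k}. B c))"
    by (simp add: card_mono)
  also have "\<dots> \<le> (\<Sum>c\<in>{..<k}. real (card (B c)))" by (rule real_card_UN_le) simp
  also have "\<dots> \<le> (\<Sum>c\<in>{..<k}. K * (\<beta> * n))"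
  proof (intro sum_mono)
    fix c
    show "real (card (B c)) \<le> K * (\<beta> * n)"
    proof (cases "real (card (root_hits c)) < \<beta> * n")
      case True
      have "real (card (B c)) \<le> real (K * card (root_hits c))"
        using card_up_edges[OF root_hits_sub, of c] True unfolding B_def by (simp only: of_nat_le_iff if_True)
      also have "\<dots> \<le> K * (\<beta> * n)" using True by (simp add: mult_left_mono)
      finally show ?thesis .
    next
      case False
      then show ?thesis using \<beta> unfolding B_def by simp
    qed
  qed
  finally show ?thesis by (simp add: algebra_simps)
qed

lemma card_stage: "h \<le> k \<Longrightarrow> real (card (edges G - stage h)) \<le>
  \<beta> * (K * (2 * K * n)) + h * (\<beta> * (k * (K + 1) ^ k * (2 * K * n)))"
proof (induction h)
  case 0
  show ?case using card_base by simp
next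
  case (Suc h)
  have "edges G - stage (Suc h) \<subseteq> (edges G - stage h) \<union> rare (stage h) h \<inter> edges G" by auto
  then have "card (edges G - stage (Suc h)) \<le> card ((edges G - stage h) \<union> rare (stage h) h \<inter> edges G)"
    using finite_edges by (intro card_mono) auto
  also have "\<dots> \<le> card (edges G - stage h) + card (rare (stage h) h \<inter> edges G)" by (rule card_Un_le)
  finally have *: "real (card (edges G - stage (Suc h))) \<le>
    real (card (edges G - stage h)) + real (card (rare (stage h) h \<inter> edges G))" by linarith
  have "rare (stage h) h \<subseteq> edges G"
  proof
    fix e assume "e \<in> rare (stage h) h"
    then show "e \<in> edges G"
      using hits_neighbors[OF stage_edges] unfolding rare_def neighbors_def by blast
  qed
  then have "rare (stage h) h \<inter> edges G = rare (stage h) h" by auto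
  then show ?case
    using * Suc card_rare[OF stage_edges, of h h] by (simp add: algebra_simps)
qed

lemma card_deleted: "real (card (edges G - final)) \<le> \<beta> * loss k K * n"
proof -
  have "edges G - final \<subseteq> (edges G - stage k) \<union> (stage k - final)" by auto
  then have "card (edges G - final) \<le> card ((edges G - stage k) \<union> (stage k - final))"
    using finite_edges stage_edges[of k] by (intro card_mono) (auto intro: finite_subset)
  also have "\<dots> \<le> card (edges G - stage k) + card (stage k - final)" by (rule card_Un_le)
  finally have "real (card (edges G - final)) \<le> real (card (edges G - stage k)) + real (card (stage k - final))"
    by linarith
  then show ?thesis using card_stage[of k] card_stage_final unfolding loss_def by (simp add: algebra_simps)
qed

text \<open>If every copy had lost an edge, disjointness would make these edges distinct, more than
  were deleted.\<close>

lemma surviving_copy: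
  assumes "finite \<Y>" "\<And>Y. Y \<in> \<Y> \<Longrightarrow> Y \<subseteq> edges G"
    "\<And>Y Y'. Y \<in> \<Y> \<Longrightarrow> Y' \<in> \<Y> \<Longrightarrow> Y \<noteq> Y' \<Longrightarrow> Y \<inter> Y' = {}"
    "\<beta> * loss k K * n < card \<Y>"
  shows "\<exists>Y\<in>\<Y>. Y \<subseteq> final"
proof (rule ccontr)
  assume "\<not> ?thesis"
  then have "\<forall>Y\<in>\<Y>. \<exists>e. e \<in> Y \<and> e \<notin> final" by blast
  then obtain g where g: "\<And>Y. Y \<in> \<Y> \<Longrightarrow> g Y \<in> Y \<and> g Y \<notin> final" by metis
  have "inj_on g \<Y>"
  proof (rule inj_onI)
    fix Y Y' assume "Y \<in> \<Y>" "Y' \<in> \<Y>" "g Y = g Y'"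
    then show "Y = Y'" using g[of Y] g[of Y'] assms(3)[of Y Y'] by auto
  qed
  moreover have "g ` \<Y> \<subseteq> edges G - final" using g assms(2) by auto
  ultimately have "card \<Y> \<le> card (edges G - final)" using finite_edges by (intro card_inj_on_le) auto
  then show False using card_deleted assms(4) by linarith
qed

end

section \<open>Discovering a surviving copy\<close>

text \<open>The number of exploration steps granted for completing a copy of \<open>pcomp h\<close>.\<close>

primrec budget :: "nat \<Rightarrow> nat \<Rightarrow> nat" where
  "budget k 0 = k"
| "budget k (Suc h) = k * (1 + (k + 1) * budget k h) + k"

lemma budget_mono:
  assumes "h \<le> h'"
  shows "budget k h \<le> budget k h'"
proof (rule lift_Suc_mono_le[of "budget k", OF _ assms])
  fix m
  show "budget k m \<le> budget k (Suc m)"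
  proof (cases "k = 0")
    case True
    then show ?thesis by (cases m) auto
  next
    case False
    then have "1 * budget k m \<le> (k * (k + 1)) * budget k m" by (intro mult_right_mono) auto
    then show ?thesis by (simp add: algebra_simps)
  qed
qed

context pruning
begin

text \<open>Agreement with \<open>f\<close> is asked on the attachments only: they are shared with
  other components, while everything below may be replaced.\<close>

definition found :: "nat \<Rightarrow> (nat \<Rightarrow> nat) \<Rightarrow> nat set \<Rightarrow> nat set set \<Rightarrow> bool" where
  "found h f U F \<longleftrightarrow> (\<exists>g. colored_hom col F h g \<and> (\<forall>j\<in>att h. g j = f j))"

lemma monotone_found: "monotone_prop (found h f)"
  using colored_hom_mono unfolding found_def by (intro monotone_propI) blast

lemma monotone_known: "monotone_prop (\<lambda>U F. x \<in> U)"
  by (intro monotone_propI) auto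

lemma monotone_edge: "monotone_prop (\<lambda>U F. e \<in> F)"
  by (intro monotone_propI) auto

text \<open>The index \<open>Suc h\<close> says that the deletion for colour \<open>h\<close> has
  been done, which is what makes queries at \<open>f h\<close> succeed.\<close>

definition discoverable :: "nat \<Rightarrow> bool" where
  "discoverable h \<longleftrightarrow>
     (\<forall>f. piece (stage (Suc h)) h f \<longrightarrow> leadsto (\<lambda>U F. f h \<in> U) (budget k h) (found h f))"

text \<open>Completing the component below the entry point \<open>s\<close> may replace its vertices
  but keeps \<open>f\<close> on \<open>att s\<close>. One attachment lies in \<open>pcomp c\<close>,
  strictly above \<open>s\<close>; its image is an end of a found edge, hence known, and the climb
  continues from there.\<close>

lemma leadsto_climb:
  assumes "h \<le> k" "\<And>i. i < h \<Longrightarrow> discoverable i" "piece (stage h) c f" "c < h"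
  shows "s \<in> pcomp c \<Longrightarrow> leadsto (\<lambda>U F. f s \<in> U) ((c - s) * budget k (h - 1)) (\<lambda>U F. f c \<in> U)"
proof (induction "c - s" arbitrary: s rule: less_induct)
  case less
  show ?case
  proof (cases "s = c")
    case True
    then show ?thesis using leadsto_refl by simp
  next
    case False
    let ?b = "budget k (h - 1)"
    obtain v where v: "v \<in> att s" "v \<in> pcomp c" using pcomp_climb[OF less.prems False] by blast
    have sv: "s < v" "v \<le> c" using att_less[OF v(1)] pcomp_le[OF v(2)] by auto
    have "piece (stage (Suc s)) s f"
      by (rule piece_mono[OF piece_sub[OF assms(3) less.prems] stage_antimono]) (use sv assms(4) in simp)
    then have "leadsto (\<lambda>U F. f s \<in> U) (budget k s) (found s f)"
      using assms(2)[of s] sv assms(4) unfolding discoverable_def by simp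
    then have "leadsto (\<lambda>U F. f s \<in> U) ?b (found s f)"
      by (rule leadsto_pad[OF _ monotone_found budget_mono]) (use sv assms(4) in simp)
    then have "leadsto (\<lambda>U F. f s \<in> U) ?b (\<lambda>U F. f v \<in> U)"
    proof (rule leadsto_weaken)
      fix U F assume *: "consistent U F" "found s f U F"
      then obtain g where g: "colored_hom col F s g" "\<forall>j\<in>att s. g j = f j" unfolding found_def by blast
      obtain t where "t \<in> pcomp s" "{t, v} \<in> P" using v(1) by (rule attE)
      then have "{g t, g v} \<in> F" using g(1) unfolding colored_hom_def by blast
      then have "{g t, f v} \<in> F" using g(2) v(1) by simp
      then show "f v \<in> U" using *(1) unfolding consistent_def by blast
    qed simp
    from leadsto_trans[OF this less.hyps[OF _ v(2)]]
    have "leadsto (\<lambda>U F. f s \<in> U) (?b + (c - v) * ?b) (\<lambda>U F. f c \<in> U)" using sv by simp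
    moreover have "?b + (c - v) * ?b \<le> (c - s) * ?b"
    proof -
      have "Suc (c - v) * ?b \<le> (c - s) * ?b" using sv by (intro mult_right_mono) auto
      then show ?thesis by simp
    qed
    ultimately show ?thesis by (rule leadsto_pad[OF _ monotone_known])
  qed
qed

text \<open>At most \<open>k\<close> climbing moves and one completion at the top explain the factor
  \<open>k + 1\<close>.\<close>

lemma leadsto_found:
  assumes "h \<le> k" "\<And>i. i < h \<Longrightarrow> discoverable i" "piece (stage h) c f" "c < h" "s \<in> pcomp c"
  shows "leadsto (\<lambda>U F. f s \<in> U) ((k + 1) * budget k (h - 1)) (found c f)"
proof -
  let ?b = "budget k (h - 1)"
  have "piece (stage (Suc c)) c f"
    by (rule piece_mono[OF assms(3) stage_antimono]) (use assms(4) in simp)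
  then have "leadsto (\<lambda>U F. f c \<in> U) (budget k c) (found c f)"
    using assms(2)[OF assms(4)] unfolding discoverable_def by simp
  from leadsto_trans[OF leadsto_climb[OF assms] this]
  have "leadsto (\<lambda>U F. f s \<in> U) ((c - s) * ?b + budget k c) (found c f)" .
  moreover have "(c - s) * ?b + budget k c \<le> k * ?b + ?b"
    using assms(1,4) budget_mono[of c "h - 1" k] by (intro add_mono mult_right_mono) auto
  ultimately have "leadsto (\<lambda>U F. f s \<in> U) (k * ?b + ?b) (found c f)"
    by (rule leadsto_pad[OF _ monotone_found])
  then show ?thesis by (simp add: algebra_simps)
qed

text \<open>The edge of the copy from \<open>f h\<close> into \<open>pcomp c\<close> survived the
  deletion for colour \<open>h\<close>, so its choice of hubs is not rare and one query hits with
  probability at least \<open>\<beta>\<close>. The component entered may differ from that of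
  \<open>f\<close> but has the same attachments.\<close>

lemma leadsto_child:
  assumes "h < k" "\<And>i. i < h \<Longrightarrow> discoverable i" "piece (stage (Suc h)) h f"
    "block h c" "c \<in> pcomp h"
  shows "leadsto (\<lambda>U F. f h \<in> U) (1 + (k + 1) * budget k (h - 1)) (found c f)"
proof -
  have c: "c < h" "h \<in> att c" using assms(4) block_pcomp[OF assms(4) pcomp_self assms(5)] unfolding block_def by auto
  let ?Y = "hits (stage h) h c f"
  have pc: "piece (stage h) c f"
    by (rule piece_mono[OF piece_sub[OF assms(3,5)] stage_antimono]) simp
  obtain s where s: "s \<in> pcomp c" "{s, h} \<in> P" "{h, s} \<in> P" using c(2) by (rule attE)
  have fs: "f s \<in> ?Y" using pc s unfolding hits_def by blast
  have "{f h, f s} \<in> stage (Suc h)" using pieceD(4)[OF assms(3) pcomp_self s(3)] .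
  then have "{f h, f s} \<notin> rare (stage h) h" by simp
  then have "\<not> real (card ?Y) < \<beta> * deg (f h)" using assms(4) c(2) fs unfolding rare_def by blast
  then have "leadsto (\<lambda>U F. f h \<in> U) 1 (\<lambda>U F. \<exists>y\<in>?Y. {f h, y} \<in> F)"
    using fs hits_neighbors[OF stage_edges c(2)] by (intro leadsto_query) auto
  then have 1: "leadsto (\<lambda>U F. f h \<in> U) 1
    (\<lambda>U F. \<exists>i. (piece (stage h) c (fst i) \<and> (\<forall>j\<in>att c. fst i j = f j) \<and> snd i \<in> pcomp c) \<and> fst i (snd i) \<in> U)"
  proof (rule leadsto_weaken)
    fix U F assume "consistent U F" "\<exists>y\<in>?Y. {f h, y} \<in> F"
    then obtain y where y: "y \<in> ?Y" "y \<in> U" unfolding consistent_def by blast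
    then obtain f' s' where "piece (stage h) c f'" "\<forall>j\<in>att c. f' j = f j" "s' \<in> pcomp c" "y = f' s'"
      unfolding hits_def by blast
    then show "\<exists>i. (piece (stage h) c (fst i) \<and> (\<forall>j\<in>att c. fst i j = f j) \<and> snd i \<in> pcomp c) \<and> fst i (snd i) \<in> U"
      using y(2) by (intro exI[of _ "(f', s')"]) simp
  qed simp
  have 2: "leadsto (\<lambda>U F. (piece (stage h) c (fst i) \<and> (\<forall>j\<in>att c. fst i j = f j) \<and> snd i \<in> pcomp c) \<and> fst i (snd i) \<in> U)
    ((k + 1) * budget k (h - 1)) (found c f)" for i
  proof (cases "piece (stage h) c (fst i) \<and> (\<forall>j\<in>att c. fst i j = f j) \<and> snd i \<in> pcomp c")
    case True
    have "leadsto (\<lambda>U F. fst i (snd i) \<in> U) ((k + 1) * budget k (h - 1)) (found c (fst i))"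
      using True assms(1,2) c(1) by (intro leadsto_found) auto
    then show ?thesis
    proof (rule leadsto_weaken)
      show "found c (fst i) U F \<Longrightarrow> found c f U F" for U F using True unfolding found_def by auto
    qed simp
  next
    case False
    from leadsto_False show ?thesis by (rule leadsto_weaken) (use False in auto)
  qed
  show ?thesis using leadsto_trans[OF 1 leadsto_ex[of _ _ "found c f", OF 2]] .
qed

text \<open>Here the exact vertex \<open>f j\<close> is required; \<open>stage 0\<close> ensures
  that \<open>f h\<close> has degree at most \<open>1 / \<beta>\<close>.\<close>

lemma leadsto_attachment:
  assumes "piece (stage (Suc h)) h f" "j \<in> att h" "{h, j} \<in> P"
  shows "leadsto (\<lambda>U F. f h \<in> U) 1 (\<lambda>U F. {f h, f j} \<in> F)"
proof -
  have "{f h, f j} \<in> stage (Suc h)" using pieceD(4)[OF assms(1) pcomp_self assms(3)] .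
  then have e: "{f h, f j} \<in> stage 0" using stage_antimono[of 0 "Suc h"] by auto
  moreover have "rank (f h) < rank (f j)"
    using pieceD(3)[OF assms(1), of h j] pcomp_self att_less[OF assms(2)] assms(2) by auto
  ultimately have "\<beta> * deg (f h) \<le> 1" by simp
  then have "leadsto (\<lambda>U F. f h \<in> U) 1 (\<lambda>U F. \<exists>y\<in>{f j}. {f h, y} \<in> F)"
    using e by (intro leadsto_query) (auto simp: neighbors_def)
  then show ?thesis by simp
qed

text \<open>\<open>C\<close> collects the components left when \<open>h\<close> is removed from
  \<open>pcomp h\<close>, which may be replaced; \<open>J\<close> collects the direct edges from
  \<open>h\<close> to attachments, which are found exactly. \<open>glue_blocks\<close> assembles the
  copy.\<close>

lemma discoverable_step:
  assumes "h < k" "\<And>i. i < h \<Longrightarrow> discoverable i"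
  shows "discoverable h"
  unfolding discoverable_def
proof (intro allI impI)
  fix f assume f: "piece (stage (Suc h)) h f"
  define C where "C = {c. block h c \<and> c \<in> pcomp h}"
  define J where "J = {j\<in>att h. {h, j} \<in> P}"
  let ?b = "1 + (k + 1) * budget k (h - 1)"
  have C: "C \<subseteq> {..<h}" unfolding C_def block_def by auto
  then have finC: "finite C" and cardC: "card C \<le> h"
    using finite_subset[OF C] card_mono[OF _ C] by auto
  have finJ: "finite J" and cardJ: "card J \<le> k"
    using finite_att card_mono[OF finite_att, of J h] card_att[of h] unfolding J_def by auto
  let ?X = "\<lambda>U F. (\<forall>c\<in>C. found c f U F) \<and> f h \<in> U"
  have 1: "leadsto (\<lambda>U F. f h \<in> U) (card C * ?b) ?X"
  proof (rule leadsto_ball[OF finC])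
    fix c assume "c \<in> C"
    then show "leadsto (\<lambda>U F. f h \<in> U) ?b (found c f)"
      using leadsto_child[OF assms f] unfolding C_def by blast
  qed (auto intro: monotone_known monotone_found)
  have monX: "monotone_prop ?X"
  proof (rule monotone_propI)
    fix U F U' F' assume *: "?X U F" "U \<subseteq> U'" "F \<subseteq> F'"
    have "found c f U' F'" if "c \<in> C" for c
      by (rule monotone_propD[OF monotone_found _ *(2,3)]) (use *(1) that in simp)
    then show "?X U' F'" using * by auto
  qed
  have "leadsto (\<lambda>U F. f h \<in> U) (card J * 1) (\<lambda>U F. (\<forall>j\<in>J. {f h, f j} \<in> F) \<and> f h \<in> U)"
    using leadsto_attachment[OF f] monotone_known monotone_edge unfolding J_def[symmetric]
    by (intro leadsto_ball[OF finJ]) (auto simp: J_def)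
  from leadsto_frame[OF this monX]
  have 2: "leadsto ?X (card J * 1) (\<lambda>U F. ((\<forall>j\<in>J. {f h, f j} \<in> F) \<and> f h \<in> U) \<and> ?X U F)"
    by (rule leadsto_weaken) auto
  have "leadsto (\<lambda>U F. f h \<in> U) (card C * ?b + card J * 1) (found h f)"
    using leadsto_trans[OF 1 2]
  proof (rule leadsto_weaken)
    fix U F assume "((\<forall>j\<in>J. {f h, f j} \<in> F) \<and> f h \<in> U) \<and> ?X U F"
    then have J: "\<And>j. j \<in> J \<Longrightarrow> {f h, f j} \<in> F" and "\<forall>c\<in>C. found c f U F" by auto
    then obtain g where g: "\<And>c. c \<in> C \<Longrightarrow> colored_hom col F c (g c) \<and> (\<forall>j\<in>att c. g c j = f j)"
      unfolding found_def by metis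
    have blk: "block h c" if "c \<in> C" for c using that unfolding C_def by simp
    obtain g' where g0: "(\<forall>i. (\<forall>c\<in>C. i \<notin> pcomp c) \<longrightarrow> g' i = f i) \<and>
      (\<forall>c\<in>C. \<forall>i\<in>pcomp c. col (g' i) = i \<and> (\<forall>j. {i, j} \<in> P \<longrightarrow> {g' i, g' j} \<in> F))"
      using glue_blocks[OF blk g] by (rule exE)
    have g': "\<And>i. \<forall>c\<in>C. i \<notin> pcomp c \<Longrightarrow> g' i = f i"
        "\<And>c i. c \<in> C \<Longrightarrow> i \<in> pcomp c \<Longrightarrow> col (g' i) = i"
        "\<And>c i j. c \<in> C \<Longrightarrow> i \<in> pcomp c \<Longrightarrow> {i, j} \<in> P \<Longrightarrow> {g' i, g' j} \<in> F"
      using g0 by simp_all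
    have hi: "g' i = f i" if "h \<le> i" for i
      using that pcomp_le C by (intro g'(1)) fastforce
    have lo: "\<exists>c\<in>C. i \<in> pcomp c" if i: "i \<in> pcomp h" "i \<noteq> h" for i
    proof -
      have "i < h" using pcomp_le[OF i(1)] i(2) by simp
      then obtain c where c: "block h c" "i \<in> pcomp c" using block_exists by blast
      then show ?thesis using block_pcomp[OF c i(1)] unfolding C_def by blast
    qed
    have "colored_hom col F h g'"
      unfolding colored_hom_def
    proof (intro conjI ballI allI impI)
      fix i assume i: "i \<in> pcomp h \<union> att h"
      show "col (g' i) = i"
      proof (cases "h \<le> i")
        case True
        then show ?thesis using hi pieceD(1)[OF f i] by simp
      next
        case False
        then have "i \<in> pcomp h" using i att_less[of i h] by auto
        then show ?thesis using lo False g'(2) by blast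
      qed
    next
      fix i j assume ij: "i \<in> pcomp h" "{i, j} \<in> P"
      show "{g' i, g' j} \<in> F"
      proof (cases "i = h")
        case False
        then show ?thesis using lo[OF ij(1)] g'(3) ij(2) by blast
      next
        case i: True
        show ?thesis
        proof (cases "j \<in> pcomp h")
          case True
          moreover have "j \<noteq> h" using P_neq[OF ij(2)] i by simp
          moreover have "{j, i} \<in> P" using ij(2) by (simp add: insert_commute)
          ultimately have "{g' j, g' i} \<in> F" using lo[of j] g'(3) by blast
          then show ?thesis by (simp add: insert_commute)
        next
          case False
          then have "j \<in> att h" using pcomp_edge_cases[OF ij] by simp
          then have "j \<in> J" "h \<le> j" using ij(2) i att_less[of j h] unfolding J_def by auto
          then show ?thesis using J hi i by simp
        qed
      qed
    qed
    moreover have "\<forall>j\<in>att h. g' j = f j" using hi att_less less_imp_le by blast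
    ultimately show "found h f U F" unfolding found_def by blast
  qed simp
  \<comment> \<open>For \<open>h = 0\<close> the set \<open>C\<close> is empty, so the truncated
    \<open>h - 1\<close> in \<open>?b\<close> does no harm.\<close>
  moreover have "card C * ?b + card J * 1 \<le> budget k h"
  proof (cases h)
    case 0
    then show ?thesis using cardC cardJ by simp
  next
    case (Suc m)
    have "card C * ?b + card J * 1 \<le> k * ?b + k"
      using cardC cardJ assms(1) by (intro add_mono mult_right_mono) auto
    then show ?thesis using Suc by simp
  qed
  ultimately show "leadsto (\<lambda>U F. f h \<in> U) (budget k h) (found h f)"
    by (rule leadsto_pad[OF _ monotone_found])
qed

lemma discoverable: "h < k \<Longrightarrow> discoverable h"
  by (induction h rule: less_induct) (auto intro: discoverable_step)

text \<open>Without attachments there is nothing to agree on, so the component completed from any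
  hit serves every \<open>f\<close>.\<close>

lemma leadsto_root:
  assumes "c < k" "att c = {}" "\<beta> * n \<le> card (root_hits c)"
  shows "leadsto (\<lambda>U F. True) (1 + (k + 1) * budget k (k - 1)) (found c f)"
proof -
  have 1: "leadsto (\<lambda>U F. True) 1
    (\<lambda>U F. \<exists>i. (piece (stage k) c (fst i) \<and> snd i \<in> pcomp c) \<and> fst i (snd i) \<in> U)"
    using leadsto_fresh[OF root_hits_sub assms(3)]
  proof (rule leadsto_weaken)
    fix U F assume "\<exists>y\<in>root_hits c. y \<in> U"
    then obtain f' s' where "piece (stage k) c f'" "s' \<in> pcomp c" "f' s' \<in> U"
      unfolding root_hits_def by blast
    then show "\<exists>i. (piece (stage k) c (fst i) \<and> snd i \<in> pcomp c) \<and> fst i (snd i) \<in> U"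
      by (intro exI[of _ "(f', s')"]) simp
  qed simp
  have 2: "leadsto (\<lambda>U F. (piece (stage k) c (fst i) \<and> snd i \<in> pcomp c) \<and> fst i (snd i) \<in> U)
    ((k + 1) * budget k (k - 1)) (found c f)" for i
  proof (cases "piece (stage k) c (fst i) \<and> snd i \<in> pcomp c")
    case True
    have "leadsto (\<lambda>U F. fst i (snd i) \<in> U) ((k + 1) * budget k (k - 1)) (found c (fst i))"
      using True assms(1) discoverable by (intro leadsto_found) auto
    then show ?thesis
    proof (rule leadsto_weaken)
      show "found c (fst i) U F \<Longrightarrow> found c f U F" for U F using assms(2) unfolding found_def by auto
    qed simp
  next
    case False
    from leadsto_False show ?thesis by (rule leadsto_weaken) (use False in auto)
  qed
  show ?thesis using leadsto_trans[OF 1 leadsto_ex[of _ _ "found c f", OF 2]] .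
qed

text \<open>Otherwise the copy would contain a deleted edge: the top \<open>c\<close> has a
  neighbour \<open>j\<close> in its component, necessarily below it, and \<open>{f j, f c}\<close>
  is an upward edge at a hit.\<close>

lemma root_hits_large:
  assumes f: "\<And>i. i \<in> \<Union>P \<Longrightarrow> col (f i) = i \<and> f i \<in> {1..n}"
    "\<And>i j. i \<in> \<Union>P \<Longrightarrow> j \<in> \<Union>P \<Longrightarrow> i < j \<Longrightarrow> rank (f i) < rank (f j)"
    "\<And>i j. {i, j} \<in> P \<Longrightarrow> {f i, f j} \<in> final"
    and c: "c \<in> \<Union>P" "att c = {}" "c < k"
  shows "\<beta> * n \<le> card (root_hits c)"
proof (rule ccontr)
  assume small: "\<not> ?thesis"
  obtain j where j: "{c, j} \<in> P" "{j, c} \<in> P"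
  proof -
    obtain e where e: "e \<in> P" "c \<in> e" using c(1) by blast
    then obtain a b where "e = {a, b}" using P[OF e(1)] by (meson card_2_iff)
    then show ?thesis using e that[of a] that[of b] by (auto simp: insert_commute)
  qed
  have jc: "j \<in> pcomp c" using pcomp_edge_cases[OF pcomp_self j(1)] c(2) by simp
  then have "j < c" using pcomp_le[OF jc] P_neq[OF j(1)] by simp
  have sub: "pcomp c \<subseteq> \<Union>P"
  proof
    fix s assume "s \<in> pcomp c"
    then have "(c, s) \<in> (adj_rel P {..c})\<^sup>*" unfolding pcomp_def by simp
    then show "s \<in> \<Union>P"
      by (induction rule: rtrancl_induct) (use c(1) in \<open>auto simp: adj_rel_def\<close>)
  qed
  have "piece (stage k) c f"
    unfolding piece_def c(2) Un_empty_right
  proof (intro conjI ballI allI impI)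
    fix i assume "i \<in> pcomp c"
    then have i: "i \<in> \<Union>P" using sub by blast
    show "col (f i) = i" "f i \<in> {1..n}" using f(1)[OF i] by simp_all
    show "rank (f i) < rank (f j)" if "j \<in> pcomp c" "i < j" for j
      using f(2)[OF i _ that(2)] that(1) sub by blast
    show "{f i, f j} \<in> stage k" if "{i, j} \<in> P" for j
      using f(3)[OF that] final_stage[of k] by auto
  qed
  then have "f j \<in> root_hits c" using jc unfolding root_hits_def by blast
  moreover have "rank (f j) < rank (f c)" using f(2)[OF _ c(1) \<open>j < c\<close>] sub jc by blast
  ultimately have "{f j, f c} \<notin> final"
    using c(2,3) small unfolding final_def by (auto simp: not_le)
  then show False using f(3)[OF j(2)] by simp
qed

text \<open>\<open>k\<close> acts as a virtual vertex above the pattern, so its blocks are the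
  components of the whole pattern; membership in \<open>\<Union>P\<close> leaves out numbers below
  \<open>k\<close> that are not pattern vertices.\<close>

lemma leadsto_pattern:
  assumes f: "\<And>i. i \<in> \<Union>P \<Longrightarrow> col (f i) = i \<and> f i \<in> {1..n}"
    "\<And>i j. i \<in> \<Union>P \<Longrightarrow> j \<in> \<Union>P \<Longrightarrow> i < j \<Longrightarrow> rank (f i) < rank (f j)"
    "\<And>i j. {i, j} \<in> P \<Longrightarrow> {f i, f j} \<in> final"
  shows "leadsto (\<lambda>U F. True) (budget k k)
    (\<lambda>U F. \<exists>g. (\<forall>i\<in>\<Union>P. col (g i) = i) \<and> (\<forall>i j. {i, j} \<in> P \<longrightarrow> {g i, g j} \<in> F))"
proof -
  define C where "C = {c. block k c \<and> c \<in> \<Union>P}"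
  have C: "C \<subseteq> {..<k}" unfolding C_def block_def by auto
  then have finC: "finite C" and cardC: "card C \<le> k"
    using finite_subset[OF C] card_mono[OF _ C] by auto
  have att: "att c = {}" if "c \<in> C" for c
    using that att_less unfolding C_def block_def by fastforce
  let ?b = "1 + (k + 1) * budget k (k - 1)"
  have "leadsto (\<lambda>U F. True) (card C * ?b) (\<lambda>U F. (\<forall>c\<in>C. found c f U F) \<and> True)"
  proof (rule leadsto_ball[OF finC])
    fix c assume c: "c \<in> C"
    have "\<beta> * n \<le> card (root_hits c)"
      by (rule root_hits_large[OF f _ att[OF c]]) (use c C in \<open>auto simp: C_def\<close>)
    then show "leadsto (\<lambda>U F. True) ?b (found c f)" using leadsto_root att[OF c] c C by blast
  qed (auto intro: monotone_found monotone_propI)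
  then have "leadsto (\<lambda>U F. True) (card C * ?b)
    (\<lambda>U F. \<exists>g. (\<forall>i\<in>\<Union>P. col (g i) = i) \<and> (\<forall>i j. {i, j} \<in> P \<longrightarrow> {g i, g j} \<in> F))"
  proof (rule leadsto_weaken)
    fix U F assume "(\<forall>c\<in>C. found c f U F) \<and> True"
    then obtain g where g: "\<And>c. c \<in> C \<Longrightarrow> colored_hom col F c (g c) \<and> (\<forall>j\<in>att c. g c j = f j)"
      unfolding found_def by metis
    have blk: "block k c" if "c \<in> C" for c using that unfolding C_def by simp
    obtain g' where g0: "(\<forall>i. (\<forall>c\<in>C. i \<notin> pcomp c) \<longrightarrow> g' i = f i) \<and>
      (\<forall>c\<in>C. \<forall>i\<in>pcomp c. col (g' i) = i \<and> (\<forall>j. {i, j} \<in> P \<longrightarrow> {g' i, g' j} \<in> F))"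
      using glue_blocks[OF blk g] by (rule exE)
    have g': "\<And>c i. c \<in> C \<Longrightarrow> i \<in> pcomp c \<Longrightarrow> col (g' i) = i"
        "\<And>c i j. c \<in> C \<Longrightarrow> i \<in> pcomp c \<Longrightarrow> {i, j} \<in> P \<Longrightarrow> {g' i, g' j} \<in> F"
      using g0 by simp_all
    have cover: "\<exists>c\<in>C. i \<in> pcomp c" if i: "i \<in> \<Union>P" for i
    proof -
      have "i < k" using i P by blast
      then obtain c where c: "block k c" "i \<in> pcomp c" using block_exists by blast
      have "(c, i) \<in> (adj_rel P {..c})\<^sup>*" using c(2) unfolding pcomp_def by simp
      then have "c \<in> \<Union>P"
        by (rule converse_rtranclE) (use i in \<open>auto simp: adj_rel_def\<close>)
      then show ?thesis using c unfolding C_def by blast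
    qed
    have "{g' i, g' j} \<in> F" if "{i, j} \<in> P" for i j
      using cover[of i] that g'(2) by blast
    then show "\<exists>g. (\<forall>i\<in>\<Union>P. col (g i) = i) \<and> (\<forall>i j. {i, j} \<in> P \<longrightarrow> {g i, g j} \<in> F)"
      using cover g'(1) by (intro exI[of _ g']) blast
  qed simp
  moreover have "monotone_prop (\<lambda>U F. \<exists>g. (\<forall>i\<in>\<Union>P. col (g i) = i) \<and> (\<forall>i j. {i, j} \<in> P \<longrightarrow> {g i, g j} \<in> F))"
    by (rule monotone_propI) (meson subsetD)
  moreover have "card C * ?b \<le> budget k k"
  proof (cases k)
    case (Suc m)
    have "card C * ?b \<le> k * ?b" using cardC by (intro mult_right_mono) auto
    then show ?thesis using Suc by simp
  qed (use cardC in simp)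
  ultimately show ?thesis by (rule leadsto_pad)
qed

end

section \<open>Edge-disjoint copies with a common pattern\<close>

text \<open>Double counting of the pairs related by \<open>R\<close>.\<close>

lemma averaging:
  fixes \<delta> :: real
  assumes "finite \<Omega>" "\<Omega> \<noteq> {}" "finite \<P>"
    "\<And>Y. Y \<in> \<P> \<Longrightarrow> \<delta> * card \<Omega> \<le> card {\<omega>\<in>\<Omega>. R Y \<omega>}"
  shows "\<exists>\<omega>\<in>\<Omega>. \<delta> * card \<P> \<le> card {Y\<in>\<P>. R Y \<omega>}"
proof (rule ccontr)
  assume "\<not> ?thesis"
  then have "(\<Sum>\<omega>\<in>\<Omega>. real (card {Y\<in>\<P>. R Y \<omega>})) < (\<Sum>\<omega>\<in>\<Omega>. \<delta> * card \<P>)"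
    using assms(1,2) by (intro sum_strict_mono) (auto simp: not_le)
  moreover have "(\<Sum>\<omega>\<in>\<Omega>. real (card {Y\<in>\<P>. R Y \<omega>})) = (\<Sum>Y\<in>\<P>. real (card {\<omega>\<in>\<Omega>. R Y \<omega>}))"
  proof -
    have "(\<Sum>\<omega>\<in>\<Omega>. real (card {Y\<in>\<P>. R Y \<omega>})) = (\<Sum>\<omega>\<in>\<Omega>. \<Sum>Y\<in>\<P>. if R Y \<omega> then 1 else 0)"
      using assms(3) by (simp add: sum.If_cases Int_def)
    also have "\<dots> = (\<Sum>Y\<in>\<P>. \<Sum>\<omega>\<in>\<Omega>. if R Y \<omega> then 1 else 0)" by (rule sum.swap)
    also have "\<dots> = (\<Sum>Y\<in>\<P>. real (card {\<omega>\<in>\<Omega>. R Y \<omega>}))"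
      using assms(1) by (simp add: sum.If_cases Int_def)
    finally show ?thesis .
  qed
  moreover have "(\<Sum>Y\<in>\<P>. \<delta> * card \<Omega>) \<le> (\<Sum>Y\<in>\<P>. real (card {\<omega>\<in>\<Omega>. R Y \<omega>}))"
    using assms(4) by (rule sum_mono)
  ultimately show False by (simp add: algebra_simps)
qed

lemma maximal_disjoint_subfamily:
  assumes "finite X" "{} \<notin> X"
  obtains \<P> where "\<P> \<subseteq> X" "\<And>Y Y'. Y \<in> \<P> \<Longrightarrow> Y' \<in> \<P> \<Longrightarrow> Y \<noteq> Y' \<Longrightarrow> Y \<inter> Y' = {}"
    "\<And>Y. Y \<in> X \<Longrightarrow> Y \<inter> \<Union>\<P> \<noteq> {}"
proof -
  define D where "D \<P> \<longleftrightarrow> \<P> \<subseteq> X \<and> (\<forall>Y\<in>\<P>. \<forall>Y'\<in>\<P>. Y \<noteq> Y' \<longrightarrow> Y \<inter> Y' = {})" for \<P>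
  have "D {}" unfolding D_def by simp
  moreover have "\<forall>\<P>. D \<P> \<longrightarrow> card \<P> < Suc (card X)"
    using card_mono[OF assms(1)] unfolding D_def by (simp add: less_Suc_eq_le)
  ultimately have "\<exists>\<P>. D \<P> \<and> (\<forall>\<Q>. D \<Q> \<longrightarrow> card \<Q> \<le> card \<P>)"
    by (rule Lattices_Big.ex_has_greatest_nat)
  then obtain \<P> where D: "D \<P>" and max: "\<And>\<Q>. D \<Q> \<Longrightarrow> card \<Q> \<le> card \<P>" by auto
  have D1: "\<P> \<subseteq> X" and D2: "\<And>Y Y'. Y \<in> \<P> \<Longrightarrow> Y' \<in> \<P> \<Longrightarrow> Y \<noteq> Y' \<Longrightarrow> Y \<inter> Y' = {}"
    using D unfolding D_def by simp_all
  have "Y \<inter> \<Union>\<P> \<noteq> {}" if Y: "Y \<in> X" for Y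
  proof
    assume emp: "Y \<inter> \<Union>\<P> = {}"
    have "Y \<noteq> {}" using Y assms(2) by auto
    then have "Y \<notin> \<P>" using emp by blast
    have "D (insert Y \<P>)"
      unfolding D_def
    proof (intro conjI ballI impI)
      show "insert Y \<P> \<subseteq> X" using D1 Y by simp
      fix A B assume "A \<in> insert Y \<P>" "B \<in> insert Y \<P>" "A \<noteq> B"
      then show "A \<inter> B = {}" using D2[of A B] emp by auto
    qed
    then have "card (insert Y \<P>) \<le> card \<P>" by (rule max)
    moreover have "finite \<P>" using D1 assms(1) by (rule finite_subset)
    ultimately show False using \<open>Y \<notin> \<P>\<close> by simp
  qed
  then show ?thesis using that[OF D1 D2] by simp
qed

section \<open>Normalised patterns and colourings\<close>

definition pos :: "('a \<Rightarrow> nat) \<Rightarrow> 'a set \<Rightarrow> 'a \<Rightarrow> nat" where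
  "pos rk W y = card {z\<in>W. rk z < rk y}"

lemma pos_less_card: "finite W \<Longrightarrow> y \<in> W \<Longrightarrow> pos rk W y < card W"
  unfolding pos_def by (intro psubset_card_mono) auto

lemma pos_strict_mono:
  assumes "finite W" "x \<in> W" "rk x < rk y"
  shows "pos rk W x < pos rk W y"
  unfolding pos_def using assms by (intro psubset_card_mono) auto

lemma pos_inj:
  assumes "finite W" "inj_on rk W"
  shows "inj_on (pos rk W) W"
proof (rule inj_onI)
  fix x y assume "x \<in> W" "y \<in> W" "pos rk W x = pos rk W y"
  then have "rk x = rk y"
    using pos_strict_mono[OF assms(1), of x rk y] pos_strict_mono[OF assms(1), of y rk x]
    by (metis less_irrefl linorder_neqE_nat)
  then show "x = y" using assms(2) \<open>x \<in> W\<close> \<open>y \<in> W\<close> by (auto dest: inj_onD)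
qed

text \<open>Renaming vertices by their position in the order makes copies comparable. Isolated
  vertices of a copy do not enter; \<open>transfer_copy\<close> restores them.\<close>

definition pattern_of :: "('a \<Rightarrow> nat) \<Rightarrow> 'a set set \<Rightarrow> nat set set" where
  "pattern_of rk Y = (\<lambda>e. pos rk (\<Union>Y) ` e) ` Y"

definition fits :: "('a \<Rightarrow> nat) \<Rightarrow> 'a set set \<Rightarrow> nat set set \<times> ('a \<Rightarrow> nat) \<Rightarrow> bool" where
  "fits rk Y = (\<lambda>(P, col). pattern_of rk Y = P \<and> (\<forall>y\<in>\<Union>Y. col y = pos rk (\<Union>Y) y))"

text \<open>A uniformly random pair of pattern and colouring fits a given copy with probability at
  least \<open>1 / (2 ^ 2 ^ k * k ^ k)\<close>: there are \<open>2 ^ 2 ^ k\<close> sets of subsets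
  of \<open>{..<k}\<close>, and at most \<open>k\<close> vertices need a prescribed colour.\<close>

lemma common_pattern:
  fixes V :: "'a set"
  assumes V: "finite V" and k: "0 < k" and "finite \<P>"
    and W: "\<And>Y. Y \<in> \<P> \<Longrightarrow> \<Union>Y \<subseteq> V \<and> card (\<Union>Y) \<le> k"
  shows "\<exists>P col. real (card \<P>) / (2 ^ 2 ^ k * k ^ k) \<le> card {Y\<in>\<P>. fits rk Y (P, col)}"
proof -
  let ?C = "PiE V (\<lambda>_. {..<k})"
  let ?\<Omega> = "Pow (Pow {..<k}) \<times> ?C"
  have C: "finite ?C" "card ?C = k ^ card V" using V by (auto intro: finite_PiE simp: card_PiE)
  have fin: "finite ?\<Omega>" using C by simp
  have card: "card ?\<Omega> = 2 ^ 2 ^ k * k ^ card V" using C by (simp add: card_cartesian_product card_Pow)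
  have ne: "?\<Omega> \<noteq> {}"
  proof -
    have "card ?\<Omega> \<noteq> 0" using card k by simp
    then show ?thesis by (metis card.empty)
  qed
  have many: "1 / (2 ^ 2 ^ k * k ^ k) * real (card ?\<Omega>) \<le> card {\<omega>\<in>?\<Omega>. fits rk Y \<omega>}" if Y: "Y \<in> \<P>" for Y
  proof -
    let ?W = "\<Union>Y"
    have Wf: "finite ?W" "?W \<subseteq> V" "card ?W \<le> k" using W[OF Y] V by (auto intro: finite_subset)
    let ?F = "PiE V (\<lambda>v. if v \<in> ?W then {pos rk ?W v} else {..<k})"
    have lt: "pos rk ?W v < k" if "v \<in> ?W" for v using pos_less_card[OF Wf(1) that, of rk] Wf(3) by simp
    have "{pattern_of rk Y} \<times> ?F \<subseteq> {\<omega>\<in>?\<Omega>. fits rk Y \<omega>}"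
    proof (intro subsetI CollectI conjI)
      fix \<omega> assume \<omega>: "\<omega> \<in> {pattern_of rk Y} \<times> ?F"
      then obtain col where col: "\<omega> = (pattern_of rk Y, col)" "col \<in> ?F" by auto
      have "pattern_of rk Y \<in> Pow (Pow {..<k})" using lt unfolding pattern_of_def by auto
      moreover have "col \<in> ?C"
      proof (rule PiE_I)
        fix v assume "v \<in> V"
        then show "col v \<in> {..<k}" using PiE_mem[OF col(2), of v] lt[of v] by (auto split: if_splits)
      next
        fix v assume "v \<notin> V"
        then show "col v = undefined" using PiE_arb[OF col(2)] by blast
      qed
      ultimately show "\<omega> \<in> ?\<Omega>" using col(1) by simp
      have "col y = pos rk ?W y" if "y \<in> ?W" for y
        using PiE_mem[OF col(2), of y] Wf(2) that by (auto split: if_splits)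
      then show "fits rk Y \<omega>" unfolding fits_def col(1) prod.case by blast
    qed
    then have le: "card ({pattern_of rk Y} \<times> ?F) \<le> card {\<omega>\<in>?\<Omega>. fits rk Y \<omega>}"
      using fin by (intro card_mono finite_subset[OF _ fin]) auto
    have eq: "card ({pattern_of rk Y} \<times> ?F) = k ^ card (V - ?W)"
    proof -
      have "card ?F = (\<Prod>v\<in>V. if v \<in> ?W then 1 else k)"
        using V by (subst card_PiE) (auto intro: prod.cong)
      also have "\<dots> = (\<Prod>v\<in>V - ?W. k)" using V by (intro prod.mono_neutral_cong_right) auto
      finally show ?thesis by (simp add: card_cartesian_product)
    qed
    have "k ^ card V \<le> k ^ card (V - ?W) * k ^ k"
    proof -
      have "card V \<le> card (V - ?W) + k"
        using card_Diff_subset[OF Wf(1,2)] Wf(3) by simp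
      then have "k ^ card V \<le> k ^ (card (V - ?W) + k)" using k by (intro power_increasing) auto
      then show ?thesis by (simp add: power_add)
    qed
    also have "\<dots> \<le> card {\<omega>\<in>?\<Omega>. fits rk Y \<omega>} * k ^ k"
      using le unfolding eq by (rule mult_le_mono1)
    finally have "k ^ card V \<le> card {\<omega>\<in>?\<Omega>. fits rk Y \<omega>} * k ^ k" .
    then have "real (k ^ card V) \<le> real (card {\<omega>\<in>?\<Omega>. fits rk Y \<omega>}) * real (k ^ k)"
      by (simp only: of_nat_mult[symmetric] of_nat_le_iff)
    moreover have "1 / (2 ^ 2 ^ k * k ^ k) * real (card ?\<Omega>) = real (k ^ card V) / real (k ^ k)"
      unfolding card by simp
    moreover have "0 < real (k ^ k)" using k by simp
    ultimately show ?thesis by (simp only: pos_divide_le_eq)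
  qed
  have "\<exists>\<omega>\<in>?\<Omega>. 1 / (2 ^ 2 ^ k * k ^ k) * real (card \<P>) \<le> card {Y\<in>\<P>. fits rk Y \<omega>}"
    by (rule averaging[OF fin ne assms(3)]) (rule many)
  then obtain \<omega> where "1 / (2 ^ 2 ^ k * k ^ k) * real (card \<P>) \<le> card {Y\<in>\<P>. fits rk Y \<omega>}" by auto
  then show ?thesis by (intro exI[of _ "fst \<omega>"] exI[of _ "snd \<omega>"]) simp
qed

section \<open>Copies with isolated vertices, and edge-disjoint copies\<close>

lemma extend_injection:
  assumes "finite V" "W \<subseteq> V" "inj_on \<phi> W" "\<phi> ` W \<subseteq> V"
  obtains \<pi> where "bij_betw \<pi> V V" "\<And>w. w \<in> W \<Longrightarrow> \<pi> w = \<phi> w"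
proof -
  have "finite W" using assms(1,2) finite_subset by blast
  then have "card (V - W) = card (V - \<phi> ` W)"
    using assms card_image[OF assms(3)] by (simp add: card_Diff_subset)
  then obtain h where h: "bij_betw h (V - W) (V - \<phi> ` W)"
    using finite_same_card_bij[of "V - W" "V - \<phi> ` W"] assms(1) by auto
  let ?\<pi> = "\<lambda>w. if w \<in> W then \<phi> w else h w"
  have "bij_betw ?\<pi> W (\<phi> ` W)"
  proof -
    have "bij_betw \<phi> W (\<phi> ` W)" using assms(3) by (simp add: bij_betw_def)
    then show ?thesis by (subst bij_betw_cong[of W _ \<phi>]) auto
  qed
  moreover have "bij_betw ?\<pi> (V - W) (V - \<phi> ` W)"
    using h by (subst bij_betw_cong[of "V - W" _ h]) auto
  ultimately have "bij_betw ?\<pi> (W \<union> (V - W)) (\<phi> ` W \<union> (V - \<phi> ` W))"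
    by (rule bij_betw_combine) auto
  moreover have "W \<union> (V - W) = V" "\<phi> ` W \<union> (V - \<phi> ` W) = V" using assms by auto
  ultimately show ?thesis using that[of ?\<pi>] by simp
qed

text \<open>\<open>\<phi>\<close> is given only on vertices that lie on edges. Its extension to a
  permutation of \<open>V\<close> places the isolated vertices injectively as well, so they need not
  be discovered.\<close>

lemma transfer_copy:
  fixes S :: "'a sgraph" and H :: "'b sgraph"
  assumes S: "simple_graph S" "verts S \<subseteq> V" "isomorphic S H" and V: "finite V"
    and \<phi>: "inj_on \<phi> (\<Union>(edges S))" "\<phi> ` \<Union>(edges S) \<subseteq> V" "\<And>e. e \<in> edges S \<Longrightarrow> \<phi> ` e \<in> F"
  shows "\<exists>S'. subgraph S' (SGraph V F) \<and> isomorphic S' H"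
proof -
  have sub: "\<Union>(edges S) \<subseteq> V" "\<And>e. e \<in> edges S \<Longrightarrow> e \<subseteq> verts S \<and> card e = 2" "finite (verts S)"
    using S unfolding simple_graph_def by auto
  obtain \<pi> where \<pi>: "bij_betw \<pi> V V" "\<And>w. w \<in> \<Union>(edges S) \<Longrightarrow> \<pi> w = \<phi> w"
    using extend_injection[OF V sub(1) \<phi>(1,2)] by blast
  let ?S = "SGraph (\<pi> ` verts S) ((\<lambda>e. \<pi> ` e) ` edges S)"
  have inj: "inj_on \<pi> (verts S)" using \<pi>(1) S(2) unfolding bij_betw_def by (meson inj_on_subset)
  have "card (\<pi> ` e) = 2" if "e \<in> edges S" for e
    using sub(2)[OF that] inj card_image[of \<pi> e] inj_on_subset by metis
  then have "simple_graph ?S" using sub(2,3) unfolding simple_graph_def by auto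
  moreover have "\<pi> ` e \<in> F" if e: "e \<in> edges S" for e
  proof -
    have "\<pi> ` e = \<phi> ` e" using \<pi>(2) e by (intro image_cong) auto
    then show ?thesis using \<phi>(3)[OF e] by simp
  qed
  moreover have "\<pi> ` verts S \<subseteq> V" using \<pi>(1) S(2) unfolding bij_betw_def by auto
  ultimately have "subgraph ?S (SGraph V F)" unfolding subgraph_def by auto
  moreover have "isomorphic ?S H"
  proof -
    obtain f where f: "bij_betw f (verts S) (verts H)" "(\<lambda>e. f ` e) ` edges S = edges H"
      using S(3) unfolding isomorphic_def by blast
    let ?i = "inv_into (verts S) \<pi>"
    have "bij_betw \<pi> (verts S) (\<pi> ` verts S)" using inj by (simp add: bij_betw_def)
    then have bij: "bij_betw (f \<circ> ?i) (\<pi> ` verts S) (verts H)"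
      using f(1) by (intro bij_betw_trans[OF bij_betw_inv_into])
    have cancel: "(f \<circ> ?i) ` \<pi> ` e = f ` e" if "e \<in> edges S" for e
      using inv_into_image_cancel[OF inj, of e] sub(2)[OF that] by (simp only: image_comp[symmetric])
    then have "(\<lambda>e. (f \<circ> ?i) ` e) ` (\<lambda>e. \<pi> ` e) ` edges S = edges H"
      unfolding f(2)[symmetric] image_comp[of "\<lambda>e. (f \<circ> ?i) ` e"]
      by (intro image_cong refl) (simp only: comp_apply cancel)
    then show ?thesis using bij unfolding isomorphic_def sgraph.sel by blast
  qed
  ultimately show ?thesis by blast
qed

lemma isomorphic_card: "isomorphic S H \<Longrightarrow> card (verts S) = card (verts H)"
  unfolding isomorphic_def using bij_betw_same_card by blast

text \<open>Deleting all edges of a maximal edge-disjoint family of copies leaves an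
  \<open>\<H>\<close>-free graph, so the family covers more than
  \<open>\<epsilon> * card (verts G)\<close> edges, while one copy has at most
  \<open>2 ^ k\<close>.\<close>

lemma edge_disjoint_copies:
  fixes G :: "'a sgraph" and \<H> :: "'b sgraph set"
  assumes G: "simple_graph G" and far: "far_from_family_free \<epsilon> \<H> G"
    and k: "\<And>H. H \<in> \<H> \<Longrightarrow> card (verts H) \<le> k"
    and ne: "\<And>S H. subgraph S G \<Longrightarrow> H \<in> \<H> \<Longrightarrow> isomorphic S H \<Longrightarrow> edges S \<noteq> {}"
  obtains \<P> where "finite \<P>" "\<epsilon> * card (verts G) < 2 ^ k * card \<P>"
    "\<And>Y Y'. Y \<in> \<P> \<Longrightarrow> Y' \<in> \<P> \<Longrightarrow> Y \<noteq> Y' \<Longrightarrow> Y \<inter> Y' = {}"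
    "\<And>Y. Y \<in> \<P> \<Longrightarrow> \<exists>S H. subgraph S G \<and> H \<in> \<H> \<and> isomorphic S H \<and> edges S = Y \<and> card (verts S) \<le> k"
proof -
  define X where "X = {edges S |S. subgraph S G \<and> (\<exists>H\<in>\<H>. isomorphic S H)}"
  have "X \<subseteq> Pow (edges G)" unfolding X_def subgraph_def by auto
  then have finX: "finite X" using simple_graph_finite_edges[OF G] by (simp add: finite_subset)
  have neX: "{} \<notin> X" using ne unfolding X_def by force
  obtain \<P> where \<P>: "\<P> \<subseteq> X" "\<And>Y Y'. Y \<in> \<P> \<Longrightarrow> Y' \<in> \<P> \<Longrightarrow> Y \<noteq> Y' \<Longrightarrow> Y \<inter> Y' = {}"
    "\<And>Y. Y \<in> X \<Longrightarrow> Y \<inter> \<Union>\<P> \<noteq> {}"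
    by (rule maximal_disjoint_subfamily[OF finX neX]) (rule that)
  have fin: "finite \<P>" using \<P>(1) finX by (rule finite_subset)
  have copy: "\<exists>S H. subgraph S G \<and> H \<in> \<H> \<and> isomorphic S H \<and> edges S = Y \<and> card (verts S) \<le> k" if "Y \<in> \<P>" for Y
  proof -
    obtain S H where "subgraph S G" "H \<in> \<H>" "isomorphic S H" "edges S = Y" using \<P>(1) \<open>Y \<in> \<P>\<close> unfolding X_def by blast
    then show ?thesis using k isomorphic_card by metis
  qed
  have free: "family_free \<H> (delete_edges G (\<Union>\<P>))"
    unfolding family_free_def
  proof (intro notI, elim bexE exE conjE)
    fix H S assume H: "H \<in> \<H>" and S: "subgraph S (delete_edges G (\<Union>\<P>))" "isomorphic S H"
    then have "subgraph S G" unfolding subgraph_def delete_edges_def by auto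
    then have "edges S \<in> X" using H S(2) unfolding X_def by blast
    then have "edges S \<inter> \<Union>\<P> \<noteq> {}" by (rule \<P>(3))
    then show False using S(1) unfolding subgraph_def delete_edges_def by auto
  qed
  have "\<Union>\<P> \<subseteq> edges G" using copy unfolding subgraph_def by blast
  then have "\<epsilon> * card (verts G) < card (\<Union>\<P>)"
    using far free unfolding far_from_family_free_def by simp
  also have "real (card (\<Union>\<P>)) \<le> 2 ^ k * card \<P>"
  proof -
    have "card Y \<le> 2 ^ k" if Y: "Y \<in> \<P>" for Y
    proof -
      obtain S where S: "simple_graph S" "edges S = Y" "card (verts S) \<le> k"
        using copy[OF Y] unfolding subgraph_def by blast
      then have "Y \<subseteq> Pow (verts S)" "finite (verts S)" unfolding simple_graph_def by auto
      then have "card Y \<le> 2 ^ card (verts S)" using card_mono[of "Pow (verts S)" Y] by (simp add: card_Pow)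
      also have "\<dots> \<le> 2 ^ k" using S(3) by (intro power_increasing) auto
      finally show ?thesis .
    qed
    then have "(\<Sum>Y\<in>\<P>. card Y) \<le> (\<Sum>Y\<in>\<P>. 2 ^ k)" by (rule sum_mono)
    moreover have "card (\<Union>\<P>) \<le> (\<Sum>Y\<in>\<P>. card Y)" by (rule card_Union_le_sum_card)
    ultimately have "card (\<Union>\<P>) \<le> 2 ^ k * card \<P>" by (simp add: mult.commute)
    then have "real (card (\<Union>\<P>)) \<le> real (2 ^ k * card \<P>)" by (simp only: of_nat_le_iff)
    then show ?thesis by simp
  qed
  finally show ?thesis by (rule that[OF fin _ \<P>(2) copy])
qed

section \<open>The tester\<close>

lemma pattern_of_edges:
  assumes "simple_graph G" "Y \<subseteq> edges G" "inj_on rk (verts G)" "card (\<Union>Y) \<le> k" "e \<in> pattern_of rk Y"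
  shows "e \<subseteq> {..<k} \<and> card e = 2"
proof -
  let ?W = "\<Union>Y"
  have W: "?W \<subseteq> verts G" using assms(1,2) unfolding simple_graph_def by auto
  then have fin: "finite ?W" using assms(1) unfolding simple_graph_def by (auto intro: finite_subset)
  obtain e' where e': "e' \<in> Y" "e = pos rk ?W ` e'" using assms(5) unfolding pattern_of_def by blast
  have "inj_on (pos rk ?W) ?W" by (rule pos_inj[OF fin inj_on_subset[OF assms(3) W]])
  then have "inj_on (pos rk ?W) e'" using e'(1) by (auto intro: inj_on_subset)
  then have "card e = card e'" unfolding e'(2) by (rule card_image)
  moreover have "card e' = 2" using e'(1) assms(1,2) unfolding simple_graph_def by blast
  moreover have "pos rk ?W y < k" if "y \<in> ?W" for y
    using pos_less_card[OF fin that, of rk] assms(4) by simp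
  ultimately show ?thesis using e' by auto
qed

lemma inv_pos:
  assumes "finite (\<Union>Y)" "inj_on rk (\<Union>Y)"
  defines "f \<equiv> inv_into (\<Union>Y) (pos rk (\<Union>Y))"
  shows "y \<in> \<Union>Y \<Longrightarrow> f (pos rk (\<Union>Y) y) = y"
    and "i \<in> \<Union>(pattern_of rk Y) \<Longrightarrow> f i \<in> \<Union>Y \<and> pos rk (\<Union>Y) (f i) = i"
    and "i \<in> \<Union>(pattern_of rk Y) \<Longrightarrow> j \<in> \<Union>(pattern_of rk Y) \<Longrightarrow> i < j \<Longrightarrow> rk (f i) < rk (f j)"
    and "{i, j} \<in> pattern_of rk Y \<Longrightarrow> {f i, f j} \<in> Y"
proof -
  let ?W = "\<Union>Y" and ?p = "pos rk (\<Union>Y)"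
  have inj: "inj_on ?p ?W" by (rule pos_inj[OF assms(1,2)])
  show 1: "f (?p y) = y" if "y \<in> ?W" for y unfolding f_def using inj that by simp
  show 2: "f i \<in> ?W \<and> ?p (f i) = i" if i: "i \<in> \<Union>(pattern_of rk Y)" for i
  proof -
    obtain y where "y \<in> ?W" "i = ?p y" using i unfolding pattern_of_def by blast
    then show ?thesis using 1 by simp
  qed
  show "rk (f i) < rk (f j)" if ij: "i \<in> \<Union>(pattern_of rk Y)" "j \<in> \<Union>(pattern_of rk Y)" "i < j"
  proof (rule ccontr)
    assume "\<not> ?thesis"
    then consider (less) "rk (f j) < rk (f i)" | (eq) "rk (f j) = rk (f i)" by linarith
    then show False
    proof cases
      case less
      then have "?p (f j) < ?p (f i)" using pos_strict_mono[OF assms(1)] 2[OF ij(2)] by blast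
      then show False using 2[OF ij(1)] 2[OF ij(2)] ij(3) by simp
    next
      case eq
      then have "f j = f i" using inj_onD[OF assms(2)] 2[OF ij(1)] 2[OF ij(2)] by blast
      then show False using 2[OF ij(1)] 2[OF ij(2)] ij(3) by simp
    qed
  qed
  show "{f i, f j} \<in> Y" if ij: "{i, j} \<in> pattern_of rk Y"
  proof -
    obtain e where e: "e \<in> Y" "{i, j} = ?p ` e" using ij unfolding pattern_of_def by blast
    have "f ` ?p ` e = e" unfolding f_def by (rule inv_into_image_cancel[OF inj]) (use e(1) in blast)
    then have "{f i, f j} = e" unfolding e(2)[symmetric] by simp
    then show ?thesis using e(1) by simp
  qed
qed

text \<open>Makes \<open>\<beta> * loss k K\<close> at most the density of copies with a common
  pattern, where \<open>2 ^ k\<close> comes from \<open>edge_disjoint_copies\<close> and the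
  remaining factor from \<open>common_pattern\<close>. The \<open>+ 1\<close> avoids division by
  \<open>0\<close>.\<close>

definition explore_prob :: "nat \<Rightarrow> nat \<Rightarrow> real \<Rightarrow> real" where
  "explore_prob k K \<epsilon> = min 1 (\<epsilon> / (2 ^ k * (2 ^ 2 ^ k * k ^ k)) / (loss k K + 1))"

lemma explore_prob_bounds: "0 < k \<Longrightarrow> 0 < \<epsilon> \<Longrightarrow> 0 < explore_prob k K \<epsilon> \<and> explore_prob k K \<epsilon> \<le> 1"
  unfolding explore_prob_def by simp

text \<open>\<open>col\<close> recovers the position of a vertex from its image, so the discovered
  map is injective and carries the copy into the found edges.\<close>

lemma copy_not_free:
  assumes "simple_graph G" "subgraph S G" "isomorphic S H" "H \<in> \<H>"
    and rk: "inj_on rk (verts G)" and F: "F \<subseteq> edges G"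
    and g: "\<And>i. i \<in> \<Union>(pattern_of rk (edges S)) \<Longrightarrow> col (g i) = i"
      "\<And>i j. {i, j} \<in> pattern_of rk (edges S) \<Longrightarrow> {g i, g j} \<in> F"
  shows "\<not> family_free \<H> (SGraph (verts G) F)"
proof -
  let ?W = "\<Union>(edges S)"
  let ?p = "pos rk ?W"
  have S: "simple_graph S" "verts S \<subseteq> verts G" "edges S \<subseteq> edges G" using assms(2) unfolding subgraph_def by auto
  have V: "finite (verts G)" using assms(1) unfolding simple_graph_def by simp
  have W: "?W \<subseteq> verts G" using S unfolding simple_graph_def by blast
  have inj: "inj_on ?p ?W"
    using pos_inj[OF finite_subset[OF W V] inj_on_subset[OF rk W]] .
  have P: "?p y \<in> \<Union>(pattern_of rk (edges S))" if "y \<in> ?W" for y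
    using that unfolding pattern_of_def by blast
  have im: "(g \<circ> ?p) ` e \<in> F" if e: "e \<in> edges S" for e
  proof -
    have "card e = 2" using e S(1) unfolding simple_graph_def by auto
    then obtain a b where ab: "e = {a, b}" by (meson card_2_iff)
    have "?p ` e \<in> pattern_of rk (edges S)" using e unfolding pattern_of_def by blast
    then have "{?p a, ?p b} \<in> pattern_of rk (edges S)" unfolding ab by simp
    then show ?thesis unfolding ab using g(2) by simp
  qed
  have "inj_on (g \<circ> ?p) ?W"
  proof (rule inj_onI)
    fix x y assume xy: "x \<in> ?W" "y \<in> ?W" "(g \<circ> ?p) x = (g \<circ> ?p) y"
    have eq: "g (?p x) = g (?p y)" using xy(3) unfolding comp_apply .
    have "?p x = col (g (?p x))" using g(1)[OF P[OF xy(1)]] by (rule sym)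
    also have "\<dots> = ?p y" unfolding eq by (rule g(1)[OF P[OF xy(2)]])
    finally show "x = y" using inj_onD[OF inj _ xy(1,2)] by blast
  qed
  moreover have "(g \<circ> ?p) ` ?W \<subseteq> verts G"
  proof (rule image_subsetI)
    fix y assume "y \<in> ?W"
    then obtain e where e: "e \<in> edges S" "y \<in> e" by blast
    have "(g \<circ> ?p) ` e \<in> edges G" using im[OF e(1)] F by (rule rev_subsetD)
    then have "(g \<circ> ?p) ` e \<subseteq> verts G" using assms(1) unfolding simple_graph_def by simp
    then show "(g \<circ> ?p) y \<in> verts G" using e(2) by blast
  qed
  ultimately have "\<exists>S'. subgraph S' (SGraph (verts G) F) \<and> isomorphic S' H"
    by (rule transfer_copy[OF S(1,2) assms(3) V]) (rule im)
  then show ?thesis using assms(4) unfolding family_free_def by blast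
qed

lemma expl_rejects:
  fixes G :: "nat sgraph" and \<H> :: "'b sgraph set"
  assumes G: "simple_graph G" "verts G = {1..n}" and n: "0 < n"
    and t: "bounded_clique_minors (edges G) {1..n} t" and far: "far_from_family_free \<epsilon> \<H> G"
    and \<epsilon>: "0 < \<epsilon>" and k: "\<And>H. H \<in> \<H> \<Longrightarrow> card (verts H) \<le> k" "0 < k"
  defines "K \<equiv> t * (t * (4 * (k * k + 2) + 1))" and "M \<equiv> budget k k"
  shows "(explore_prob k K \<epsilon> / (M + 1)) ^ M \<le> rej G (expl (\<lambda>F. family_free \<H> (SGraph {1..n} F)) n M M [] {})"
proof -
  let ?dec = "\<lambda>F. family_free \<H> (SGraph {1..n} F)"
  define \<beta> where "\<beta> = explore_prob k K \<epsilon>"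
  have \<beta>: "0 < \<beta>" "\<beta> \<le> 1" using explore_prob_bounds[OF k(2) \<epsilon>, of K] unfolding \<beta>_def by auto
  interpret exploration G ?dec n M \<beta> by unfold_locales (use G n \<beta> in auto)
  have "(\<beta> / (M + 1)) ^ M \<le> rej G (expl ?dec n M M [] {})"
  proof (cases "\<exists>S H. subgraph S G \<and> H \<in> \<H> \<and> isomorphic S H \<and> edges S = {}")
    case True
    then obtain S H where S: "subgraph S G" "H \<in> \<H>" "isomorphic S H" "edges S = {}" by blast
    \<comment> \<open>A copy without edges is present over every set of found edges, so every
      outcome of the exploration rejects.\<close>
    have no: "\<not> ?dec F" for F
    proof -
      have "subgraph S (SGraph {1..n} F)" using S(1,4) G(2) unfolding subgraph_def by auto
      then show ?thesis using S(2,3) unfolding family_free_def by blast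
    qed
    have "leadsto (\<lambda>K F. True) M (\<lambda>K F. True)"
      by (rule leadsto_pad[OF leadsto_refl]) (simp_all add: monotone_propI)
    then show ?thesis by (rule rej_expl_leadsto) (rule no)
  next
    case False
    then have ne: "\<And>S H. subgraph S G \<Longrightarrow> H \<in> \<H> \<Longrightarrow> isomorphic S H \<Longrightarrow> edges S \<noteq> {}" by blast
    obtain \<P> where \<P>: "finite \<P>" "\<epsilon> * card (verts G) < 2 ^ k * card \<P>"
      "\<And>Y Y'. Y \<in> \<P> \<Longrightarrow> Y' \<in> \<P> \<Longrightarrow> Y \<noteq> Y' \<Longrightarrow> Y \<inter> Y' = {}"
      "\<And>Y. Y \<in> \<P> \<Longrightarrow> \<exists>S H. subgraph S G \<and> H \<in> \<H> \<and> isomorphic S H \<and> edges S = Y \<and> card (verts S) \<le> k"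
      by (rule edge_disjoint_copies[OF G(1) far k(1) ne]) (assumption | rule that)+
    have sub: "Y \<subseteq> edges G \<and> \<Union>Y \<subseteq> {1..n} \<and> card (\<Union>Y) \<le> k" if Y: "Y \<in> \<P>" for Y
    proof -
      obtain S H where S: "subgraph S G" "edges S = Y" "card (verts S) \<le> k" using \<P>(4)[OF Y] by blast
      then have "finite (verts S)" "\<Union>Y \<subseteq> verts S" unfolding subgraph_def simple_graph_def by auto
      then have "card (\<Union>Y) \<le> k" using card_mono[of "verts S" "\<Union>Y"] S(3) by simp
      then show ?thesis using S \<open>\<Union>Y \<subseteq> verts S\<close> G(2) unfolding subgraph_def by auto
    qed
    obtain rk :: "nat \<Rightarrow> nat" where rk: "inj_on rk {1..n}"
      "\<And>x. x \<in> {1..n} \<Longrightarrow> card {z\<in>{1..n}. rk x < rk z \<and>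
         z \<in> sreach (edges G) {u\<in>{1..n}. rk u < rk x} (k * k + 2) x} \<le> K"
      using rank_exists[OF _ t, of "k * k + 2"] unfolding K_def by auto
    obtain P col where Pc: "real (card \<P>) / (2 ^ 2 ^ k * k ^ k) \<le> card {Y\<in>\<P>. fits rk Y (P, col)}"
      using common_pattern[of "{1..n}" k \<P> rk] \<P>(1) k(2) sub by auto
    define \<Y> where "\<Y> = {Y\<in>\<P>. fits rk Y (P, col)}"
    have "\<epsilon> * n / 2 ^ k < card \<P>" using \<P>(2) G(2) by (simp add: divide_less_eq mult.commute)
    then have "\<epsilon> * n / 2 ^ k / (2 ^ 2 ^ k * k ^ k) < card \<P> / (2 ^ 2 ^ k * k ^ k)"
      using k(2) by (intro divide_strict_right_mono) auto
    then have many: "\<epsilon> / (2 ^ k * (2 ^ 2 ^ k * k ^ k)) * n < card \<Y>"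
      using Pc unfolding \<Y>_def by simp
    have "\<beta> * loss k K * n < card \<Y>"
    proof -
      let ?e = "\<epsilon> / (2 ^ k * (2 ^ 2 ^ k * k ^ k))"
      have "0 < ?e" using \<epsilon> k(2) by simp
      have "\<beta> * loss k K \<le> ?e / (loss k K + 1) * loss k K"
        unfolding \<beta>_def explore_prob_def by (intro mult_right_mono) auto
      also have "\<dots> \<le> ?e"
      proof -
        have "e / (loss k K + 1) * loss k K \<le> e" if "0 < e" for e :: real
          using that by (simp add: field_simps)
        then show ?thesis using \<open>0 < ?e\<close> by blast
      qed
      finally have "\<beta> * loss k K * n \<le> ?e * n" by (rule mult_right_mono) simp
      then show ?thesis using many by linarith
    qed
    have "\<Y> \<noteq> {}"
    proof
      assume "\<Y> = {}"
      then have "\<epsilon> / (2 ^ k * (2 ^ 2 ^ k * k ^ k)) * n < 0" using many by simp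
      moreover have "0 \<le> \<epsilon> / (2 ^ k * (2 ^ 2 ^ k * k ^ k)) * n" using \<epsilon> by simp
      ultimately show False by linarith
    qed
    have fit: "Y \<in> \<P>" "pattern_of rk Y = P" "\<And>y. y \<in> \<Union>Y \<Longrightarrow> col y = pos rk (\<Union>Y) y" if "Y \<in> \<Y>" for Y
      using that unfolding \<Y>_def fits_def by auto
    obtain Y0 where Y0: "Y0 \<in> \<Y>" using \<open>\<Y> \<noteq> {}\<close> by blast
    have P: "e \<subseteq> {..<k} \<and> card e = 2" if "e \<in> P" for e
      using pattern_of_edges[OF G(1), of Y0 rk k e] sub[OF fit(1)[OF Y0]] rk(1) fit(2)[OF Y0] that G(2) by simp
    interpret pruning G ?dec n M \<beta> P k col rk K
      by unfold_locales (use P rk in auto)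
    have fin\<Y>: "finite \<Y>" using \<P>(1) unfolding \<Y>_def by simp
    have "\<exists>Y\<in>\<Y>. Y \<subseteq> final"
    proof (rule surviving_copy[OF fin\<Y>])
      show "Y \<subseteq> edges G" if "Y \<in> \<Y>" for Y using sub fit(1)[OF that] by blast
      show "Y \<inter> Y' = {}" if "Y \<in> \<Y>" "Y' \<in> \<Y>" "Y \<noteq> Y'" for Y Y'
        using \<P>(3) fit(1) that by blast
    qed fact
    then obtain Y where Y: "Y \<in> \<Y>" "Y \<subseteq> final" by blast
    note Yf = fit[OF Y(1)]
    have W: "finite (\<Union>Y)" "\<Union>Y \<subseteq> {1..n}" "inj_on rk (\<Union>Y)"
      using sub[OF Yf(1)] rk(1) by (auto intro: finite_subset inj_on_subset)
    let ?f = "inv_into (\<Union>Y) (pos rk (\<Union>Y))"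
    note inv = inv_pos[OF W(1,3), unfolded Yf(2)]
    have "leadsto (\<lambda>K F. True) M
      (\<lambda>K F. \<exists>g. (\<forall>i\<in>\<Union>P. col (g i) = i) \<and> (\<forall>i j. {i, j} \<in> P \<longrightarrow> {g i, g j} \<in> F))"
    proof (rule leadsto_pattern[of ?f, folded M_def])
      show "col (?f i) = i \<and> ?f i \<in> {1..n}" if "i \<in> \<Union>P" for i
        using inv(2)[OF that] Yf(3) W(2) by auto
      show "rk (?f i) < rk (?f j)" if "i \<in> \<Union>P" "j \<in> \<Union>P" "i < j" for i j
        using inv(3)[OF that] .
      show "{?f i, ?f j} \<in> final" if "{i, j} \<in> P" for i j
        using inv(4)[OF that] Y(2) by blast
    qed
    then show ?thesis
    proof (rule rej_expl_leadsto)
      fix K' F assume c: "consistent K' F"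
        and "\<exists>g. (\<forall>i\<in>\<Union>P. col (g i) = i) \<and> (\<forall>i j. {i, j} \<in> P \<longrightarrow> {g i, g j} \<in> F)"
      then obtain g where g: "\<And>i. i \<in> \<Union>P \<Longrightarrow> col (g i) = i" "\<And>i j. {i, j} \<in> P \<Longrightarrow> {g i, g j} \<in> F" by blast
      obtain S H where S: "subgraph S G" "H \<in> \<H>" "isomorphic S H" "edges S = Y" using \<P>(4)[OF Yf(1)] by blast
      have "\<not> family_free \<H> (SGraph (verts G) F)"
        using copy_not_free[OF G(1) S(1,3,2), of rk F col g] rk(1) G(2) c g Yf(2) S(4)
        unfolding consistent_def by simp
      then show "\<not> ?dec F" using G(2) by simp
    qed
  qed
  then show ?thesis unfolding \<beta>_def .
qed

theorem theorem9p2: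
  fixes L :: "'a sgraph" and \<H> :: "'b sgraph set"
  assumes "simple_graph L"
    and "finite \<H>" and "\<forall>H\<in>\<H>. simple_graph H"
  shows "\<exists>(T :: real \<Rightarrow> nat \<Rightarrow> query_alg) (q :: real \<Rightarrow> nat).
    \<forall>\<epsilon> n (G :: nat sgraph).
      \<epsilon> > 0 \<longrightarrow> simple_graph G \<longrightarrow> verts G = {1..n} \<longrightarrow> minor_free L G \<longrightarrow>
        (\<forall>(b, m) \<in> set_pmf (run G (T \<epsilon> n)). m \<le> q \<epsilon>) \<and>
        (family_free \<H> G \<longrightarrow>
           measure_pmf.prob (run G (T \<epsilon> n)) {(b, m). b} = 1) \<and>
        (far_from_family_free \<epsilon> \<H> G \<longrightarrow>
           measure_pmf.prob (run G (T \<epsilon> n)) {(b, m). \<not> b} \<ge> 2 / 3)"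
proof -
  define t where "t = card (verts L)"
  \<comment> \<open>The sum bounds every member of the family; \<open>Suc\<close> keeps
    \<open>k\<close> positive for an empty one.\<close>
  define k where "k = Suc (\<Sum>H\<in>\<H>. card (verts H))"
  \<comment> \<open>The bound of \<open>rank_exists\<close> for the radius
    \<open>k * k + 2\<close>.\<close>
  define K where "K = t * (t * (4 * (k * k + 2) + 1))"
  define M where "M = budget k k"
  define \<eta> where "\<eta> \<epsilon> = (explore_prob k K \<epsilon> / (M + 1)) ^ M" for \<epsilon>
  \<comment> \<open>Enough repetitions to bring the acceptance probability of far inputs down to
    \<open>1 / 3\<close>; for fixed \<open>L\<close> and \<open>\<H>\<close> the number depends on
    \<open>\<epsilon>\<close> alone.\<close>
  define N where "N \<epsilon> = (SOME N. (1 - \<eta> \<epsilon>) ^ N \<le> 1 / 3)" for \<epsilon>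
  define dec where "dec n F \<longleftrightarrow> family_free \<H> (SGraph {1..n} F)" for n :: nat and F
  \<comment> \<open>For \<open>n = 0\<close> there is no vertex to draw, and the graph is known
    without queries.\<close>
  define A where "A n = (if n = 0 then Decide (dec n {}) else expl (dec n) n M M [] {})" for n
  define T where "T \<epsilon> n = rep_alg (N \<epsilon>) (A n)" for \<epsilon> n
  have k: "0 < k" "card (verts H) \<le> k" if "H \<in> \<H>" for H
    using member_le_sum[of H \<H> "\<lambda>H. card (verts H)"] that assms(2) unfolding k_def by auto
  have "0 < k" unfolding k_def by simp
  have N: "0 \<le> 1 - \<eta> \<epsilon>" "(1 - \<eta> \<epsilon>) ^ N \<epsilon> \<le> 1 / 3" if "0 < \<epsilon>" for \<epsilon>
  proof -
    have "0 < explore_prob k K \<epsilon>" "explore_prob k K \<epsilon> \<le> 1"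
      using explore_prob_bounds[OF \<open>0 < k\<close> that] by auto
    then have "0 < explore_prob k K \<epsilon> / (M + 1)" "explore_prob k K \<epsilon> / (M + 1) \<le> 1" by auto
    then have \<eta>: "0 < \<eta> \<epsilon>" "\<eta> \<epsilon> \<le> 1" unfolding \<eta>_def by (auto intro: power_le_one)
    then show "0 \<le> 1 - \<eta> \<epsilon>" by simp
    obtain N0 where "(1 - \<eta> \<epsilon>) ^ N0 < 1 / 3" using real_arch_pow_inv[of "1 / 3" "1 - \<eta> \<epsilon>"] \<eta> by auto
    then have "(1 - \<eta> \<epsilon>) ^ N0 \<le> 1 / 3" by (rule less_imp_le)
    then show "(1 - \<eta> \<epsilon>) ^ N \<epsilon> \<le> 1 / 3" unfolding N_def by (rule someI)
  qed
  have queries: "m \<le> M" if "(b, m) \<in> set_pmf (run G (A n))" for b m n and G :: "nat sgraph"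
    using that expl_queries unfolding A_def by (auto split: if_splits)
  have accepts: "acc G (T \<epsilon> n) = 1"
    if G: "simple_graph G" "verts G = {1..n}" "family_free \<H> G" for \<epsilon> n and G :: "nat sgraph"
  proof -
    have dec: "dec n F" if "F \<subseteq> edges G" for F
    proof -
      have "subgraph S G" if "subgraph S (SGraph {1..n} F)" for S
        using that \<open>F \<subseteq> edges G\<close> G(2) unfolding subgraph_def by auto
      then show ?thesis using G(3) unfolding dec_def family_free_def by blast
    qed
    have "b" if "(b, m) \<in> set_pmf (run G (A n))" for b m
      using that dec[of "{}"] expl_sound[of G "dec n" "{}" b m n M M "[]", OF G(1) dec]
      unfolding A_def by (auto split: if_splits)
    then have "acc G (A n) = 1"
      unfolding acc_def by (subst measure_pmf.prob_eq_1) (auto simp: AE_measure_pmf_iff)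
    then show ?thesis unfolding T_def acc_rep_alg by simp
  qed
  have rejects: "2 / 3 \<le> rej G (T \<epsilon> n)"
    if G: "0 < \<epsilon>" "simple_graph G" "verts G = {1..n}" "minor_free L G" "far_from_family_free \<epsilon> \<H> G"
    for \<epsilon> n and G :: "nat sgraph"
  proof -
    have "\<eta> \<epsilon> \<le> rej G (A n)"
    proof (cases "n = 0")
      case True
      have "edges G = {}" using G(2,3) True unfolding simple_graph_def by fastforce
      then have "G = SGraph {1..n} {}" using G(3) by (metis sgraph.collapse)
      \<comment> \<open>Deleting nothing costs \<open>0\<close>, which does not exceed
        \<open>\<epsilon> * 0\<close>; so a far graph without vertices is not free.\<close>
      moreover have "\<not> family_free \<H> (delete_edges G {})"
        using G(3,5) True unfolding far_from_family_free_def by fastforce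
      ultimately have "\<not> dec n {}" unfolding dec_def delete_edges_def by simp
      then have "rej G (A n) = 1" using True unfolding A_def by (simp add: rej_def measure_return)
      then show ?thesis using N(1)[OF G(1)] by simp
    next
      case False
      have "bounded_clique_minors (edges G) {1..n} t"
        unfolding bounded_clique_minors_def t_def
        using minor_free_card_touching[OF assms(1) G(2,4)] G(3) by auto
      then show ?thesis
        using expl_rejects[OF G(2,3) _ _ G(5,1) k(2) \<open>0 < k\<close>, of t] False
        unfolding \<eta>_def A_def K_def M_def dec_def by simp
    qed
    then have "acc G (A n) \<le> 1 - \<eta> \<epsilon>" unfolding acc_rej by simp
    then have "acc G (T \<epsilon> n) \<le> (1 - \<eta> \<epsilon>) ^ N \<epsilon>"
      unfolding T_def acc_rep_alg by (intro power_mono) (auto simp: acc_def)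
    then show ?thesis using N(2)[OF G(1)] unfolding acc_rej by simp
  qed
  show ?thesis
  proof (rule exI[of _ T], rule exI[of _ "\<lambda>\<epsilon>. N \<epsilon> * M"], intro allI impI conjI ballI)
    fix \<epsilon> n and G :: "nat sgraph" and x
    assume "x \<in> set_pmf (run G (T \<epsilon> n))"
    then show "case x of (b, m) \<Rightarrow> m \<le> N \<epsilon> * M"
      using queries_rep_alg[OF queries] unfolding T_def by (cases x) auto
  next
    fix \<epsilon> n and G :: "nat sgraph"
    assume "simple_graph G" "verts G = {1..n}" "family_free \<H> G"
    then show "measure_pmf.prob (run G (T \<epsilon> n)) {(b, m). b} = 1"
      using accepts unfolding acc_def by blast
  next
    fix \<epsilon> :: real and n and G :: "nat sgraph"
    assume "0 < \<epsilon>" "simple_graph G" "verts G = {1..n}" "minor_free L G" "far_from_family_free \<epsilon> \<H> G"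
    then show "2 / 3 \<le> measure_pmf.prob (run G (T \<epsilon> n)) {(b, m). \<not> b}"
      using rejects unfolding rej_def by blast
  qed
qed

end
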